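(* Fix $q\in(0,1)$ and let $\mathcal F:\mathbb R\to\mathbb R$ and $\Phi_-:\mathbb R\to\mathbb R\cup\{+\infty\}$ be the functions defined in the context. The function $\mathcal F$ is (weakly) decreasing, non-negative, convex, and continuously differentiable, with derivative $\mathcal F'$ being $\log(q^{-1})$-Lipschitz. Moreover, there exists $x_q\in\mathbb R$ such that $$\mathcal F(x)=(1-q)+\log(q^{-1})\,\frac{x^2}{2}\qquad\text{for all }x\le x_q.$$ Furthermore, for all $x\in\mathbb R$, $$\mathcal F(x)=\inf_{y\in\mathbb R}\Big\{\Phi_-(y)+\frac{\log q^{-1}}{2}(x-y)^2\Big\}.$$
   Context: **The function $\mathcal F$.** Let $\mathcal Y_1$ be the set of (weakly) decreasing functions $\phi:[0,\infty)\to[0,\infty)$ with $\int_0^\infty\phi(x)\,dx=1$. For $\phi\in\mathcal Y_1$ put $\phi^{-1}(y)=\inf\{x\ge0:\phi(x)\le y\}$, and define the hook integral $$I_{\mathrm{hook}}(\phi)=\int_0^\infty dx\int_0^{\phi(x)}dy\,\log\big(\phi(x)+\phi^{-1}(y)-x-y\big)\in(-\infty,+\infty].$$ With $[a]_+=\max\{a,0\}$ define $$\mathcal V^{(q)}(x;\phi)=\log (q^{-1})\int_0^\infty[\phi(y)-y-x]_+\,dy,$$ $$\mathcal W^{(q)}(\kappa,\phi;x)=1+\kappa\log\kappa+2\kappa I_{\mathrm{hook}}(\phi)+\kappa\,\mathcal V^{(q)}(x/\sqrt\kappa;\phi),\qquad \kappa>0,\ \phi\in\mathcal Y_1,\ x\in\mathbb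 R,$$ $$\mathcal F(x)=\inf_{\kappa>0}\ \inf_{\phi\in\mathcal Y_1}\ \mathcal W^{(q)}(\kappa,\phi;x).$$ **The function $\Phi_-$.** $\Phi_-(\mu)=\sup_{y\in\mathbb R}\big\{\mathcal F(y)-\frac{\log q^{-1}}{2}(\mu-y)^2\big\}$ for $\mu\in\mathbb R$. (In the paper this is the lower-tail large deviation rate function, with speed $t^2$, of the height at the origin of the $q$-deformed polynuclear growth with intensity $2(1-q)$ and droplet initial condition.) *)

theory Defs
  imports "HOL-Analysis.Analysis"
begin

text \<open>
  A function on \<open>[0,\<infinity>)\<close> is represented by a total function on the reals; every definition below
  only looks at its values on \<open>{0..}\<close>.
\<close>

definition Y1 :: "(real \<Rightarrow> real) set" where
  "Y1 = {\<phi>. antimono_on {0..} \<phi> \<and> (\<forall>x\<ge>0. 0 \<le> \<phi> x) \<and>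
             set_integrable lborel {0..} \<phi> \<and> (LBINT x:{0..}. \<phi> x) = 1}"

text \<open>
  For \<open>\<phi> \<in> Y1\<close> and \<open>y > 0\<close> the set below is nonempty and bounded below. At \<open>y = 0\<close> it may be empty,
  and the value is then irrelevant, since only integrals over \<open>y\<close> are taken.
\<close>

definition gen_inv :: "(real \<Rightarrow> real) \<Rightarrow> real \<Rightarrow> real" where
  "gen_inv \<phi> y = Inf {x. 0 \<le> x \<and> \<phi> x \<le> y}"

definition hook :: "(real \<Rightarrow> real) \<Rightarrow> real \<Rightarrow> real \<Rightarrow> real" where
  "hook \<phi> x y = \<phi> x + gen_inv \<phi> y - x - y"

text \<open>
  The integral takes values in \<open>(-\<infinity>,\<infinity>]\<close>, so it is the integral of the positive part of the
  logarithm minus the integral of its negative part (\<open>ennreal\<close> truncates at \<open>0\<close>). For \<open>\<phi> \<in> Y1\<close> the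
  latter is at most \<open>2\<close>, so \<open>\<infinity> - \<infinity>\<close> does not arise. On \<open>0 < y < \<phi> x\<close> the hook is positive;
  the convention \<open>ln 0 = 0\<close> can matter only on a null set.
\<close>

definition I_hook :: "(real \<Rightarrow> real) \<Rightarrow> ereal" where
  "I_hook \<phi> =
     enn2ereal (\<integral>\<^sup>+x\<in>{0..}. (\<integral>\<^sup>+y\<in>{0..\<phi> x}. ennreal (ln (hook \<phi> x y)) \<partial>lborel) \<partial>lborel) -
     enn2ereal (\<integral>\<^sup>+x\<in>{0..}. (\<integral>\<^sup>+y\<in>{0..\<phi> x}. ennreal (- ln (hook \<phi> x y)) \<partial>lborel) \<partial>lborel)"

text \<open>The integrand is dominated by \<open>\<phi> y + max (- y - x) 0\<close>, hence integrable for \<open>\<phi> \<in> Y1\<close>.\<close>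

definition V_func :: "real \<Rightarrow> real \<Rightarrow> (real \<Rightarrow> real) \<Rightarrow> real" where
  "V_func q x \<phi> = ln (1 / q) * (LBINT y:{0..}. max (\<phi> y - y - x) 0)"

definition W_func :: "real \<Rightarrow> real \<Rightarrow> (real \<Rightarrow> real) \<Rightarrow> real \<Rightarrow> ereal" where
  "W_func q \<kappa> \<phi> x =
     ereal (1 + \<kappa> * ln \<kappa>) + ereal (2 * \<kappa>) * I_hook \<phi> + ereal (\<kappa> * V_func q (x / sqrt \<kappa>) \<phi>)"

definition F_func :: "real \<Rightarrow> real \<Rightarrow> ereal" where
  "F_func q x = (INF \<kappa>\<in>{0<..}. INF \<phi>\<in>Y1. W_func q \<kappa> \<phi> x)"

definition Phi_minus :: "real \<Rightarrow> real \<Rightarrow> ereal" where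
  "Phi_minus q \<mu> = (SUP y. F_func q y - ereal (ln (1 / q) / 2 * (\<mu> - y)\<^sup>2))"

end

theory Submission
  imports Defs "HOL-Real_Asymp.Real_Asymp"
begin

text \<open>
  Put \<open>\<psi>(u) = \<surd>\<kappa> \<phi>(u/\<surd>\<kappa>)\<close>. This merges \<open>\<kappa>\<close> and \<open>\<phi>\<close> into one decreasing function of mass \<open>\<kappa>\<close>, and
  \<open>W\<close> becomes \<open>1 + E(\<psi>) + log(1/q) \<integral>[\<psi>(u) - u - x]\<^sub>+ du\<close> with \<open>E = 2 I_hook\<close>; by truncation \<open>\<psi>\<close> may be taken
  with compact support. With \<open>a(u) = \<psi>(u) - u\<close> and \<open>\<psi>\<close> supported in \<open>[0,N]\<close>, the continuous version of the
  identity between hook products and differences of shifted parts gives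
  \<open>E(\<psi>) = 2 \<integral> G(a(u) + N) du - \<integral>\<integral> log |a(u) - a(v)| du dv\<close> with \<open>G(t) = t log t - t\<close>. Hence \<open>E\<close> is convex in \<open>\<psi>\<close>,
  and since the area term is jointly convex in \<open>(\<psi>, x)\<close>, so is \<open>F\<close>. For fixed \<open>\<psi>\<close> the area term minus \<open>x\<^sup>2/2\<close>
  is concave in \<open>x\<close>, so \<open>log(1/q) x\<^sup>2/2 - F\<close> is convex as well. The two convexities give differentiability, the
  Lipschitz bound, and (through tangent parabolas) the duality with \<open>\<Phi>\<^sub>-\<close>.

  For the lower bounds, the logarithmic energy of differences is positive because \<open>- log |t|\<close> is a mixture of tent
  functions. Comparing with the Vershik-Kerov-Logan-Shepp shape \<open>\<Omega>\<close> this yields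
  \<open>E(\<psi>) \<ge> E(\<Omega>) + 2 \<integral> (P(a(u)) - P(-u)) du\<close> for a potential \<open>P\<close> whose derivative is a multiple of
  \<open>L(t) = \<integral>\<^sub>0\<^sup>\<pi> log |t - 2 cos \<theta>| d\<theta>\<close>. On \<open>[-2,2]\<close> this \<open>L\<close> is bounded and satisfies \<open>L(t\<^sup>2 - 2) = 2 L(t)\<close>, so it
  vanishes there, and it is positive outside. Rescaling gives \<open>E(\<psi>) \<ge> - s\<^sup>2 + 2 log s mass(\<psi>)\<close> for all \<open>s > 0\<close>, and
  mass far from the origin costs more than \<open>log(1/q)\<close> per unit; so for very negative \<open>x\<close> the minimiser is
  the dilation of \<open>\<Omega>\<close> of mass \<open>q\<close>.
\<close>

text \<open>The obstacle is that the logarithm changes sign and is singular on the diagonal, so no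
  integral may be split or exchanged before it is known to be finite. Two devices deal with this.
  The functions \<open>\<psi> u - u\<close> fall with slope at most -1, so they stay within s of a
  given value only on a set of length O(s); this bounds logarithmic integrals uniformly. And the
  logarithm of a length T is written as \<open>ln B - ln (B / T)\<close> with B above all lengths in
  question, so that Tonelli applies to nonnegative integrands and the B terms cancel at the end.
  Logarithmic energies of two competitors are comparable because both push forward Lebesgue measure
  on the same segment [0,N]: total masses agree, and the constants that separate the logarithm from
  a mixture of tents cancel. No minimiser is constructed for general x. The properties of F are
  inherited from each fixed competitor, and cutting off a competitor has to be controlled from one
  side only.\<close>

definition seg :: "real \<Rightarrow> real measure" where
  "seg N = density lborel (indicator {0..N})"

abbreviation seg2 :: "real \<Rightarrow> (real \<times> real) measure" where
  "seg2 N \<equiv> seg N \<Otimes>\<^sub>M seg N"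

lemma sets_seg [simp, measurable_cong]: "sets (seg N) = sets borel" by (simp add: seg_def)
lemma space_seg [simp]: "space (seg N) = UNIV" by (simp add: seg_def)

lemma nn_integral_seg:
  assumes "f \<in> borel_measurable borel"
  shows "(\<integral>\<^sup>+u. f u \<partial>seg N) = (\<integral>\<^sup>+u\<in>{0..N}. f u \<partial>lborel)"
  unfolding seg_def using assms by (subst nn_integral_density) (auto simp: mult.commute)

lemma emeasure_seg:
  "A \<in> sets borel \<Longrightarrow> emeasure (seg N) A = emeasure lborel ({0..N} \<inter> A)"
  unfolding seg_def by (subst emeasure_density) (auto simp: indicator_inter_arith[symmetric] simp flip: indicator_inter_arith)

lemma AE_seg: "(AE u in seg N. Q u) \<longleftrightarrow> (AE u in lborel. u \<in> {0..N} \<longrightarrow> Q u)"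
  unfolding seg_def by (subst AE_density) (auto simp: indicator_def elim!: eventually_mono)

lemma AE_segI: "(\<And>u. 0 \<le> u \<Longrightarrow> u \<le> N \<Longrightarrow> Q u) \<Longrightarrow> AE u in seg N. Q u"
  by (simp add: AE_seg)

lemma finite_measure_seg: "finite_measure (seg N)"
  by (rule finite_measureI) (simp add: emeasure_seg emeasure_lborel_Icc_eq)

text \<open>The carrier stays the whole line and Lebesgue measure is cut down by a density, so one
  borel function serves for every N, while finiteness gives products and Fubini.\<close>

interpretation seg: finite_measure "seg N" for N by (rule finite_measure_seg)
interpretation segp: pair_sigma_finite "seg N" "seg N'" for N N' ..
interpretation seg2: finite_measure "seg2 N" for N by (intro finite_measure_pair_measure finite_measure_seg)

lemma integrable_seg_bounded:
  fixes f :: "real \<Rightarrow> real"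
  assumes "f \<in> borel_measurable borel" "\<And>u. 0 \<le> u \<Longrightarrow> u \<le> N \<Longrightarrow> \<bar>f u\<bar> \<le> C"
  shows "integrable (seg N) f"
  by (rule seg.integrable_const_bound[of _ C]) (use assms in \<open>auto intro: AE_segI\<close>)

lemma seg_alt: "seg N = density lborel (\<lambda>x. ennreal (indicator {0..N} x))"
  by (simp add: seg_def ennreal_indicator)

lemma integral_seg:
  fixes f :: "real \<Rightarrow> real"
  assumes "f \<in> borel_measurable borel"
  shows "(\<integral>u. f u \<partial>seg N) = (LBINT u:{0..N}. f u)"
  unfolding seg_alt set_lebesgue_integral_def
  by (subst integral_density) (use assms in auto)

lemma integrable_seg:
  fixes f :: "real \<Rightarrow> real"
  assumes "f \<in> borel_measurable borel"
  shows "integrable (seg N) f \<longleftrightarrow> set_integrable lborel {0..N} f"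
  unfolding seg_alt set_integrable_def
  by (subst integrable_density) (use assms in auto)

lemma emeasure_seg_UNIV: "0 \<le> N \<Longrightarrow> emeasure (seg N) UNIV = ennreal N"
  by (simp add: emeasure_seg)

lemma measure_seg_UNIV: "0 \<le> N \<Longrightarrow> measure (seg N) UNIV = N"
  by (simp add: measure_def emeasure_seg_UNIV)

lemma integral_seg_id: "0 \<le> N \<Longrightarrow> (\<integral>u. u \<partial>seg N) = N\<^sup>2 / 2"
proof -
  assume N: "0 \<le> N"
  have "(\<integral>u. u \<partial>seg N) = (\<integral>u. u * indicator {0..N} u \<partial>lborel)"
    by (simp add: integral_seg set_lebesgue_integral_def mult.commute)
  also have "\<dots> = N\<^sup>2 / 2 - 0\<^sup>2 / 2"
    by (rule integral_FTC_Icc_nonneg) (use N in \<open>auto intro!: derivative_eq_intros\<close>)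
  finally show ?thesis by simp
qed

lemma id_integrable_seg: "integrable (seg N) (\<lambda>u. u)"
  by (rule integrable_seg_bounded[where C=N]) auto

section \<open>Layer-cake bounds for logarithms\<close>

text \<open>Slope at most -1, without any continuity: the property of \<open>\<psi> u - u\<close>
  for decreasing \<open>\<psi>\<close> that makes its level sets thin.\<close>

definition steep :: "(real \<Rightarrow> real) \<Rightarrow> bool" where
  "steep a \<longleftrightarrow> (\<forall>u v. u \<le> v \<longrightarrow> v - u \<le> a u - a v)"

lemma steepD: "steep a \<Longrightarrow> u \<le> v \<Longrightarrow> v - u \<le> a u - a v"
  by (simp add: steep_def)

lemma steep_abs: "steep a \<Longrightarrow> \<bar>u - v\<bar> \<le> \<bar>a u - a v\<bar>"
  using steepD[of a u v] steepD[of a v u] by linarith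

lemma antimono_borel_measurable:
  fixes f :: "real \<Rightarrow> real"
  assumes "antimono f" shows "f \<in> borel_measurable borel"
proof -
  have "mono (\<lambda>x. - f x)" using assms by (auto simp: mono_def antimono_def)
  from borel_measurable_uminus[OF borel_measurable_mono[OF this]] show ?thesis by simp
qed

lemma steep_measurable: "steep a \<Longrightarrow> a \<in> borel_measurable borel"
  by (rule antimono_borel_measurable) (force simp: antimono_def dest: steepD)

lemma ln_layer:
  fixes T B :: real
  assumes "0 < T" "T \<le> B"
  shows "ennreal (ln (B / T)) = (\<integral>\<^sup>+s\<in>{T..B}. ennreal (1 / s) \<partial>lborel)"
proof -
  have "(\<integral>\<^sup>+s\<in>{T..B}. ennreal (1 / s) \<partial>lborel) = ennreal (ln B - ln T)"
    by (rule nn_integral_FTC_Icc) (use assms in \<open>auto intro!: derivative_eq_intros\<close>)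
  then show ?thesis using assms by (simp add: ln_div)
qed

text \<open>Since 1/s is the derivative of the logarithm, the inner integral on the right is
  \<open>ln (B / T x)\<close> cut into layers. A general measure is allowed because the formula
  serves both for bounds and for exact evaluations.\<close>

lemma layer_swap:
  fixes T :: "'a \<Rightarrow> real"
  assumes "sigma_finite_measure M" and [measurable]: "T \<in> borel_measurable M"
  shows "(\<integral>\<^sup>+s. indicator {0<..B} s * ennreal (1 / s) * emeasure M {x \<in> space M. T x \<le> s} \<partial>lborel) =
    (\<integral>\<^sup>+x. (\<integral>\<^sup>+s. indicator {0<..B} s * ennreal (1 / s) * indicator {T x..} s \<partial>lborel) \<partial>M)"
proof -
  interpret M: sigma_finite_measure M by fact
  interpret pair_sigma_finite lborel M ..
  have "(\<integral>\<^sup>+s. indicator {0<..B} s * ennreal (1 / s) * emeasure M {x \<in> space M. T x \<le> s} \<partial>lborel) =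
    (\<integral>\<^sup>+s. (\<integral>\<^sup>+x. indicator {0<..B} s * ennreal (1 / s) * indicator {T x..} s \<partial>M) \<partial>lborel)"
  proof (rule nn_integral_cong)
    fix s :: real
    have "emeasure M {x \<in> space M. T x \<le> s} = (\<integral>\<^sup>+x. indicator {x \<in> space M. T x \<le> s} x \<partial>M)"
      by simp
    also have "\<dots> = (\<integral>\<^sup>+x. indicator {T x..} s \<partial>M)"
      by (intro nn_integral_cong) (auto simp: indicator_def)
    finally show "indicator {0<..B} s * ennreal (1 / s) * emeasure M {x \<in> space M. T x \<le> s} =
      (\<integral>\<^sup>+x. indicator {0<..B} s * ennreal (1 / s) * indicator {T x..} s \<partial>M)"
      by (subst nn_integral_cmult) (auto simp: indicator_def)
  qed
  also have "\<dots> = (\<integral>\<^sup>+x. (\<integral>\<^sup>+s. indicator {0<..B} s * ennreal (1 / s) * indicator {T x..} s \<partial>lborel) \<partial>M)"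
    by (rule Fubini'[symmetric]) (simp add: indicator_def atLeast_def)
  finally show ?thesis .
qed

lemma layer_le:
  fixes T :: "'a \<Rightarrow> real"
  assumes "sigma_finite_measure M" "T \<in> borel_measurable M" "\<And>x. 0 \<le> T x" "0 < B"
  shows "(\<integral>\<^sup>+x. ennreal (ln (B / T x)) \<partial>M) \<le>
    (\<integral>\<^sup>+s. indicator {0<..B} s * ennreal (1 / s) * emeasure M {x \<in> space M. T x \<le> s} \<partial>lborel)"
  unfolding layer_swap[OF assms(1,2)]
proof (rule nn_integral_mono)
  fix x
  show "ennreal (ln (B / T x)) \<le> (\<integral>\<^sup>+s. indicator {0<..B} s * ennreal (1 / s) * indicator {T x..} s \<partial>lborel)"
  proof (cases "0 < T x \<and> T x \<le> B")
    case True
    then have "ennreal (ln (B / T x)) = (\<integral>\<^sup>+s\<in>{T x..B}. ennreal (1 / s) \<partial>lborel)" by (simp add: ln_layer)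
    also have "\<dots> \<le> (\<integral>\<^sup>+s. indicator {0<..B} s * ennreal (1 / s) * indicator {T x..} s \<partial>lborel)"
      using True by (intro nn_integral_mono) (auto simp: indicator_def)
    finally show ?thesis .
  next
    case False
    \<comment> \<open>At \<open>T x = 0\<close> the convention \<open>ln 0 = 0\<close> makes the
      left side vanish while the layers add up to infinity; this is why only an inequality holds
      here.\<close>
    then have "T x = 0 \<or> B < T x" using assms(3)[of x] by linarith
    then have "ln (B / T x) \<le> 0" using \<open>0 < B\<close> by auto
    then show ?thesis by (simp add: ennreal_neg)
  qed
qed

lemma layer_eq:
  fixes T :: "'a \<Rightarrow> real"
  assumes "sigma_finite_measure M" "T \<in> borel_measurable M" "AE x in M. 0 < T x \<and> T x \<le> B"
  shows "(\<integral>\<^sup>+x. ennreal (ln (B / T x)) \<partial>M) =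
    (\<integral>\<^sup>+s. indicator {0<..B} s * ennreal (1 / s) * emeasure M {x \<in> space M. T x \<le> s} \<partial>lborel)"
  unfolding layer_swap[OF assms(1,2)]
proof (rule nn_integral_cong_AE, use assms(3) in eventually_elim)
  case (elim x)
  then have "ennreal (ln (B / T x)) = (\<integral>\<^sup>+s\<in>{T x..B}. ennreal (1 / s) \<partial>lborel)" by (simp add: ln_layer)
  also have "\<dots> = (\<integral>\<^sup>+s. indicator {0<..B} s * ennreal (1 / s) * indicator {T x..} s \<partial>lborel)"
    using elim by (intro nn_integral_cong) (auto simp: indicator_def)
  finally show ?case .
qed

text \<open>A steep function is within s of t only on a set of length at most 4 s. This cancels the
  weight 1/s in the layer formula and leaves 4 times the length B of the range of s, whatever t
  is.\<close>

lemma steep_log_bound: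
  assumes g: "steep g" and B: "0 < B"
  shows "(\<integral>\<^sup>+v. ennreal (ln (B / \<bar>t - g v\<bar>)) \<partial>lborel) \<le> ennreal (4 * B)"
proof -
  note [measurable] = steep_measurable[OF g]
  have em: "emeasure lborel {x. \<bar>t - g x\<bar> \<le> s} \<le> ennreal (4 * s)" if s: "0 < s" for s
  proof (cases "{x. \<bar>t - g x\<bar> \<le> s} = {}")
    case False
    then obtain x0 where x0: "\<bar>t - g x0\<bar> \<le> s" by auto
    have "{x. \<bar>t - g x\<bar> \<le> s} \<subseteq> {x0 - 2 * s..x0 + 2 * s}"
    proof safe
      fix x assume "\<bar>t - g x\<bar> \<le> s"
      then have "\<bar>x - x0\<bar> \<le> 2 * s" using x0 steep_abs[OF g, of x x0] by linarith
      then show "x \<in> {x0 - 2 * s..x0 + 2 * s}" by auto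
    qed
    then have "emeasure lborel {x. \<bar>t - g x\<bar> \<le> s} \<le> emeasure lborel {x0 - 2 * s..x0 + 2 * s}"
      by (rule emeasure_mono) simp
    also have "\<dots> = ennreal (4 * s)" using s by simp
    finally show ?thesis .
  qed simp
  have "(\<integral>\<^sup>+v. ennreal (ln (B / \<bar>t - g v\<bar>)) \<partial>lborel) \<le>
    (\<integral>\<^sup>+s. indicator {0<..B} s * ennreal (1 / s) * emeasure lborel {x \<in> space lborel. \<bar>t - g x\<bar> \<le> s} \<partial>lborel)"
    using B by (intro layer_le lborel.sigma_finite_measure_axioms) auto
  also have "\<dots> \<le> (\<integral>\<^sup>+s. ennreal 4 * indicator {0<..B} s \<partial>lborel)"
  proof (rule nn_integral_mono)
    fix s :: real
    show "indicator {0<..B} s * ennreal (1 / s) * emeasure lborel {x \<in> space lborel. \<bar>t - g x\<bar> \<le> s}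
      \<le> ennreal 4 * indicator {0<..B} s"
    proof (cases "s \<in> {0<..B}")
      case True
      then have "ennreal (1 / s) * emeasure lborel {x \<in> space lborel. \<bar>t - g x\<bar> \<le> s} \<le> ennreal (1 / s) * ennreal (4 * s)"
        by (intro mult_left_mono) (use em[of s] in auto)
      also have "\<dots> = ennreal 4" using True by (simp flip: ennreal_mult)
      finally show ?thesis using True by simp
    qed simp
  qed
  also have "\<dots> = ennreal 4 * ennreal B"
    using B by (subst nn_integral_cmult_indicator) auto
  also have "\<dots> = ennreal (4 * B)" using B by (subst ennreal_mult) auto
  finally show ?thesis .
qed

lemma abs_ln_le:
  fixes t B :: real
  assumes "\<bar>t\<bar> \<le> B" "1 \<le> B"
  shows "ennreal \<bar>ln \<bar>t\<bar>\<bar> \<le> ennreal (ln (B / \<bar>t\<bar>)) + ennreal (ln B)"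
proof (cases "t = 0")
  case False
  have 1: "ln (B / \<bar>t\<bar>) = ln B - ln \<bar>t\<bar>" using False assms by (simp add: ln_div)
  have 2: "ln \<bar>t\<bar> \<le> ln B" using False assms by simp
  have 3: "0 \<le> ln B" using assms by simp
  have "\<bar>ln \<bar>t\<bar>\<bar> \<le> ln (B / \<bar>t\<bar>) + ln B" using 1 2 3 by linarith
  then show ?thesis using 1 2 3 by (simp flip: ennreal_plus)
qed (use assms in auto)

text \<open>The bound is uniform in t, so it can be integrated once more; this is what makes the
  double logarithmic integral of \<open>pair_log_integrable\<close> finite.\<close>

lemma log_nn_bound:
  assumes g: "steep g" and C: "\<bar>t\<bar> \<le> C" "\<And>v. 0 \<le> v \<Longrightarrow> v \<le> N \<Longrightarrow> \<bar>g v\<bar> \<le> C" and B: "2 * C \<le> B" "1 \<le> B" and N: "0 \<le> N"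
  shows "(\<integral>\<^sup>+v. ennreal \<bar>ln \<bar>t - g v\<bar>\<bar> \<partial>seg N) \<le> ennreal (4 * B + ln B * N)"
proof -
  note [measurable] = steep_measurable[OF g]
  have "(\<integral>\<^sup>+v. ennreal \<bar>ln \<bar>t - g v\<bar>\<bar> \<partial>seg N) \<le> (\<integral>\<^sup>+v. ennreal (ln (B / \<bar>t - g v\<bar>)) + ennreal (ln B) \<partial>seg N)"
  proof (intro nn_integral_mono_AE AE_segI abs_ln_le)
    fix v assume "0 \<le> v" "v \<le> N"
    then show "\<bar>t - g v\<bar> \<le> B" using C(2)[of v] C(1) B(1) by linarith
  qed (use B in auto)
  also have "\<dots> = (\<integral>\<^sup>+v. ennreal (ln (B / \<bar>t - g v\<bar>)) \<partial>seg N) + ennreal (ln B) * ennreal N"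
    using N by (subst nn_integral_add) (auto simp: emeasure_seg)
  also have "\<dots> \<le> ennreal (4 * B) + ennreal (ln B) * ennreal N"
  proof (intro add_mono order_refl)
    have "(\<integral>\<^sup>+v. ennreal (ln (B / \<bar>t - g v\<bar>)) \<partial>seg N) \<le> (\<integral>\<^sup>+v. ennreal (ln (B / \<bar>t - g v\<bar>)) \<partial>lborel)"
      by (subst nn_integral_seg) (auto intro!: nn_integral_mono simp: indicator_def)
    also have "\<dots> \<le> ennreal (4 * B)" using steep_log_bound[OF g] B by simp
    finally show "(\<integral>\<^sup>+v. ennreal (ln (B / \<bar>t - g v\<bar>)) \<partial>seg N) \<le> ennreal (4 * B)" .
  qed
  also have "\<dots> = ennreal (4 * B + ln B * N)" using B N by (simp add: ennreal_mult ennreal_plus)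
  finally show ?thesis .
qed

lemma log_integrable:
  assumes g: "steep g" and C: "\<bar>t\<bar> \<le> C" "\<And>v. 0 \<le> v \<Longrightarrow> v \<le> N \<Longrightarrow> \<bar>g v\<bar> \<le> C" and N: "0 \<le> N"
  shows "integrable (seg N) (\<lambda>v. ln \<bar>t - g v\<bar>)"
proof (rule integrableI_bounded)
  note [measurable] = steep_measurable[OF g]
  show "(\<lambda>v. ln \<bar>t - g v\<bar>) \<in> borel_measurable (seg N)" by measurable
  have "(\<integral>\<^sup>+v. ennreal (norm (ln \<bar>t - g v\<bar>)) \<partial>seg N) \<le> ennreal (4 * max 1 (2*C) + ln (max 1 (2*C)) * N)"
    unfolding real_norm_def by (rule log_nn_bound[OF g C _ _ N]) auto
  then show "(\<integral>\<^sup>+v. ennreal (norm (ln \<bar>t - g v\<bar>)) \<partial>seg N) < \<infinity>"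
    using le_less_trans by fastforce
qed

lemma pair_log_integrable:
  assumes [measurable]: "f \<in> borel_measurable borel" and g: "steep g"
    and f_C: "\<And>u. 0 \<le> u \<Longrightarrow> u \<le> N \<Longrightarrow> \<bar>f u\<bar> \<le> C"
    and g_C: "\<And>v. 0 \<le> v \<Longrightarrow> v \<le> N' \<Longrightarrow> \<bar>g v\<bar> \<le> C" and N: "0 \<le> N" "0 \<le> N'"
  shows "integrable (seg N \<Otimes>\<^sub>M seg N') (\<lambda>p. ln \<bar>f (fst p) - g (snd p)\<bar>)"
proof (rule integrableI_bounded)
  note [measurable] = steep_measurable[OF g]
  define K where "K = 4 * max 1 (2*C) + ln (max 1 (2*C)) * N'"
  have K: "0 \<le> K" using N by (auto simp: K_def intro!: add_nonneg_nonneg mult_nonneg_nonneg)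
  show "(\<lambda>p. ln \<bar>f (fst p) - g (snd p)\<bar>) \<in> borel_measurable (seg N \<Otimes>\<^sub>M seg N')" by measurable
  have "(\<integral>\<^sup>+p. ennreal (norm (ln \<bar>f (fst p) - g (snd p)\<bar>)) \<partial>(seg N \<Otimes>\<^sub>M seg N')) =
    (\<integral>\<^sup>+u. (\<integral>\<^sup>+v. ennreal \<bar>ln \<bar>f u - g v\<bar>\<bar> \<partial>seg N') \<partial>seg N)"
    by (subst seg.nn_integral_fst[symmetric]) auto
  also have "\<dots> \<le> (\<integral>\<^sup>+u. ennreal K \<partial>seg N)"
    unfolding K_def
    by (intro nn_integral_mono_AE AE_segI log_nn_bound[OF g f_C g_C]) (use N in auto)
  also have "\<dots> = ennreal K * ennreal N" using N by (simp add: emeasure_seg)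
  also have "\<dots> < \<infinity>" by (simp add: ennreal_mult_less_top)
  finally show "(\<integral>\<^sup>+p. ennreal (norm (ln \<bar>f (fst p) - g (snd p)\<bar>)) \<partial>(seg N \<Otimes>\<^sub>M seg N')) < \<infinity>" .
qed

text \<open>Steep functions are injective, so a level is hit at most once. This discards the points
  where the argument of the logarithm is 0 and the default \<open>ln 0 = 0\<close> would
  intrude.\<close>

lemma steep_AE_neq:
  assumes g: "steep g" shows "AE v in seg N. g v \<noteq> t"
proof -
  have "{v. g v = t} \<subseteq> {THE v. g v = t}"
  proof
    fix v assume "v \<in> {v. g v = t}"
    then have "(THE v. g v = t) = v" 
    proof (intro the_equality)
      fix w assume "g w = t"
      with \<open>v \<in> {v. g v = t}\<close> steep_abs[OF g, of w v] show "w = v" by simp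
    qed simp
    then show "v \<in> {THE v. g v = t}" by simp
  qed
  then have "finite {v. g v = t}" using finite_subset by blast
  then have "AE v in lborel. v \<notin> {v. g v = t}"
    by (intro AE_not_in finite_imp_null_set_lborel)
  then show ?thesis by (auto simp: AE_seg elim!: eventually_mono)
qed

section \<open>Positive definiteness of the logarithmic energy\<close>

text \<open>The windows [w, w + R] that contain both s and t have w in an interval of length R - |s
  - t|. A tent is therefore an overlap of indicators, which is the source of its positive
  definiteness. The embedding \<open>ennreal\<close> takes the positive part.\<close>

lemma tent_nn_integral:
  fixes s t R :: real
  shows "(\<integral>\<^sup>+w. indicator {w. w \<le> s \<and> s \<le> w + R} w * indicator {w. w \<le> t \<and> t \<le> w + R} w \<partial>lborel) = ennreal (R - \<bar>s - t\<bar>)"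
proof -
  have "(\<integral>\<^sup>+w. indicator {w. w \<le> s \<and> s \<le> w + R} w * indicator {w. w \<le> t \<and> t \<le> w + R} w \<partial>lborel) =
    (\<integral>\<^sup>+w. indicator {max s t - R..min s t} w \<partial>lborel)"
    by (intro nn_integral_cong) (auto simp: indicator_def)
  also have "\<dots> = emeasure lborel {max s t - R..min s t}" by simp
  also have "\<dots> = ennreal (R - \<bar>s - t\<bar>)"
    by (auto simp: emeasure_lborel_Icc_eq ennreal_neg max_def min_def abs_if)
  finally show ?thesis .
qed

text \<open>
  \<open>- ln |t|\<close> up to a constant and a term of order \<open>1/L\<close>; it is the integral of the tents \<open>[R - |t|]\<^sub>+ / R\<^sup>2\<close>
  over \<open>0 < R \<le> L\<close>, each of which is positive definite.
\<close>

definition tent_kernel :: "real \<Rightarrow> real \<Rightarrow> real" where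
  "tent_kernel L t = ln L - ln \<bar>t\<bar> - 1 + \<bar>t\<bar> / L"

lemma tent_kernel_nonneg:
  assumes "t \<noteq> 0" "\<bar>t\<bar> \<le> L" shows "0 \<le> tent_kernel L t"
proof -
  have L: "0 < L" using assms by linarith
  have "ln (\<bar>t\<bar> / L) \<le> \<bar>t\<bar> / L - 1" using assms L by (intro ln_le_minus_one) auto
  then show ?thesis using assms L by (simp add: tent_kernel_def ln_div)
qed

lemma tent_kernel_eq:
  assumes "t \<noteq> 0" "\<bar>t\<bar> \<le> L"
  shows "ennreal (tent_kernel L t) = (\<integral>\<^sup>+R. indicator {0<..L} R * ennreal (1 / R\<^sup>2) * ennreal (R - \<bar>t\<bar>) \<partial>lborel)"
proof -
  have L: "0 < L" using assms by linarith
  have "(\<integral>\<^sup>+R\<in>{\<bar>t\<bar>..L}. ennreal ((R - \<bar>t\<bar>) / R\<^sup>2) \<partial>lborel) = ennreal ((ln L + \<bar>t\<bar> / L) - (ln \<bar>t\<bar> + \<bar>t\<bar> / \<bar>t\<bar>))"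
  proof (rule nn_integral_FTC_Icc[where F="\<lambda>a. ln a + \<bar>t\<bar> / a"])
    fix x assume "x \<in> {\<bar>t\<bar>..L}"
    then have x: "\<bar>t\<bar> \<le> x" "x \<le> L" by auto
    then have "0 < x" using assms by linarith
    then show "((\<lambda>a. ln a + \<bar>t\<bar> / a) has_real_derivative (x - \<bar>t\<bar>) / x\<^sup>2) (at x)"
      by (auto intro!: derivative_eq_intros simp: field_simps power2_eq_square)
    show "0 \<le> (x - \<bar>t\<bar>) / x\<^sup>2" using x by auto
  qed (use assms in auto)
  moreover have "ln L + \<bar>t\<bar> / L - (ln \<bar>t\<bar> + \<bar>t\<bar> / \<bar>t\<bar>) = tent_kernel L t"
    using assms by (simp add: tent_kernel_def)
  moreover have "(\<integral>\<^sup>+R\<in>{\<bar>t\<bar>..L}. ennreal ((R - \<bar>t\<bar>) / R\<^sup>2) \<partial>lborel) =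
    (\<integral>\<^sup>+R. indicator {0<..L} R * ennreal (1 / R\<^sup>2) * ennreal (R - \<bar>t\<bar>) \<partial>lborel)"
  proof (intro nn_integral_cong)
    fix R
    show "ennreal ((R - \<bar>t\<bar>) / R\<^sup>2) * indicator {\<bar>t\<bar>..L} R = indicator {0<..L} R * ennreal (1 / R\<^sup>2) * ennreal (R - \<bar>t\<bar>)"
    proof (cases "R \<in> {\<bar>t\<bar>..L}")
      case True
      then have "R \<in> {0<..L}" using assms by auto
      with True show ?thesis by (simp flip: ennreal_mult)
    next
      case False
      then show ?thesis by (auto simp: indicator_def ennreal_neg)
    qed
  qed
  ultimately show ?thesis by simp
qed

text \<open>The push-forward of Lebesgue measure on [0,N] under f, evaluated on a window of length
  R.\<close>

definition window :: "real \<Rightarrow> (real \<Rightarrow> real) \<Rightarrow> real \<Rightarrow> real \<Rightarrow> real" where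
  "window N f R w = measure (seg N) {u. w \<le> f u \<and> f u \<le> w + R}"

definition tent_energy :: "real \<Rightarrow> real \<Rightarrow> (real \<Rightarrow> real) \<Rightarrow> (real \<Rightarrow> real) \<Rightarrow> ennreal" where
  "tent_energy N L f g = (\<integral>\<^sup>+R. indicator {0<..L} R * ennreal (1 / R\<^sup>2) * (\<integral>\<^sup>+w. ennreal (window N f R w) * ennreal (window N g R w) \<partial>lborel) \<partial>lborel)"

text \<open>After expansion by \<open>tent_nn_integral\<close> the integrand factors, for fixed R
  and w, into a function of u and a function of v. All terms are nonnegative, so the exchanges need
  measurability only.\<close>

lemma tent_energy_eq:
  assumes [measurable]: "f \<in> borel_measurable borel" "g \<in> borel_measurable borel"
  shows "(\<integral>\<^sup>+u. (\<integral>\<^sup>+v. (\<integral>\<^sup>+R. indicator {0<..L} R * ennreal (1 / R\<^sup>2) * ennreal (R - \<bar>f u - g v\<bar>) \<partial>lborel) \<partial>seg N) \<partial>seg N) =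
    tent_energy N L f g"
    (is "?lhs = ?rhs")
proof -
  interpret sl: pair_sigma_finite "seg N" lborel ..
  interpret ls: pair_sigma_finite lborel "seg N" ..
  have "?lhs = (\<integral>\<^sup>+u. (\<integral>\<^sup>+R. (\<integral>\<^sup>+v. indicator {0<..L} R * ennreal (1 / R\<^sup>2) * ennreal (R - \<bar>f u - g v\<bar>) \<partial>seg N) \<partial>lborel) \<partial>seg N)"
    by (intro nn_integral_cong ls.Fubini') measurable
  also have "\<dots> = (\<integral>\<^sup>+R. (\<integral>\<^sup>+u. (\<integral>\<^sup>+v. indicator {0<..L} R * ennreal (1 / R\<^sup>2) * ennreal (R - \<bar>f u - g v\<bar>) \<partial>seg N) \<partial>seg N) \<partial>lborel)"
    by (intro ls.Fubini') measurable
  also have "\<dots> = (\<integral>\<^sup>+R. indicator {0<..L} R * ennreal (1 / R\<^sup>2) * (\<integral>\<^sup>+u. (\<integral>\<^sup>+v. ennreal (R - \<bar>f u - g v\<bar>) \<partial>seg N) \<partial>seg N) \<partial>lborel)"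
    by (intro nn_integral_cong) (simp add: nn_integral_cmult)
  also have "\<dots> = ?rhs"
    unfolding tent_energy_def
  proof (intro nn_integral_cong arg_cong2[where f="(*)"] refl)
    fix R :: real
    let ?I = "\<lambda>s w. indicator {w. w \<le> s \<and> s \<le> w + R} w :: ennreal"
    have "(\<integral>\<^sup>+u. (\<integral>\<^sup>+v. ennreal (R - \<bar>f u - g v\<bar>) \<partial>seg N) \<partial>seg N) =
      (\<integral>\<^sup>+u. (\<integral>\<^sup>+v. (\<integral>\<^sup>+w. ?I (f u) w * ?I (g v) w \<partial>lborel) \<partial>seg N) \<partial>seg N)"
      unfolding tent_nn_integral ..
    also have "\<dots> = (\<integral>\<^sup>+u. (\<integral>\<^sup>+w. (\<integral>\<^sup>+v. ?I (f u) w * ?I (g v) w \<partial>seg N) \<partial>lborel) \<partial>seg N)"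
      by (intro nn_integral_cong ls.Fubini') (simp add: indicator_def)
    also have "\<dots> = (\<integral>\<^sup>+w. (\<integral>\<^sup>+u. (\<integral>\<^sup>+v. ?I (f u) w * ?I (g v) w \<partial>seg N) \<partial>seg N) \<partial>lborel)"
      by (intro ls.Fubini') (simp add: indicator_def)
    also have "\<dots> = (\<integral>\<^sup>+w. ennreal (window N f R w) * ennreal (window N g R w) \<partial>lborel)"
    proof (intro nn_integral_cong)
      fix w
      have W: "(\<integral>\<^sup>+v. ?I (h v) w \<partial>seg N) = ennreal (window N h R w)"
        if [measurable]: "h \<in> borel_measurable borel" for h
      proof -
        have "(\<integral>\<^sup>+v. ?I (h v) w \<partial>seg N) = (\<integral>\<^sup>+v. indicator {u. w \<le> h u \<and> h u \<le> w + R} v \<partial>seg N)"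
          by (intro nn_integral_cong) (auto simp: indicator_def)
        also have "\<dots> = emeasure (seg N) {u. w \<le> h u \<and> h u \<le> w + R}" by simp
        finally show ?thesis by (simp add: window_def seg.emeasure_eq_measure)
      qed
      have "(\<integral>\<^sup>+u. (\<integral>\<^sup>+v. ?I (f u) w * ?I (g v) w \<partial>seg N) \<partial>seg N) = (\<integral>\<^sup>+u. ?I (f u) w * ennreal (window N g R w) \<partial>seg N)"
        by (intro nn_integral_cong, subst nn_integral_cmult, simp add: indicator_def, subst W) auto
      also have "\<dots> = ennreal (window N f R w) * ennreal (window N g R w)"
        by (subst nn_integral_multc, simp add: indicator_def, subst W) auto
      finally show "(\<integral>\<^sup>+u. (\<integral>\<^sup>+v. ?I (f u) w * ?I (g v) w \<partial>seg N) \<partial>seg N) = ennreal (window N f R w) * ennreal (window N g R w)" .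
    qed
    finally show "(\<integral>\<^sup>+u. (\<integral>\<^sup>+v. ennreal (R - \<bar>f u - g v\<bar>) \<partial>seg N) \<partial>seg N) = \<dots>" .
  qed
  finally show ?thesis .
qed

lemma window_measurable [measurable]:
  assumes [measurable]: "f \<in> borel_measurable borel"
  shows "(\<lambda>p. window N f (fst p) (snd p)) \<in> borel_measurable (borel \<Otimes>\<^sub>M borel)"
proof -
  have "(\<lambda>p. measure (seg N) {u \<in> space (seg N). snd p \<le> f u \<and> f u \<le> snd p + fst p}) \<in> borel_measurable (borel \<Otimes>\<^sub>M borel)"
    by (rule seg.measurable_measure) measurable
  then show ?thesis by (simp add: window_def)
qed

text \<open>This is 2ab <= a^2 + b^2 for the two window masses at each R and w. The mixed term
  stands alone on the left because \<open>ennreal\<close> has no usable subtraction.\<close>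

lemma tent_energy_positive:
  assumes [measurable]: "f \<in> borel_measurable borel" "g \<in> borel_measurable borel"
  shows "2 * tent_energy N L f g \<le> tent_energy N L f f + tent_energy N L g g"
proof -
  have m[measurable]: "(\<lambda>w. window N h R w) \<in> borel_measurable borel" if [measurable]: "h \<in> borel_measurable borel" for h R
    using measurable_compose[OF _ window_measurable[OF that], of "\<lambda>w. (R, w)" borel] by simp
  have "2 * tent_energy N L f g = (\<integral>\<^sup>+R. indicator {0<..L} R * ennreal (1 / R\<^sup>2) * (\<integral>\<^sup>+w. 2 * (ennreal (window N f R w) * ennreal (window N g R w)) \<partial>lborel) \<partial>lborel)"
    unfolding tent_energy_def
    by (subst nn_integral_cmult[symmetric]) (auto simp: nn_integral_cmult mult_ac intro!: nn_integral_cong)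
  also have "\<dots> \<le> (\<integral>\<^sup>+R. indicator {0<..L} R * ennreal (1 / R\<^sup>2) * (\<integral>\<^sup>+w. ennreal (window N f R w) * ennreal (window N f R w) + ennreal (window N g R w) * ennreal (window N g R w) \<partial>lborel) \<partial>lborel)"
  proof (intro nn_integral_mono mult_left_mono)
    fix R w
    have nn: "0 \<le> window N h R w" for h by (simp add: window_def)
    have "2 * (ennreal (window N f R w) * ennreal (window N g R w)) = ennreal (2 * (window N f R w * window N g R w))"
      using nn by (simp add: ennreal_mult)
    also have "\<dots> \<le> ennreal (window N f R w * window N f R w + window N g R w * window N g R w)"
      using sum_squares_bound[of "window N f R w" "window N g R w"]
      by (intro ennreal_leI) (simp add: power2_eq_square mult_ac)
    also have "\<dots> = ennreal (window N f R w) * ennreal (window N f R w) + ennreal (window N g R w) * ennreal (window N g R w)"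
      using nn by (simp add: ennreal_mult)
    finally show "2 * (ennreal (window N f R w) * ennreal (window N g R w)) \<le> \<dots>" .
  qed auto
  also have "\<dots> = tent_energy N L f f + tent_energy N L g g"
    unfolding tent_energy_def
    by (subst nn_integral_add[symmetric]) (auto simp: nn_integral_add distrib_left intro!: nn_integral_cong)
  finally show ?thesis .
qed

lemma measure_seg_pair:
  assumes "0 \<le> N" shows "measure (seg2 N) UNIV = N\<^sup>2"
  using seg.emeasure_pair_measure_Times[of UNIV "seg N" UNIV N] assms
  by (simp add: measure_def emeasure_seg_UNIV power2_eq_square ennreal_mult[symmetric])

definition log_pair :: "real \<Rightarrow> (real \<Rightarrow> real) \<Rightarrow> (real \<Rightarrow> real) \<Rightarrow> real" where
  "log_pair N f g = (\<integral>p. ln \<bar>f (fst p) - g (snd p)\<bar> \<partial>seg2 N)"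

lemma AE_pair_seg:
  assumes [measurable]: "Measurable.pred (borel \<Otimes>\<^sub>M borel) (\<lambda>p. Q (fst p) (snd p))"
    and "\<And>u. 0 \<le> u \<Longrightarrow> u \<le> N \<Longrightarrow> AE v in seg N'. Q u v"
  shows "AE p in seg N \<Otimes>\<^sub>M seg N'. Q (fst p) (snd p)"
proof -
  have 1: "AE u in seg N. AE v in seg N'. Q u v" by (rule AE_segI) (rule assms(2))
  have 2: "{p \<in> space (seg N \<Otimes>\<^sub>M seg N'). Q (fst p) (snd p)} \<in> sets (seg N \<Otimes>\<^sub>M seg N')"
    by measurable
  show ?thesis
    using segp.AE_pair_measure[OF 2] 1 by simp
qed

definition dist_pair :: "real \<Rightarrow> (real \<Rightarrow> real) \<Rightarrow> (real \<Rightarrow> real) \<Rightarrow> real" where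
  "dist_pair N f g = (\<integral>p. \<bar>f (fst p) - g (snd p)\<bar> \<partial>seg2 N)"

text \<open>Returns to real numbers once L exceeds all differences. The term
  \<open>(ln L - 1) * N\<^sup>2\<close> is the same for every pair of functions on [0,N], so it
  drops out of the quadratic inequality.\<close>

lemma tent_energy_real:
  assumes f: "steep f" and g: "steep g"
    and f_C: "\<And>u. 0 \<le> u \<Longrightarrow> u \<le> N \<Longrightarrow> \<bar>f u\<bar> \<le> C"
    and g_C: "\<And>v. 0 \<le> v \<Longrightarrow> v \<le> N \<Longrightarrow> \<bar>g v\<bar> \<le> C" and N: "0 \<le> N" and L: "2 * C \<le> L" "0 < L"
  shows "tent_energy N L f g = ennreal ((ln L - 1) * N\<^sup>2 - log_pair N f g + dist_pair N f g / L)" (is ?C)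
    and "0 \<le> (ln L - 1) * N\<^sup>2 - log_pair N f g + dist_pair N f g / L" (is ?D)
proof -
  note [measurable] = steep_measurable[OF f] steep_measurable[OF g]
  note tot = measure_seg_pair[OF N]
  have b: "AE p in seg2 N. \<bar>f (fst p) - g (snd p)\<bar> \<le> 2 * C"
  proof (rule AE_pair_seg)
    fix u assume "0 \<le> u" "u \<le> N"
    show "AE v in seg N. \<bar>f u - g v\<bar> \<le> 2 * C"
    proof (rule AE_segI)
      fix v assume "0 \<le> v" "v \<le> N"
      show "\<bar>f u - g v\<bar> \<le> 2 * C" using f_C[OF \<open>0 \<le> u\<close> \<open>u \<le> N\<close>] g_C[OF \<open>0 \<le> v\<close> \<open>v \<le> N\<close>] by linarith
    qed
  qed measurable
  have ne: "AE p in seg2 N. f (fst p) - g (snd p) \<noteq> 0"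
  proof (rule AE_pair_seg)
    fix u show "AE v in seg N. f u - g v \<noteq> 0" using steep_AE_neq[OF g, where N=N and t="f u"] by (auto elim: eventually_mono)
  qed measurable
  have A: "integrable (seg2 N) (\<lambda>p. \<bar>f (fst p) - g (snd p)\<bar>)"
    by (rule seg2.integrable_const_bound[of _ "2*C"]) (use b in auto)
  have li: "integrable (seg2 N) (\<lambda>p. ln \<bar>f (fst p) - g (snd p)\<bar>)"
    by (rule pair_log_integrable[OF _ g f_C g_C N N]) auto
  have ki: "integrable (seg2 N) (\<lambda>p. tent_kernel L (f (fst p) - g (snd p)))"
    unfolding tent_kernel_def using li A by auto
  have kn: "AE p in seg2 N. 0 \<le> tent_kernel L (f (fst p) - g (snd p))"
    using b ne by eventually_elim (use L in \<open>auto intro: tent_kernel_nonneg\<close>)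
  have val: "(\<integral>p. tent_kernel L (f (fst p) - g (snd p)) \<partial>seg2 N) = 
     (ln L - 1) * N\<^sup>2 - log_pair N f g + dist_pair N f g / L"
    unfolding tent_kernel_def log_pair_def dist_pair_def using li A by (simp add: tot space_pair_measure algebra_simps)
  show ?D using integral_nonneg_AE[OF kn] val by simp
  have "ennreal (\<integral>p. tent_kernel L (f (fst p) - g (snd p)) \<partial>seg2 N) =
     (\<integral>\<^sup>+p. ennreal (tent_kernel L (f (fst p) - g (snd p))) \<partial>seg2 N)"
    by (rule nn_integral_eq_integral[OF ki kn, symmetric])
  also have "\<dots> = (\<integral>\<^sup>+p. (\<integral>\<^sup>+R. indicator {0<..L} R * ennreal (1 / R\<^sup>2) * ennreal (R - \<bar>f (fst p) - g (snd p)\<bar>) \<partial>lborel) \<partial>seg2 N)"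
    by (rule nn_integral_cong_AE, use b ne in eventually_elim) (use L in \<open>auto intro: tent_kernel_eq\<close>)
  also have "\<dots> = (\<integral>\<^sup>+u. (\<integral>\<^sup>+v. (\<integral>\<^sup>+R. indicator {0<..L} R * ennreal (1 / R\<^sup>2) * ennreal (R - \<bar>f u - g v\<bar>) \<partial>lborel) \<partial>seg N) \<partial>seg N)"
    by (subst seg.nn_integral_fst[symmetric]) auto
  also have "\<dots> = tent_energy N L f g"
    by (rule tent_energy_eq) measurable
  finally show ?C using val by simp
qed

lemma ennreal_double_le:
  fixes a b c :: real
  assumes "0 \<le> a" "0 \<le> b" "0 \<le> c" "2 * ennreal a \<le> ennreal b + ennreal c"
  shows "2 * a \<le> b + c"
proof -
  have "ennreal (2 * a) \<le> ennreal (b + c)" using assms by (simp add: ennreal_mult ennreal_plus)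
  then show ?thesis using assms by (subst (asm) ennreal_le_iff) auto
qed

text \<open>Let L grow in the inequality for the tent form: the constants cancel and only distance
  terms divided by L remain as an error.\<close>

lemma log_pair_positive:
  assumes f: "steep f" and g: "steep g"
    and f_C: "\<And>u. 0 \<le> u \<Longrightarrow> u \<le> N \<Longrightarrow> \<bar>f u\<bar> \<le> C"
    and g_C: "\<And>v. 0 \<le> v \<Longrightarrow> v \<le> N \<Longrightarrow> \<bar>g v\<bar> \<le> C" and N: "0 \<le> N"
  shows "log_pair N f f + log_pair N g g \<le> 2 * log_pair N f g"
proof -
  note [measurable] = steep_measurable[OF f] steep_measurable[OF g]
  define X where "X = log_pair N f f + log_pair N g g - 2 * log_pair N f g"
  define Y where "Y = dist_pair N f f + dist_pair N g g
    - 2 * dist_pair N f g"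
  have XL: "X \<le> Y / L" if L: "2 * C \<le> L" "0 < L" for L
  proof -
    have T: "tent_energy N L h k = ennreal ((ln L - 1) * N\<^sup>2 - log_pair N h k + dist_pair N h k / L)"
        "0 \<le> (ln L - 1) * N\<^sup>2 - log_pair N h k + dist_pair N h k / L"
      if "h = f \<or> h = g" "k = f \<or> k = g" for h k
      by (rule tent_energy_real[where C=C]; use that f g f_C g_C N L in blast)+
    have e: "2 * tent_energy N L f g \<le> tent_energy N L f f + tent_energy N L g g"
      by (rule tent_energy_positive) measurable
    have "2 * ennreal ((ln L - 1) * N\<^sup>2 - log_pair N f g + dist_pair N f g / L)
      \<le> ennreal ((ln L - 1) * N\<^sup>2 - log_pair N f f + dist_pair N f f / L)
       + ennreal ((ln L - 1) * N\<^sup>2 - log_pair N g g + dist_pair N g g / L)"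
      using e by (simp add: T(1))
    then have "2 * ((ln L - 1) * N\<^sup>2 - log_pair N f g + dist_pair N f g / L)
      \<le> ((ln L - 1) * N\<^sup>2 - log_pair N f f + dist_pair N f f / L)
       + ((ln L - 1) * N\<^sup>2 - log_pair N g g + dist_pair N g g / L)"
      by (intro ennreal_double_le T(2)) auto
    then show ?thesis by (simp add: X_def Y_def add_divide_distrib diff_divide_distrib)
  qed
  have "X \<le> 0"
  proof (rule ccontr)
    assume "\<not> X \<le> 0"
    then have X: "0 < X" by simp
    \<comment> \<open>The last entry gives |Y| / L <= X / 2, against X <= Y / L; the other entries
      make the tent representation applicable.\<close>
    define L where "L = max (max (2 * C) 1) (2 * \<bar>Y\<bar> / X)"
    have L: "2 * C \<le> L" "0 < L" "2 * \<bar>Y\<bar> / X \<le> L" by (auto simp: L_def)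
    have "X * L \<le> Y" using XL[OF L(1,2)] L(2) by (simp add: pos_le_divide_eq)
    moreover have "2 * \<bar>Y\<bar> \<le> L * X" using L(3) X by (simp add: pos_divide_le_eq)
    moreover have "0 < X * L" using X L(2) by simp
    ultimately show False by (simp add: mult.commute)
  qed
  then show ?thesis by (simp add: X_def)
qed

section \<open>The hook integral as a logarithmic energy\<close>

text \<open>Monotonicity and sign are asked for on the whole line, not only on [0,\<infinity>), so
  that measurability and steepness of \<open>\<psi> u - u\<close> hold there without
  restriction.\<close>

definition shape :: "real \<Rightarrow> (real \<Rightarrow> real) \<Rightarrow> bool" where
  "shape N \<psi> \<longleftrightarrow> 0 < N \<and> antimono \<psi> \<and> (\<forall>x. 0 \<le> \<psi> x) \<and> (\<forall>x\<ge>N. \<psi> x = 0)"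

lemma shapeD:
  assumes "shape N \<psi>"
  shows "0 < N" "antimono \<psi>" "\<And>x. 0 \<le> \<psi> x" "\<And>x. N \<le> x \<Longrightarrow> \<psi> x = 0" "\<And>x y. x \<le> y \<Longrightarrow> \<psi> y \<le> \<psi> x"
    "\<And>x. 0 \<le> x \<Longrightarrow> \<psi> x \<le> \<psi> 0"
  using assms by (auto simp: shape_def antimono_def)

lemma shape_measurable: "shape N \<psi> \<Longrightarrow> \<psi> \<in> borel_measurable borel"
  by (intro antimono_borel_measurable shapeD)

lemma shape_steep: "shape N \<psi> \<Longrightarrow> steep (\<lambda>u. \<psi> u - u)"
  using shapeD(5)[of N \<psi>] by (force simp: steep_def)

lemma shape_abs_le:
  assumes "shape N \<psi>" "0 \<le> u" "u \<le> N"
  shows "\<bar>\<psi> u - u\<bar> \<le> \<psi> 0 + N"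
  using shapeD(3,6)[OF assms(1), of u] assms(2,3) shapeD(1)[OF assms(1)] by linarith

lemma shape_mono: "shape N \<psi> \<Longrightarrow> N \<le> N' \<Longrightarrow> shape N' \<psi>"
  by (auto simp: shape_def)

lemma shape_inv:
  assumes s: "shape N \<psi>" and y: "0 \<le> y"
  shows "0 \<le> gen_inv \<psi> y" "gen_inv \<psi> y \<le> N" "\<And>v. 0 \<le> v \<Longrightarrow> \<psi> v \<le> y \<Longrightarrow> gen_inv \<psi> y \<le> v"
    "\<And>v. y < \<psi> v \<Longrightarrow> v \<le> gen_inv \<psi> y"
proof -
  have N: "N \<in> {x. 0 \<le> x \<and> \<psi> x \<le> y}" using shapeD[OF s] y by auto
  have bd: "bdd_below {x. 0 \<le> x \<and> \<psi> x \<le> y}" by (auto intro: bdd_belowI[of _ 0])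
  show "0 \<le> gen_inv \<psi> y" unfolding gen_inv_def by (rule cInf_greatest) (use N in auto)
  show "gen_inv \<psi> y \<le> N" unfolding gen_inv_def by (rule cInf_lower[OF N bd])
  show "gen_inv \<psi> y \<le> v" if "0 \<le> v" "\<psi> v \<le> y" for v
    unfolding gen_inv_def by (rule cInf_lower[OF _ bd]) (use that in auto)
  show "v \<le> gen_inv \<psi> y" if "y < \<psi> v" for v
    unfolding gen_inv_def
  proof (rule cInf_greatest)
    fix x assume "x \<in> {x. 0 \<le> x \<and> \<psi> x \<le> y}"
    then have "\<psi> x < \<psi> v" using that by auto
    then show "v \<le> x" using shapeD(5)[OF s, of x v] by linarith
  qed (use N in auto)
qed

text \<open>For y < 0 the set in \<open>gen_inv\<close> is empty and its infimum unspecified.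
  Clamping the argument gives a function that is monotone on the whole line, hence
  measurable.\<close>

definition cut_inv :: "(real \<Rightarrow> real) \<Rightarrow> real \<Rightarrow> real" where
  "cut_inv \<psi> y = gen_inv \<psi> (max 0 y)"

lemma cut_inv_measurable: assumes s: "shape N \<psi>" shows "cut_inv \<psi> \<in> borel_measurable borel"
proof (rule antimono_borel_measurable, rule antimonoI)
  fix x y :: real assume xy: "x \<le> y"
  have N: "N \<in> {z. 0 \<le> z \<and> \<psi> z \<le> max 0 x}" using shapeD[OF s] by auto
  show "cut_inv \<psi> y \<le> cut_inv \<psi> x" unfolding cut_inv_def gen_inv_def
    by (rule cInf_superset_mono) (use N xy in \<open>auto intro: bdd_belowI[of _ 0]\<close>)
qed

lemma emeasure_between:
  fixes A :: "real set"
  assumes "A \<in> sets borel" "{l<..<r} \<subseteq> A" "A \<subseteq> {l..r}" "l \<le> r"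
  shows "emeasure lborel A = ennreal (r - l)"
proof (rule antisym)
  have "emeasure lborel A \<le> emeasure lborel {l..r}" using assms by (intro emeasure_mono) auto
  then show "emeasure lborel A \<le> ennreal (r - l)" using assms by simp
  have "emeasure lborel {l<..<r} \<le> emeasure lborel A" using assms by (intro emeasure_mono) auto
  then show "ennreal (r - l) \<le> emeasure lborel A" using assms by simp
qed

text \<open>
  The line through \<open>(0,-c)\<close> of slope one meets the boundary of the shape in exactly one point
  \<open>(v\<^sub>0, v\<^sub>0 - c)\<close>; this is the continuous version of the classical fact that the hook lengths
  of a row and the differences of shifted parts are complementary.
\<close>

lemma row_measure:
  assumes s: "shape N \<psi>" and u: "0 \<le> u" "u < N" and t: "0 < t"
  shows "emeasure lborel {y \<in> {0<..<\<psi> u}. \<psi> u + cut_inv \<psi> y - u - y \<le> t} +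
    emeasure lborel {v \<in> {u<..N}. (\<psi> u - u) - (\<psi> v - v) \<le> t} = ennreal (min t (\<psi> u - u + N))"
proof -
  note [measurable] = shape_measurable[OF s] cut_inv_measurable[OF s]
  let ?Y = "{y \<in> {0<..<\<psi> u}. \<psi> u + cut_inv \<psi> y - u - y \<le> t}"
  let ?V = "{v \<in> {u<..N}. (\<psi> u - u) - (\<psi> v - v) \<le> t}"
  note sD = shapeD[OF s]
  have mY: "?Y \<in> sets borel" by measurable
  have mV: "?V \<in> sets borel" by measurable
  have ci: "cut_inv \<psi> y = gen_inv \<psi> y" if "0 < y" for y using that by (simp add: cut_inv_def)
  have pu: "0 \<le> \<psi> u" using sD by auto
  show ?thesis
  proof (cases "\<psi> u - u + N \<le> t")
    \<comment> \<open>From \<open>\<psi> u - u + N\<close> on, both conditions hold throughout, and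
      the lengths add up to \<open>\<psi> u + (N - u)\<close>.\<close>
    case True
    have "emeasure lborel ?Y = ennreal (\<psi> u - 0)"
    proof (rule emeasure_between[OF mY])
      show "{0<..<\<psi> u} \<subseteq> ?Y"
      proof
        fix y assume y: "y \<in> {0<..<\<psi> u}"
        then have "gen_inv \<psi> y \<le> N" by (intro shape_inv[OF s]) auto
        then show "y \<in> ?Y" using y ci[of y] True by auto
      qed
    qed (use pu in auto)
    moreover have "emeasure lborel ?V = ennreal (N - u)"
    proof (rule emeasure_between[OF mV])
      show "{u<..<N} \<subseteq> ?V"
      proof
        fix v assume v: "v \<in> {u<..<N}"
        then show "v \<in> ?V" using sD(3)[of v] True by auto
      qed
    qed (use u in auto)
    ultimately show ?thesis using True pu u by (simp flip: ennreal_plus)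
  next
    case False
    \<comment> \<open>The difference at v is at most t iff \<open>v - \<psi> v \<le> c\<close>, so w
      is the abscissa of the crossing point and w - c its height. Up to endpoints, the differences
      select v between u and w, the hooks select y between w - c and \<open>\<psi> u\<close>, and
      the two lengths add up to t.\<close>
    define c where "c = t - \<psi> u + u"
    define S where "S = {v \<in> {u..N}. v - \<psi> v \<le> c}"
    define w where "w = Sup S"
    have uS: "u \<in> S" using u t by (auto simp: S_def c_def)
    have bdd: "bdd_above S" by (auto simp: S_def intro: bdd_aboveI[of _ N])
    have wu: "u \<le> w" unfolding w_def by (rule cSup_upper[OF uS bdd])
    have wN: "w \<le> N" unfolding w_def by (rule cSup_least) (use uS in \<open>auto simp: S_def\<close>)
    have above: "c < v - \<psi> v" if "w < v" "v \<le> N" for v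
    proof (rule ccontr)
      assume "\<not> c < v - \<psi> v"
      then have "v \<in> S" using that wu by (auto simp: S_def)
      then have "v \<le> w" unfolding w_def by (intro cSup_upper bdd)
      then show False using that by simp
    qed
    have below: "v - \<psi> v \<le> c" if vw: "v < w" and "u \<le> v" for v
    proof -
      obtain v' where v': "v' \<in> S" "v < v'" by (rule less_cSupE[of v S]) (use vw uS in \<open>auto simp: w_def\<close>)
      then show ?thesis using sD(5)[of v v'] by (auto simp: S_def)
    qed
    have cN: "c < N" using False by (simp add: c_def)
    have cw: "c \<le> w"
    proof (rule ccontr)
      assume "\<not> c \<le> w"
      then have "c < c - \<psi> c" using cN by (intro above) auto
      then show False using sD(3)[of c] by simp
    qed
    have wcu: "w - c \<le> \<psi> u"
    proof -
      have "w \<le> \<psi> u + c" unfolding w_def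
      proof (rule cSup_least)
        fix v assume "v \<in> S"
        then show "v \<le> \<psi> u + c" using sD(5)[of u v] by (auto simp: S_def)
      qed (use uS in auto)
      then show ?thesis by simp
    qed
    have "emeasure lborel ?V = ennreal (w - u)"
    proof (rule emeasure_between[OF mV])
      show "{u<..<w} \<subseteq> ?V"
      proof
        fix v assume v: "v \<in> {u<..<w}"
        then show "v \<in> ?V" using below[of v] wN by (auto simp: c_def)
      qed
      show "?V \<subseteq> {u..w}"
      proof
        fix v assume v: "v \<in> ?V"
        then have "\<not> w < v" using above[of v] by (auto simp: c_def)
        then show "v \<in> {u..w}" using v by auto
      qed
    qed (rule wu)
    moreover have "emeasure lborel ?Y = ennreal (\<psi> u - (w - c))"
    proof (rule emeasure_between[OF mY])
      show "{w - c<..<\<psi> u} \<subseteq> ?Y"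
      proof
        fix y assume y: "y \<in> {w - c<..<\<psi> u}"
        then have y0: "0 < y" using cw by auto
        have "gen_inv \<psi> y \<le> y + c"
        proof (cases "y + c \<le> N")
          case True
          have "c < (y + c) - \<psi> (y + c)" using y True by (intro above) auto
          then show ?thesis using y0 y wu u by (intro shape_inv(3)[OF s]) auto
        next
          case False
          then show ?thesis using shape_inv(2)[OF s, of y] y0 by simp
        qed
        then show "y \<in> ?Y" using y y0 ci[OF y0] by (auto simp: c_def)
      qed
      show "?Y \<subseteq> {w - c..\<psi> u}"
      proof
        fix y assume y: "y \<in> ?Y"
        have "\<not> y < w - c"
        proof
          assume yw: "y < w - c"
          obtain v where v: "v \<in> S" "y + c < v" by (rule less_cSupE[of "y + c" S]) (use uS yw in \<open>auto simp: w_def\<close>)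
          then have "y < \<psi> v" by (auto simp: S_def)
          then have "v \<le> gen_inv \<psi> y" using y by (intro shape_inv(4)[OF s]) auto
          then show False using v y ci[of y] by (auto simp: c_def)
        qed
        then show "y \<in> {w - c..\<psi> u}" using y by auto
      qed
    qed (rule wcu)
    ultimately show ?thesis using False wcu wu t by (simp add: c_def flip: ennreal_plus)
  qed
qed

text \<open>In layers, both integrals have weight 1/t against lengths whose sum is min(t, A) by
  \<open>row_measure\<close>. The range t <= A contributes A, the range from A to B contributes A ln
  (B / A).\<close>

lemma row_identity:
  assumes s: "shape N \<psi>" and u: "0 \<le> u" "u < N" and B: "\<psi> u - u + N \<le> B"
  defines "A \<equiv> \<psi> u - u + N"
  shows "(\<integral>\<^sup>+y\<in>{0<..<\<psi> u}. ennreal (ln (B / (\<psi> u + cut_inv \<psi> y - u - y))) \<partial>lborel) +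
    (\<integral>\<^sup>+v\<in>{u<..N}. ennreal (ln (B / ((\<psi> u - u) - (\<psi> v - v)))) \<partial>lborel) = ennreal (A + A * ln (B / A))"
proof -
  note [measurable] = shape_measurable[OF s] cut_inv_measurable[OF s]
  note sD = shapeD[OF s]
  have A: "0 < A" using sD(3)[of u] u by (simp add: A_def)
  have AB: "A \<le> B" using B by (simp add: A_def)
  have ci: "cut_inv \<psi> y = gen_inv \<psi> y" if "0 < y" for y using that by (simp add: cut_inv_def)
  let ?T1 = "\<lambda>y. \<psi> u + cut_inv \<psi> y - u - y" and ?T2 = "\<lambda>v. (\<psi> u - u) - (\<psi> v - v)"
  let ?k = "\<lambda>t. indicator {0<..B} t * ennreal (1 / t)"
  define D1 where "D1 = density lborel (indicator {0<..<\<psi> u} :: real \<Rightarrow> ennreal)"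
  define D2 where "D2 = density lborel (indicator {u<..N} :: real \<Rightarrow> ennreal)"
  have [measurable_cong]: "sets D1 = sets borel" "sets D2 = sets borel" and sp: "space D1 = UNIV" "space D2 = UNIV"
    by (auto simp: D1_def D2_def)
  have em1: "emeasure D1 X = emeasure lborel {x \<in> {0<..<\<psi> u}. x \<in> X}" if [measurable]: "X \<in> sets borel" for X
    unfolding D1_def by (subst emeasure_density) (auto intro!: arg_cong[where f="emeasure lborel"] simp: Int_def simp flip: indicator_inter_arith)
  have em2: "emeasure D2 X = emeasure lborel {x \<in> {u<..N}. x \<in> X}" if [measurable]: "X \<in> sets borel" for X
    unfolding D2_def by (subst emeasure_density) (auto intro!: arg_cong[where f="emeasure lborel"] simp: Int_def simp flip: indicator_inter_arith)
  have "emeasure D1 UNIV = emeasure lborel {x \<in> {0<..<\<psi> u}. x \<in> UNIV}" by (rule em1) simp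
  also have "{x \<in> {0<..<\<psi> u}. x \<in> UNIV} = {0<..<\<psi> u}" by auto
  finally have t1: "emeasure D1 UNIV = ennreal (\<psi> u)" using sD(3)[of u] by simp
  have "emeasure D2 UNIV = emeasure lborel {x \<in> {u<..N}. x \<in> UNIV}" by (rule em2) simp
  also have "{x \<in> {u<..N}. x \<in> UNIV} = {u<..N}" by auto
  finally have t2: "emeasure D2 UNIV = ennreal (N - u)" using u by simp
  from t1 t2 have f1: "sigma_finite_measure D1" and f2: "sigma_finite_measure D2"
    by (auto intro!: finite_measure.axioms(1) finite_measureI simp: sp)
  have ae1: "AE y in D1. 0 < ?T1 y \<and> ?T1 y \<le> B"
    unfolding D1_def
  proof (subst AE_density, simp, rule AE_I2, rule impI)
    fix y :: real assume "0 < (indicator {0<..<\<psi> u} y :: ennreal)"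
    then have "y \<in> {0<..<\<psi> u}" by (cases "y \<in> {0<..<\<psi> u}") simp_all
    then have y: "0 < y" "y < \<psi> u" by auto
    then show "0 < ?T1 y \<and> ?T1 y \<le> B"
      using shape_inv(2)[OF s, of y] shape_inv(4)[OF s, of y u] AB ci[of y] by (auto simp: A_def)
  qed
  have ae2: "AE v in D2. 0 < ?T2 v \<and> ?T2 v \<le> B"
    unfolding D2_def
  proof (subst AE_density, simp, rule AE_I2, rule impI)
    fix v :: real assume "0 < (indicator {u<..N} v :: ennreal)"
    then have "v \<in> {u<..N}" by (cases "v \<in> {u<..N}") simp_all
    then have v: "u < v" "v \<le> N" by auto
    then show "0 < ?T2 v \<and> ?T2 v \<le> B"
      using sD(3)[of v] sD(5)[of u v] AB by (auto simp: A_def)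
  qed
  have e1: "(\<integral>\<^sup>+y\<in>{0<..<\<psi> u}. ennreal (ln (B / ?T1 y)) \<partial>lborel) = (\<integral>\<^sup>+y. ennreal (ln (B / ?T1 y)) \<partial>D1)"
    unfolding D1_def by (subst nn_integral_density) (auto simp: mult.commute)
  have e2: "(\<integral>\<^sup>+v\<in>{u<..N}. ennreal (ln (B / ?T2 v)) \<partial>lborel) = (\<integral>\<^sup>+v. ennreal (ln (B / ?T2 v)) \<partial>D2)"
    unfolding D2_def by (subst nn_integral_density) (auto simp: mult.commute)
  have [measurable]: "(\<lambda>t. emeasure D1 {y. ?T1 y \<le> t}) \<in> borel_measurable borel"
    using sigma_finite_measure.measurable_emeasure[OF f1, where N=borel and A="\<lambda>t. {y. ?T1 y \<le> t}"] by (simp add: sp)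
  have [measurable]: "(\<lambda>t. emeasure D2 {v. ?T2 v \<le> t}) \<in> borel_measurable borel"
    using sigma_finite_measure.measurable_emeasure[OF f2, where N=borel and A="\<lambda>t. {v. ?T2 v \<le> t}"] by (simp add: sp)
  have "(\<integral>\<^sup>+y\<in>{0<..<\<psi> u}. ennreal (ln (B / ?T1 y)) \<partial>lborel) + (\<integral>\<^sup>+v\<in>{u<..N}. ennreal (ln (B / ?T2 v)) \<partial>lborel) =
    (\<integral>\<^sup>+t. ?k t * emeasure D1 {y. ?T1 y \<le> t} \<partial>lborel) + (\<integral>\<^sup>+t. ?k t * emeasure D2 {v. ?T2 v \<le> t} \<partial>lborel)"
    unfolding e1 e2 using layer_eq[OF f1 _ ae1] layer_eq[OF f2 _ ae2] by (simp add: sp)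
  also have "\<dots> = (\<integral>\<^sup>+t. ?k t * (emeasure D1 {y. ?T1 y \<le> t} + emeasure D2 {v. ?T2 v \<le> t}) \<partial>lborel)"
    by (subst nn_integral_add[symmetric]) (auto simp: distrib_left)
  also have "\<dots> = (\<integral>\<^sup>+t. indicator {0<..A} t + ennreal A * (ennreal (1 / t) * indicator {A<..B} t) \<partial>lborel)"
  proof (rule nn_integral_cong)
    fix t :: real
    show "?k t * (emeasure D1 {y. ?T1 y \<le> t} + emeasure D2 {v. ?T2 v \<le> t}) = indicator {0<..A} t + ennreal A * (ennreal (1 / t) * indicator {A<..B} t)"
    proof (cases "0 < t \<and> t \<le> B")
      case True
      have "emeasure D1 {y. ?T1 y \<le> t} + emeasure D2 {v. ?T2 v \<le> t} = ennreal (min t A)"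
        using row_measure[OF s u, of t] True by (simp add: em1 em2 A_def)
      then show ?thesis using True A by (auto simp: indicator_def min_def simp flip: ennreal_mult)
    next
      case False
      then show ?thesis using A AB by (auto simp: indicator_def)
    qed
  qed
  also have "\<dots> = ennreal A + ennreal A * (\<integral>\<^sup>+t\<in>{A<..B}. ennreal (1 / t) \<partial>lborel)"
    using A by (subst nn_integral_add) (auto simp: nn_integral_cmult)
  also have "(\<integral>\<^sup>+t\<in>{A<..B}. ennreal (1 / t) \<partial>lborel) = (\<integral>\<^sup>+t\<in>{A..B}. ennreal (1 / t) \<partial>lborel)"
  proof (rule nn_integral_cong_AE)
    show "AE t in lborel. ennreal (1 / t) * indicator {A<..B} t = ennreal (1 / t) * indicator {A..B} t"
      using AE_lborel_singleton[of A] by eventually_elim (auto simp: indicator_def)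
  qed
  also have "\<dots> = ennreal (ln (B / A))" using A AB by (simp add: ln_layer)
  also have "ennreal A + ennreal A * ennreal (ln (B / A)) = ennreal (A + A * ln (B / A))"
    using A AB by (simp add: ennreal_mult ennreal_plus)
  finally show ?thesis .
qed

text \<open>The dependence on N is only formal: by \<open>I_hook_eq\<close> this is twice the hook
  integral for every N that bounds the support.\<close>

definition hook_energy :: "real \<Rightarrow> (real \<Rightarrow> real) \<Rightarrow> real" where
  "hook_energy N \<psi> = 2 * (\<integral>u. (\<psi> u - u + N) * ln (\<psi> u - u + N) - (\<psi> u - u + N) \<partial>seg N) - log_pair N (\<lambda>u. \<psi> u - u) (\<lambda>u. \<psi> u - u)"

lemma shape_xlnx_integrable:
  assumes s: "shape N \<psi>"
  shows "integrable (seg N) (\<lambda>u. (\<psi> u - u + N) * ln (\<psi> u - u + N))"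
proof -
  note [measurable] = shape_measurable[OF s]
  note sD = shapeD[OF s]
  define B where "B = max 1 (\<psi> 0 + N)"
  show ?thesis
  proof (rule integrable_seg_bounded[where C="B * B"])
    fix u assume u: "0 \<le> u" "u \<le> N"
    let ?t = "\<psi> u - u + N"
    have t: "0 \<le> ?t" "?t \<le> B" using sD(3)[of u] sD(6)[of u] u by (auto simp: B_def)
    have "\<bar>?t * ln ?t\<bar> \<le> B * B"
    proof (cases "?t = 0")
      case False
      then have t0: "0 < ?t" using t by simp
      have B1: "1 \<le> B * B" "?t * ?t \<le> B * B"
        using t mult_mono[of ?t B ?t B] mult_mono[of 1 B 1 B] by (auto simp: B_def)
      have l: "ln ?t \<le> ?t - 1" by (rule ln_le_minus_one[OF t0])
      have l': "1 - 1 / ?t \<le> ln ?t" using ln_le_minus_one[of "1 / ?t"] t0 by (simp add: ln_div)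
      have "?t * \<bar>ln ?t\<bar> \<le> B * B"
      proof (cases "1 \<le> ?t")
        case True
        then have "?t * \<bar>ln ?t\<bar> \<le> ?t * ?t" using l by (intro mult_left_mono) auto
        then show ?thesis using B1 by linarith
      next
        case False
        then have "?t * \<bar>ln ?t\<bar> \<le> ?t * (1 / ?t - 1)" using l' t0 by (intro mult_left_mono) auto
        also have "\<dots> \<le> 1" using t0 by (simp add: algebra_simps)
        finally show ?thesis using B1 by linarith
      qed
      then show ?thesis using t by (simp add: abs_mult)
    qed (simp add: B_def)
    then show "\<bar>?t * ln ?t\<bar> \<le> B * B" .
  qed measurable
qed

text \<open>F is left open to be \<open>ln\<close> or its negative, so that one argument covers both
  halves of \<open>I_hook\<close>.\<close>

definition hook_int :: "(real \<Rightarrow> real) \<Rightarrow> (real \<Rightarrow> real) \<Rightarrow> ennreal" where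
  "hook_int F \<phi> = (\<integral>\<^sup>+x\<in>{0..}. (\<integral>\<^sup>+y\<in>{0..\<phi> x}. ennreal (F (hook \<phi> x y)) \<partial>lborel) \<partial>lborel)"

lemma I_hook_alt: "I_hook \<phi> = enn2ereal (hook_int ln \<phi>) - enn2ereal (hook_int (\<lambda>t. - ln t) \<phi>)"
  by (simp add: I_hook_def hook_int_def)

text \<open>The kernel is symmetric and the diagonal null, so the pairs u < v carry half of the
  double integral. With B above all differences the logarithm is nonnegative and
  \<open>ennreal\<close> truncates nothing.\<close>

lemma half_log_energy:
  assumes a: "steep a" and C: "\<And>u. 0 \<le> u \<Longrightarrow> u \<le> N \<Longrightarrow> \<bar>a u\<bar> \<le> C" and B: "2 * C \<le> B" "0 < B" and N: "0 \<le> N"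
  defines "Y \<equiv> \<integral>\<^sup>+u. (\<integral>\<^sup>+v\<in>{u<..N}. ennreal (ln (B / (a u - a v))) \<partial>lborel) \<partial>seg N"
  shows "Y = ennreal ((N\<^sup>2 * ln B - log_pair N a a) / 2)" and "log_pair N a a \<le> N\<^sup>2 * ln B"
proof -
  note [measurable] = steep_measurable[OF a]
  have li: "integrable (seg2 N) (\<lambda>p. ln \<bar>a (fst p) - a (snd p)\<bar>)"
    by (rule pair_log_integrable[OF _ a C C N N]) auto
  let ?f = "\<lambda>u v. ennreal (ln (B / \<bar>a u - a v\<bar>))"
  let ?up = "\<lambda>u v. ?f u v * indicator {p. fst p < snd p} (u, v)"
  let ?k = "\<lambda>u v. ln B - ln \<bar>a u - a v\<bar>"
  have "Y = (\<integral>\<^sup>+u. (\<integral>\<^sup>+v. ?up u v \<partial>seg N) \<partial>seg N)" unfolding Y_def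
  proof (intro nn_integral_cong_AE AE_segI)
    fix u assume u: "0 \<le> u" "u \<le> N"
    have "(\<integral>\<^sup>+v. ?up u v \<partial>seg N) = (\<integral>\<^sup>+v\<in>{0..N}. ?up u v \<partial>lborel)" by (rule nn_integral_seg) measurable
    also have "\<dots> = (\<integral>\<^sup>+v\<in>{u<..N}. ennreal (ln (B / (a u - a v))) \<partial>lborel)"
    proof (rule nn_integral_cong)
      fix v show "?up u v * indicator {0..N} v = ennreal (ln (B / (a u - a v))) * indicator {u<..N} v"
        using u steepD[OF a, of u v] by (auto simp: indicator_def)
    qed
    finally show "(\<integral>\<^sup>+v\<in>{u<..N}. ennreal (ln (B / (a u - a v))) \<partial>lborel) = (\<integral>\<^sup>+v. ?up u v \<partial>seg N)" by simp
  qed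
  moreover have "\<dots> = (\<integral>\<^sup>+u. (\<integral>\<^sup>+v. ?up v u \<partial>seg N) \<partial>seg N)" by (rule segp.Fubini') measurable
  ultimately have "2 * Y = (\<integral>\<^sup>+u. (\<integral>\<^sup>+v. ?up u v \<partial>seg N) \<partial>seg N) + (\<integral>\<^sup>+u. (\<integral>\<^sup>+v. ?up v u \<partial>seg N) \<partial>seg N)"
    by (simp add: mult_2)
  also have "\<dots> = (\<integral>\<^sup>+u. (\<integral>\<^sup>+v. ?up u v + ?up v u \<partial>seg N) \<partial>seg N)"
    by (simp add: nn_integral_add)
  also have "\<dots> = (\<integral>\<^sup>+u. (\<integral>\<^sup>+v. ennreal (?k u v) \<partial>seg N) \<partial>seg N)"
  proof (rule nn_integral_cong, rule nn_integral_cong_AE)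
    fix u show "AE v in seg N. ?up u v + ?up v u = ennreal (?k u v)"
      using steep_AE_neq[OF a, where N=N and t="a u"]
    proof eventually_elim
      case (elim v)
      then have "u \<noteq> v" by auto
      then show ?case using elim B by (auto simp: indicator_def abs_minus_commute ln_div)
    qed
  qed
  also have "\<dots> = (\<integral>\<^sup>+p. ennreal (?k (fst p) (snd p)) \<partial>seg2 N)"
    by (subst seg.nn_integral_fst[symmetric]) auto
  finally have Y2: "2 * Y = (\<integral>\<^sup>+p. ennreal (?k (fst p) (snd p)) \<partial>seg2 N)" .
  have nn: "AE p in seg2 N. 0 \<le> ?k (fst p) (snd p)"
  proof (rule AE_pair_seg)
    fix u assume u: "0 \<le> u" "u \<le> N"
    have "AE v in seg N. \<bar>a u - a v\<bar> \<le> B"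
      by (rule AE_segI) (use C[OF u] C B in \<open>fastforce simp: abs_le_iff\<close>)
    with steep_AE_neq[OF a, where N=N and t="a u"] show "AE v in seg N. 0 \<le> ?k u v"
      by eventually_elim (use B in auto)
  qed measurable
  have val: "(\<integral>p. ?k (fst p) (snd p) \<partial>seg2 N) = N\<^sup>2 * ln B - log_pair N a a"
    using li measure_seg_pair[OF N] by (simp add: log_pair_def space_pair_measure)
  define k where "k = (N\<^sup>2 * ln B - log_pair N a a) / 2"
  have k0: "0 \<le> k" using integral_nonneg_AE[OF nn] val by (simp add: k_def)
  then show "log_pair N a a \<le> N\<^sup>2 * ln B" by (simp add: k_def)
  have "2 * Y = ennreal (N\<^sup>2 * ln B - log_pair N a a)"
    unfolding Y2 val[symmetric] using li nn by (intro nn_integral_eq_integral) auto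
  also have "N\<^sup>2 * ln B - log_pair N a a = 2 * k" by (simp add: k_def field_simps)
  also have "ennreal (2 * k) = 2 * ennreal k" using k0 by (simp add: ennreal_mult)
  finally have "Y = ennreal k" by (subst (asm) ennreal_mult_cancel_left) auto
  then show "Y = ennreal ((N\<^sup>2 * ln B - log_pair N a a) / 2)" by (simp add: k_def)
qed

text \<open>Integrate \<open>row_identity\<close> over u. The pairs u < v give half the logarithmic
  energy; the multiples of \<open>ln B\<close> are the area m from the hooks plus N^2/2 from the
  pairs on one side, and the integral of \<open>\<psi> u - u + N\<close>, which is the same number,
  on the other.\<close>

lemma I_hook_eq:
  assumes s: "shape N \<psi>"
  shows "I_hook \<psi> = ereal (hook_energy N \<psi> / 2)"
proof -
  note [measurable] = shape_measurable[OF s] cut_inv_measurable[OF s]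
  note sD = shapeD[OF s]
  define H where "H = \<psi> 0"
  \<comment> \<open>Dominates every hook and every difference, so that the logarithms of
    \<open>B / T\<close> below are nonnegative.\<close>
  define B where "B = max 1 (2 * (\<psi> 0 + N))"
  have "1 \<le> B" "2 * (\<psi> 0 + N) \<le> B" by (auto simp: B_def)
  then have B: "1 \<le> B" "\<psi> 0 + N \<le> B" using sD(1) sD(3)[of 0] by auto
  have H: "0 \<le> H" using sD by (simp add: H_def)
  have N: "0 < N" using sD by simp
  have ci: "cut_inv \<psi> y = gen_inv \<psi> y" if "0 < y" for y using that by (simp add: cut_inv_def)
  let ?h = "\<lambda>u y. \<psi> u + cut_inv \<psi> y - u - y"
  let ?M = "seg N \<Otimes>\<^sub>M seg H"
  let ?a = "\<lambda>u. \<psi> u - u"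
  \<comment> \<open>The open region under the graph is used because hooks are positive there; its
    boundary is null. On it X, the logarithm of the hook, equals \<open>ln B * i - g\<close> with g
    nonnegative.\<close>
  define X where "X = (\<lambda>p::real\<times>real. indicator {p. 0 < snd p \<and> snd p < \<psi> (fst p)} p * ln (?h (fst p) (snd p)))"
  define g where "g = (\<lambda>p::real\<times>real. indicator {p. 0 < snd p \<and> snd p < \<psi> (fst p)} p * ln (B / ?h (fst p) (snd p)))"
  define i where "i = (\<lambda>p::real\<times>real. indicator {p. 0 < snd p \<and> snd p < \<psi> (fst p)} p :: real)"
  have [measurable]: "X \<in> borel_measurable (borel \<Otimes>\<^sub>M borel)" "g \<in> borel_measurable (borel \<Otimes>\<^sub>M borel)" "i \<in> borel_measurable (borel \<Otimes>\<^sub>M borel)"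
    by (auto simp: X_def g_def i_def)
  have hpos: "0 < ?h u y" "?h u y \<le> B" if "0 \<le> u" "u \<le> N" "0 < y" "y < \<psi> u" for u y
  proof -
    have "u \<le> gen_inv \<psi> y" "gen_inv \<psi> y \<le> N" using that by (auto intro: shape_inv[OF s])
    then show "0 < ?h u y" "?h u y \<le> B" using ci[of y] that B sD(6)[of u] by auto
  qed
  have inner: "hook_int F \<psi> = (\<integral>\<^sup>+p. ennreal (i p * F (?h (fst p) (snd p))) \<partial>?M)"
    if [measurable]: "F \<in> borel_measurable borel" for F :: "real \<Rightarrow> real"
  proof -
    let ?R = "\<lambda>u. \<integral>\<^sup>+y\<in>{0..\<psi> u}. ennreal (F (hook \<psi> u y)) \<partial>lborel"
    let ?S = "\<lambda>u. \<integral>\<^sup>+y\<in>{0..H}. ennreal (i (u, y) * F (?h u y)) \<partial>lborel"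
    have "hook_int F \<psi> = (\<integral>\<^sup>+u\<in>{0..N}. ?S u \<partial>lborel)"
      unfolding hook_int_def
    proof (rule nn_integral_cong)
      fix u :: real
      have "?R u = ?S u" if "0 \<le> u"
      proof (rule nn_integral_cong_AE)
        show "AE y in lborel. ennreal (F (hook \<psi> u y)) * indicator {0..\<psi> u} y = ennreal (i (u, y) * F (?h u y)) * indicator {0..H} y"
          using AE_lborel_singleton[of 0] AE_lborel_singleton[of "\<psi> u"]
        proof eventually_elim
          case (elim y)
          then show ?case using sD(6)[OF that] by (auto simp: indicator_def i_def hook_def H_def ci)
        qed
      qed
      moreover have "?S u = 0" if "N \<le> u"
      proof -
        have "i (u, y) = 0" for y using sD(4)[OF that] by (auto simp: i_def indicator_def)
        then show ?thesis by simp
      qed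
      ultimately show "?R u * indicator {0..} u = ?S u * indicator {0..N} u"
        by (cases "0 \<le> u"; cases "u \<le> N") (auto simp: indicator_def)
    qed
    also have "\<dots> = (\<integral>\<^sup>+u. (\<integral>\<^sup>+y. ennreal (i (u, y) * F (?h u y)) \<partial>seg H) \<partial>seg N)"
      by (simp add: nn_integral_seg)
    also have "\<dots> = (\<integral>\<^sup>+p. ennreal (i p * F (?h (fst p) (snd p))) \<partial>?M)"
      by (subst seg.nn_integral_fst[symmetric]) auto
    finally show ?thesis .
  qed
  have gn: "AE p in ?M. 0 \<le> g p" and Xg: "AE p in ?M. X p = ln B * i p - g p"
  proof -
    have "AE p in ?M. 0 \<le> g (fst p, snd p)"
    proof (rule AE_pair_seg)
      fix u assume u: "0 \<le> u" "u \<le> N"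
      show "AE v in seg H. 0 \<le> g (u, v)"
      proof (rule AE_I2)
        fix v show "0 \<le> g (u, v)" using hpos[OF u, of v] by (auto simp: g_def indicator_def)
      qed
    qed measurable
    then show "AE p in ?M. 0 \<le> g p" by simp
    have "AE p in ?M. X (fst p, snd p) = ln B * i (fst p, snd p) - g (fst p, snd p)"
    proof (rule AE_pair_seg)
      fix u assume u: "0 \<le> u" "u \<le> N"
      show "AE v in seg H. X (u, v) = ln B * i (u, v) - g (u, v)"
      proof (rule AE_I2)
        fix v show "X (u, v) = ln B * i (u, v) - g (u, v)"
          using hpos[OF u, of v] B by (auto simp: X_def i_def g_def indicator_def ln_div)
      qed
    qed measurable
    then show "AE p in ?M. X p = ln B * i p - g p" by simp
  qed
  define A where "A = (\<lambda>u. ?a u + N)"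
  have [measurable]: "A \<in> borel_measurable borel" by (simp add: A_def)
  have A0: "0 \<le> A u" "A u \<le> B" if "0 \<le> u" "u \<le> N" for u using that sD(3)[of u] sD(6)[of u] B by (auto simp: A_def)
  have AL: "0 \<le> A u + A u * ln (B / A u)" if "0 \<le> u" "u \<le> N" for u
    using A0[OF that] B by (cases "A u = 0") (auto intro!: add_nonneg_nonneg mult_nonneg_nonneg)
  have AL': "A u + A u * ln (B / A u) = A u + A u * ln B - A u * ln (A u)" if "0 \<le> u" "u \<le> N" for u
    using A0[OF that] B by (cases "A u = 0") (auto simp: ln_div algebra_simps)
  have \<psi>i: "integrable (seg N) \<psi>"
    by (rule integrable_seg_bounded[where C=H]) (use sD(3,6) in \<open>auto simp: H_def\<close>)
  have Ai: "integrable (seg N) A" unfolding A_def using \<psi>i id_integrable_seg by auto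
  have Lni: "integrable (seg N) (\<lambda>u. A u * ln (A u))" using shape_xlnx_integrable[OF s] by (simp add: A_def)
  define m where "m = (\<integral>u. \<psi> u \<partial>seg N)"
  have iA: "(\<integral>u. A u \<partial>seg N) = m + N\<^sup>2 / 2"
    unfolding A_def using \<psi>i id_integrable_seg N by (simp add: m_def integral_seg_id measure_seg_UNIV power2_eq_square)
  define Z where "Z = (\<integral>u. A u * ln (A u) - A u \<partial>seg N)"
  define P where "P = log_pair N ?a ?a"
  have tot: "(\<integral>\<^sup>+u. ennreal (A u + A u * ln (B / A u)) \<partial>seg N) = ennreal ((m + N\<^sup>2 / 2) * ln B - Z)"
  proof -
    have "(\<integral>\<^sup>+u. ennreal (A u + A u * ln (B / A u)) \<partial>seg N) = (\<integral>\<^sup>+u. ennreal (A u + A u * ln B - A u * ln (A u)) \<partial>seg N)"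
      by (intro nn_integral_cong_AE AE_segI) (simp add: AL')
    also have "\<dots> = ennreal (\<integral>u. A u + A u * ln B - A u * ln (A u) \<partial>seg N)"
      using Ai Lni by (intro nn_integral_eq_integral AE_segI) (auto simp: AL AL'[symmetric])
    also have "(\<integral>u. A u + A u * ln B - A u * ln (A u) \<partial>seg N) = (m + N\<^sup>2 / 2) * ln B - Z"
      unfolding Z_def using Ai Lni iA by (simp add: algebra_simps)
    finally show ?thesis .
  qed
  define Y where "Y = (\<integral>\<^sup>+u. (\<integral>\<^sup>+v\<in>{u<..N}. ennreal (ln (B / (?a u - ?a v))) \<partial>lborel) \<partial>seg N)"
  have Yr: "Y = ennreal ((N\<^sup>2 * ln B - P) / 2)" and YP: "0 \<le> N\<^sup>2 * ln B - P"
    using half_log_energy[OF shape_steep[OF s] shape_abs_le[OF s] \<open>2 * (\<psi> 0 + N) \<le> B\<close>] B N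
    by (simp_all add: Y_def P_def)
  have gY: "(\<integral>\<^sup>+p. ennreal (g p) \<partial>?M) + Y = ennreal ((m + N\<^sup>2 / 2) * ln B - Z)"
  proof -
    have "(\<integral>\<^sup>+p. ennreal (g p) \<partial>?M) = (\<integral>\<^sup>+u. (\<integral>\<^sup>+y. ennreal (g (u, y)) \<partial>seg H) \<partial>seg N)"
      by (rule seg.nn_integral_fst[symmetric]) measurable
    also have "\<dots> + Y = (\<integral>\<^sup>+u. (\<integral>\<^sup>+y. ennreal (g (u, y)) \<partial>seg H) + (\<integral>\<^sup>+v\<in>{u<..N}. ennreal (ln (B / (?a u - ?a v))) \<partial>lborel) \<partial>seg N)"
    proof -
      have "(\<lambda>u. \<integral>\<^sup>+v. ennreal (ln (B / (?a u - ?a v))) * indicator {p. fst p < snd p \<and> snd p \<le> N} (u, v) \<partial>lborel) \<in> borel_measurable borel"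
        by measurable
      moreover have "indicator {p. fst p < snd p \<and> snd p \<le> N} (u, v) = (indicator {u<..N} v :: ennreal)" for u v :: real
        by (auto simp: indicator_def)
      ultimately have [measurable]: "(\<lambda>u. \<integral>\<^sup>+v\<in>{u<..N}. ennreal (ln (B / (?a u - ?a v))) \<partial>lborel) \<in> borel_measurable borel"
        by simp
      show ?thesis unfolding Y_def by (subst nn_integral_add) auto
    qed
    also have "\<dots> = (\<integral>\<^sup>+u. ennreal (A u + A u * ln (B / A u)) \<partial>seg N)"
    proof (rule nn_integral_cong_AE)
      have "AE u in seg N. u \<noteq> N" using AE_lborel_singleton[of N] by (auto simp: AE_seg elim!: eventually_mono)
      moreover have "AE u in seg N. 0 \<le> u \<and> u \<le> N" by (rule AE_segI) auto
      ultimately show "AE u in seg N. (\<integral>\<^sup>+y. ennreal (g (u, y)) \<partial>seg H) + (\<integral>\<^sup>+v\<in>{u<..N}. ennreal (ln (B / (?a u - ?a v))) \<partial>lborel)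
          = ennreal (A u + A u * ln (B / A u))"
      proof eventually_elim
        case (elim u)
        have "(\<integral>\<^sup>+y. ennreal (g (u, y)) \<partial>seg H) = (\<integral>\<^sup>+y\<in>{0..H}. ennreal (g (u, y)) \<partial>lborel)"
          by (rule nn_integral_seg) measurable
        also have "\<dots> = (\<integral>\<^sup>+y\<in>{0<..<\<psi> u}. ennreal (ln (B / ?h u y)) \<partial>lborel)"
          using sD(6)[of u] elim by (intro nn_integral_cong) (auto simp: g_def indicator_def H_def)
        finally show ?case
          using row_identity[OF s, of u B] elim B sD(6)[of u] by (simp add: A_def)
      qed
    qed
    finally show ?thesis using tot by simp
  qed
  \<comment> \<open>The sum in \<open>gY\<close> is finite, hence so is each summand. Only now is X
    known to be integrable, so that the two halves of \<open>I_hook\<close> may be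
    subtracted.\<close>
  have gfin: "(\<integral>\<^sup>+p. ennreal (g p) \<partial>?M) < \<infinity>"
    using gY by (cases "(\<integral>\<^sup>+p. ennreal (g p) \<partial>?M) = top") (auto simp: less_top[symmetric])
  have gi: "integrable ?M g"
    by (rule integrableI_nonneg) (use gn gfin in auto)
  have ii: "integrable ?M i"
    by (rule finite_measure.integrable_const_bound[of _ _ 1])
      (auto simp: i_def indicator_def intro: finite_measure_pair_measure finite_measure_seg)
  have im: "(\<integral>p. i p \<partial>?M) = m"
  proof -
    have "(\<integral>\<^sup>+p. ennreal (i p) \<partial>?M) = (\<integral>\<^sup>+u. (\<integral>\<^sup>+y. ennreal (i (u, y)) \<partial>seg H) \<partial>seg N)"
      by (rule seg.nn_integral_fst[symmetric]) measurable
    also have "\<dots> = (\<integral>\<^sup>+u. ennreal (\<psi> u) \<partial>seg N)"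
    proof (intro nn_integral_cong_AE AE_segI)
      fix u assume u: "0 \<le> u" "u \<le> N"
      have "(\<integral>\<^sup>+y. ennreal (i (u, y)) \<partial>seg H) = (\<integral>\<^sup>+y. indicator {0<..<\<psi> u} y \<partial>seg H)"
        by (intro nn_integral_cong) (auto simp: i_def indicator_def)
      also have "\<dots> = emeasure lborel ({0..H} \<inter> {0<..<\<psi> u})" by (simp add: emeasure_seg)
      also have "{0..H} \<inter> {0<..<\<psi> u} = {0<..<\<psi> u}" using sD(6)[of u] u by (auto simp: H_def)
      finally show "(\<integral>\<^sup>+y. ennreal (i (u, y)) \<partial>seg H) = ennreal (\<psi> u)" using sD by simp
    qed
    also have "\<dots> = ennreal m" unfolding m_def using \<psi>i sD by (intro nn_integral_eq_integral) auto
    finally have "(\<integral>\<^sup>+p. ennreal (i p) \<partial>?M) = ennreal m" .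
    moreover have "(\<integral>\<^sup>+p. ennreal (i p) \<partial>?M) = ennreal (\<integral>p. i p \<partial>?M)"
      using ii by (intro nn_integral_eq_integral) (auto simp: i_def)
    moreover have "0 \<le> m" unfolding m_def using sD by (intro Bochner_Integration.integral_nonneg) auto
    moreover have "0 \<le> (\<integral>p. i p \<partial>?M)" by (intro Bochner_Integration.integral_nonneg) (auto simp: i_def)
    ultimately show ?thesis by simp
  qed
  have ig: "(\<integral>p. g p \<partial>?M) + (N\<^sup>2 * ln B - P) / 2 = (m + N\<^sup>2 / 2) * ln B - Z"
  proof -
    have g0: "0 \<le> (\<integral>p. g p \<partial>?M)" using gn by (rule integral_nonneg_AE)
    have "ennreal ((\<integral>p. g p \<partial>?M) + (N\<^sup>2 * ln B - P) / 2) = ennreal ((m + N\<^sup>2 / 2) * ln B - Z)"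
      using gY nn_integral_eq_integral[OF gi gn] Yr YP g0 by (simp add: ennreal_plus)
    moreover have "0 \<le> (m + N\<^sup>2 / 2) * ln B - Z"
    proof -
      have "0 \<le> (\<integral>u. A u + A u * ln B - A u * ln (A u) \<partial>seg N)"
        by (intro integral_nonneg_AE AE_segI) (simp add: AL AL'[symmetric])
      also have "\<dots> = (m + N\<^sup>2 / 2) * ln B - Z"
        unfolding Z_def using Ai Lni iA by (simp add: algebra_simps)
      finally show ?thesis .
    qed
    ultimately show ?thesis using YP g0 by (subst (asm) ennreal_inj) auto
  qed
  have Xi: "integrable ?M X"
    by (rule Bochner_Integration.integrable_cong_AE_imp[where g="\<lambda>p. ln B * i p - g p"]) (use gi ii Xg in auto)
  have "(\<integral>p. X p \<partial>?M) = (\<integral>p. ln B * i p - g p \<partial>?M)"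
    by (rule integral_cong_AE) (use Xg in auto)
  also have "\<dots> = ln B * m - (\<integral>p. g p \<partial>?M)" using gi ii im by simp
  also have "\<dots> = hook_energy N \<psi> / 2"
    using ig by (simp add: hook_energy_def Z_def[unfolded A_def] P_def algebra_simps add_divide_distrib diff_divide_distrib)
  finally have Xv: "(\<integral>p. X p \<partial>?M) = hook_energy N \<psi> / 2" .
  have "I_hook \<psi> = enn2ereal (\<integral>\<^sup>+p. ennreal (X p) \<partial>?M) - enn2ereal (\<integral>\<^sup>+p. ennreal (- X p) \<partial>?M)"
    unfolding I_hook_alt using inner[of ln] inner[of "\<lambda>x. - ln x"] by (simp add: X_def i_def)
  also have "\<dots> = ereal (\<integral>p. X p \<partial>?M)"
  proof -
    have "(\<integral>\<^sup>+p. ennreal (X p) \<partial>?M) \<noteq> top" "(\<integral>\<^sup>+p. ennreal (- X p) \<partial>?M) \<noteq> top"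
      using Xi by (auto simp: real_integrable_def)
    then show ?thesis
      unfolding real_lebesgue_integral_def[OF Xi]
      by (cases "(\<integral>\<^sup>+p. ennreal (X p) \<partial>?M)"; cases "(\<integral>\<^sup>+p. ennreal (- X p) \<partial>?M)") auto
  qed
  finally show ?thesis using Xv by simp
qed

section \<open>Scaling and convexity of the energy\<close>

lemma log_pair_iter:
  assumes [measurable]: "f \<in> borel_measurable borel" and g: "steep g"
    and f_C: "\<And>u. 0 \<le> u \<Longrightarrow> u \<le> N \<Longrightarrow> \<bar>f u\<bar> \<le> C"
    and g_C: "\<And>v. 0 \<le> v \<Longrightarrow> v \<le> N \<Longrightarrow> \<bar>g v\<bar> \<le> C" and N: "0 \<le> N"
  shows "log_pair N f g = (\<integral>u. (\<integral>v. ln \<bar>f u - g v\<bar> \<partial>seg N) \<partial>seg N)"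
    and "integrable (seg N) (\<lambda>u. \<integral>v. ln \<bar>f u - g v\<bar> \<partial>seg N)"
proof -
  have i: "integrable (seg2 N) (\<lambda>(u, v). ln \<bar>f u - g v\<bar>)"
    using pair_log_integrable[OF assms(1) g f_C g_C N N] by (simp add: case_prod_beta')
  show "log_pair N f g = (\<integral>u. (\<integral>v. ln \<bar>f u - g v\<bar> \<partial>seg N) \<partial>seg N)"
    using segp.integral_fst[OF i] by (simp add: log_pair_def case_prod_beta')
  show "integrable (seg N) (\<lambda>u. \<integral>v. ln \<bar>f u - g v\<bar> \<partial>seg N)"
    by (rule segp.integrable_fst[OF i])
qed

lemma integral_seg_scale:
  fixes f :: "real \<Rightarrow> real"
  assumes [measurable]: "f \<in> borel_measurable borel" and c: "0 < c"
  shows "(\<integral>u. f u \<partial>seg (c * N)) = c * (\<integral>u. f (c * u) \<partial>seg N)"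
proof -
  have "(\<integral>u. f u \<partial>seg (c * N)) = c * (\<integral>u. indicator {0..c * N} (c * u) * f (c * u) \<partial>lborel)"
    unfolding integral_seg[OF assms(1)] set_lebesgue_integral_def
    using lborel_integral_real_affine[of c "\<lambda>u. indicator {0..c * N} u * f u" 0] c by simp
  also have "(\<lambda>u. indicator {0..c * N} (c * u) * f (c * u)) = (\<lambda>u. indicator {0..N} u * f (c * u))"
    using c by (auto simp: indicator_def fun_eq_iff zero_le_mult_iff)
  finally show ?thesis by (simp add: integral_seg set_lebesgue_integral_def)
qed

lemma shape_integrable: "shape N \<psi> \<Longrightarrow> integrable (seg K) \<psi>"
  by (rule integrable_seg_bounded[where C="\<psi> 0"]) (auto simp: shape_measurable shapeD)

text \<open>A similarity of the region under the graph: lengths scale by c, areas by the square of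
  c.\<close>

definition dilate :: "real \<Rightarrow> (real \<Rightarrow> real) \<Rightarrow> real \<Rightarrow> real" where
  "dilate c \<psi> x = c * \<psi> (x / c)"

lemma shape_dilate: "shape N \<psi> \<Longrightarrow> 0 < c \<Longrightarrow> shape (c * N) (dilate c \<psi>)"
  by (auto simp: shape_def dilate_def antimono_def divide_right_mono pos_le_divide_eq mult.commute)

lemma dilate_dilate: "0 < c \<Longrightarrow> 0 < d \<Longrightarrow> dilate c (dilate d \<psi>) = dilate (c * d) \<psi>"
  by (simp add: dilate_def fun_eq_iff)

lemma dilate_1 [simp]: "dilate 1 \<psi> = \<psi>"
  by (simp add: dilate_def fun_eq_iff)

lemma mass_dilate:
  assumes "shape N \<psi>" "0 < c"
  shows "(\<integral>u. dilate c \<psi> u \<partial>seg (c * N)) = c\<^sup>2 * (\<integral>u. \<psi> u \<partial>seg N)"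
  using assms shape_measurable[OF shape_dilate[OF assms]]
  by (subst integral_seg_scale) (auto simp: dilate_def power2_eq_square)

text \<open>Every logarithm gains \<open>ln c\<close>. The single integral gains 2 c^2 ln c (mass +
  N^2/2), the double integral c^2 ln c N^2, so the terms with N cancel.\<close>

lemma hook_energy_dilate:
  assumes s: "shape N \<psi>" and c: "0 < c"
  shows "hook_energy (c * N) (dilate c \<psi>) = c\<^sup>2 * hook_energy N \<psi> + 2 * c\<^sup>2 * ln c * (\<integral>u. \<psi> u \<partial>seg N)"
proof -
  note [measurable] = shape_measurable[OF s]
  note sc = shape_dilate[OF s c]
  note [measurable] = shape_measurable[OF sc]
  have N: "0 < N" using shapeD[OF s] by simp
  let ?a = "\<lambda>u. \<psi> u - u" and ?b = "\<lambda>u. dilate c \<psi> u - u"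
  have ab: "?b (c * u) = c * ?a u" for u using c by (simp add: dilate_def algebra_simps)
  define A where "A = (\<lambda>u. ?a u + N)"
  have A0: "0 \<le> A u" if "u \<le> N" for u using shapeD(3)[OF s, of u] that by (simp add: A_def)
  have Ai: "integrable (seg N) A" unfolding A_def using shape_integrable[OF s] id_integrable_seg by auto
  have Li: "integrable (seg N) (\<lambda>u. A u * ln (A u))" using shape_xlnx_integrable[OF s] by (simp add: A_def)
  have 1: "(\<integral>u. (?b u + c * N) * ln (?b u + c * N) - (?b u + c * N) \<partial>seg (c * N)) =
    c\<^sup>2 * (\<integral>u. A u * ln (A u) - A u \<partial>seg N) + c\<^sup>2 * ln c * (\<integral>u. A u \<partial>seg N)"
  proof -
    have "(\<integral>u. (?b u + c * N) * ln (?b u + c * N) - (?b u + c * N) \<partial>seg (c * N)) =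
      c * (\<integral>u. (c * A u) * ln (c * A u) - (c * A u) \<partial>seg N)"
      using c by (subst integral_seg_scale) (simp_all add: ab A_def distrib_left)
    also have "(\<integral>u. (c * A u) * ln (c * A u) - (c * A u) \<partial>seg N) = (\<integral>u. c * (A u * ln (A u) - A u) + c * ln c * A u \<partial>seg N)"
    proof (rule integral_cong_AE)
      show "AE u in seg N. (c * A u) * ln (c * A u) - (c * A u) = c * (A u * ln (A u) - A u) + c * ln c * A u"
      proof (rule AE_segI)
        fix u assume "u \<le> N"
        with A0[of u] c show "(c * A u) * ln (c * A u) - (c * A u) = c * (A u * ln (A u) - A u) + c * ln c * A u"
          by (cases "A u = 0") (auto simp: ln_mult algebra_simps)
      qed
    qed (simp_all add: A_def)
    also have "\<dots> = c * (\<integral>u. A u * ln (A u) - A u \<partial>seg N) + c * ln c * (\<integral>u. A u \<partial>seg N)"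
      using Ai Li by simp
    finally show ?thesis by (simp add: power2_eq_square algebra_simps)
  qed
  have iA: "(\<integral>u. A u \<partial>seg N) = (\<integral>u. \<psi> u \<partial>seg N) + N\<^sup>2 / 2"
    unfolding A_def using shape_integrable[OF s] id_integrable_seg N
    by (simp add: integral_seg_id measure_seg_UNIV power2_eq_square)
  have 2: "log_pair (c * N) ?b ?b = c\<^sup>2 * log_pair N ?a ?a + c\<^sup>2 * ln c * N\<^sup>2"
  proof -
    note it = log_pair_iter[OF _ shape_steep[OF s] shape_abs_le[OF s] shape_abs_le[OF s]]
    note itc = log_pair_iter[OF _ shape_steep[OF sc] shape_abs_le[OF sc] shape_abs_le[OF sc]]
    have "log_pair (c * N) ?b ?b = (\<integral>u. (\<integral>v. ln \<bar>?b u - ?b v\<bar> \<partial>seg (c * N)) \<partial>seg (c * N))"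
      by (rule itc(1)) (use N c in auto)
    also have "\<dots> = (\<integral>u. c * (\<integral>v. ln \<bar>?b u - ?b (c * v)\<bar> \<partial>seg N) \<partial>seg (c * N))"
      by (subst integral_seg_scale) (use c in auto)
    also have "\<dots> = c * (\<integral>u. c * (\<integral>v. ln \<bar>?b (c * u) - ?b (c * v)\<bar> \<partial>seg N) \<partial>seg N)"
      by (subst integral_seg_scale) (use c in auto)
    also have "(\<integral>u. c * (\<integral>v. ln \<bar>?b (c * u) - ?b (c * v)\<bar> \<partial>seg N) \<partial>seg N) =
      (\<integral>u. c * (ln c * N + (\<integral>v. ln \<bar>?a u - ?a v\<bar> \<partial>seg N)) \<partial>seg N)"
    proof (rule integral_cong_AE)
      show "AE u in seg N. c * (\<integral>v. ln \<bar>?b (c * u) - ?b (c * v)\<bar> \<partial>seg N) = c * (ln c * N + (\<integral>v. ln \<bar>?a u - ?a v\<bar> \<partial>seg N))"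
      proof (rule AE_segI)
        fix u assume u: "0 \<le> u" "u \<le> N"
        have li: "integrable (seg N) (\<lambda>v. ln \<bar>?a u - ?a v\<bar>)"
          by (rule log_integrable[OF shape_steep[OF s] shape_abs_le[OF s u] shape_abs_le[OF s]]) (use N in auto)
        have "(\<integral>v. ln \<bar>?b (c * u) - ?b (c * v)\<bar> \<partial>seg N) = (\<integral>v. ln c + ln \<bar>?a u - ?a v\<bar> \<partial>seg N)"
        proof (rule integral_cong_AE)
          show "AE v in seg N. ln \<bar>?b (c * u) - ?b (c * v)\<bar> = ln c + ln \<bar>?a u - ?a v\<bar>"
            using steep_AE_neq[OF shape_steep[OF s], where N=N and t="?a u"]
          proof eventually_elim
            case (elim v)
            have "\<bar>?b (c * u) - ?b (c * v)\<bar> = c * \<bar>?a u - ?a v\<bar>"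
              unfolding ab right_diff_distrib[symmetric] using c by (simp add: abs_mult)
            with elim c show ?case by (simp add: ln_mult)
          qed
        qed simp_all
        also have "\<dots> = ln c * N + (\<integral>v. ln \<bar>?a u - ?a v\<bar> \<partial>seg N)"
          using li N by (simp add: measure_seg_UNIV)
        finally show "c * (\<integral>v. ln \<bar>?b (c * u) - ?b (c * v)\<bar> \<partial>seg N) = c * (ln c * N + (\<integral>v. ln \<bar>?a u - ?a v\<bar> \<partial>seg N))" by simp
      qed
    qed simp_all
    also have "\<dots> = c * (ln c * N * N + log_pair N ?a ?a)"
    proof -
      have "integrable (seg N) (\<lambda>u. \<integral>v. ln \<bar>?a u - ?a v\<bar> \<partial>seg N)" by (rule it(2)) (use N in auto)
      moreover have "log_pair N ?a ?a = (\<integral>u. (\<integral>v. ln \<bar>?a u - ?a v\<bar> \<partial>seg N) \<partial>seg N)" by (rule it(1)) (use N in auto)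
      ultimately show ?thesis using N by (simp add: measure_seg_UNIV)
    qed
    finally show ?thesis by (simp add: power2_eq_square algebra_simps)
  qed
  show ?thesis unfolding hook_energy_def 1[unfolded iA] 2 by (simp add: A_def algebra_simps)
qed

text \<open>A weighted sum of the tangent line inequality at z > 0. It includes the endpoint 0, with
  \<open>0 * ln 0 = 0\<close>, because \<open>\<psi> u - u + N\<close> may vanish.\<close>

lemma xlnx_convex:
  fixes x y t :: real
  assumes "0 \<le> x" "0 \<le> y" "0 < t" "t < 1"
  defines "z \<equiv> (1 - t) * x + t * y"
  shows "z * ln z \<le> (1 - t) * (x * ln x) + t * (y * ln y)"
proof (cases "x = 0 \<and> y = 0")
  case False
  have z: "0 < z"
  proof (cases "0 < x")
    case True then show ?thesis using assms by (auto intro!: add_pos_nonneg)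
  next
    case False
    with \<open>\<not> (x = 0 \<and> y = 0)\<close> have "0 < y" using assms by auto
    then show ?thesis using assms by (auto intro!: add_nonneg_pos)
  qed
  have tan: "z * ln z + (ln z + 1) * (w - z) \<le> w * ln w" if "0 \<le> w" for w
  proof (cases "w = 0")
    case False
    then have w: "0 < w" using that by simp
    have "ln (z / w) \<le> z / w - 1" using w z by (intro ln_le_minus_one) auto
    then have "w * (ln z - ln w) \<le> w * (z / w - 1)" using w z by (intro mult_left_mono) (auto simp: ln_div)
    also have "\<dots> = z - w" using w by (simp add: algebra_simps)
    finally show ?thesis by (simp add: algebra_simps)
  qed (use z in \<open>auto simp: algebra_simps\<close>)
  have "(1 - t) * (z * ln z + (ln z + 1) * (x - z)) + t * (z * ln z + (ln z + 1) * (y - z)) \<le> (1 - t) * (x * ln x) + t * (y * ln y)"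
    using assms tan by (intro add_mono mult_left_mono) auto
  moreover have "(1 - t) * (z * ln z + (ln z + 1) * (x - z)) + t * (z * ln z + (ln z + 1) * (y - z)) = z * ln z"
  proof -
    have "(1 - t) * (z * ln z + (ln z + 1) * (x - z)) + t * (z * ln z + (ln z + 1) * (y - z)) = z * ln z + (ln z + 1) * ((1 - t) * x + t * y - z)"
      by (simp add: algebra_simps)
    then show ?thesis by (simp add: z_def)
  qed
  ultimately show ?thesis by simp
qed (simp add: z_def)

lemma shape_convex:
  assumes "shape N \<psi>" "shape N \<phi>" "0 < t" "t < 1"
  shows "shape N (\<lambda>x. (1 - t) * \<psi> x + t * \<phi> x)"
  using assms by (auto simp: shape_def antimono_def intro!: add_mono mult_left_mono)

lemma hook_energy_convex:
  assumes s1: "shape N \<psi>" and s2: "shape N \<phi>" and t: "0 < t" "t < 1"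
  shows "hook_energy N (\<lambda>x. (1 - t) * \<psi> x + t * \<phi> x) \<le> (1 - t) * hook_energy N \<psi> + t * hook_energy N \<phi>"
proof -
  note s = shape_convex[OF s1 s2 t]
  define \<theta> where "\<theta> = (\<lambda>x. (1 - t) * \<psi> x + t * \<phi> x)"
  have s: "shape N \<theta>" unfolding \<theta>_def by (rule s)
  note [measurable] = shape_measurable[OF s] shape_measurable[OF s1] shape_measurable[OF s2]
  have N: "0 < N" using shapeD[OF s] by simp
  let ?A = "\<lambda>\<psi>::real\<Rightarrow>real. \<lambda>u. \<psi> u - u + N"
  let ?G = "\<lambda>\<psi>. \<integral>u. ?A \<psi> u * ln (?A \<psi> u) - ?A \<psi> u \<partial>seg N"
  let ?P = "\<lambda>\<psi>. log_pair N (\<lambda>u. \<psi> u - u) (\<lambda>u. \<psi> u - u)"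
  have Gi: "integrable (seg N) (\<lambda>u. ?A \<psi> u * ln (?A \<psi> u) - ?A \<psi> u)" if "shape N \<psi>" for \<psi>
    using shape_xlnx_integrable[OF that] shape_integrable[OF that] id_integrable_seg by auto
  have "?G \<theta> \<le> (\<integral>u. (1 - t) * (?A \<psi> u * ln (?A \<psi> u) - ?A \<psi> u) + t * (?A \<phi> u * ln (?A \<phi> u) - ?A \<phi> u) \<partial>seg N)"
  proof (intro integral_mono_AE AE_segI Bochner_Integration.integrable_add integrable_mult_right Gi s s1 s2)
    fix u assume u: "0 \<le> u" "u \<le> N"
    have "?A \<theta> u = (1 - t) * ?A \<psi> u + t * ?A \<phi> u" by (simp add: \<theta>_def algebra_simps)
    moreover have "0 \<le> ?A \<psi> u" "0 \<le> ?A \<phi> u" using shapeD(3)[OF s1, of u] shapeD(3)[OF s2, of u] u by auto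
    ultimately show "?A \<theta> u * ln (?A \<theta> u) - ?A \<theta> u \<le> (1 - t) * (?A \<psi> u * ln (?A \<psi> u) - ?A \<psi> u) + t * (?A \<phi> u * ln (?A \<phi> u) - ?A \<phi> u)"
      using xlnx_convex[of "?A \<psi> u" "?A \<phi> u" t] t by (simp add: right_diff_distrib)
  qed
  also have "\<dots> = (1 - t) * ?G \<psi> + t * ?G \<phi>"
    using Gi[OF s1] Gi[OF s2] by (subst Bochner_Integration.integral_add) simp_all
  finally have G: "?G \<theta> \<le> (1 - t) * ?G \<psi> + t * ?G \<phi>" .
  have Pi: "integrable (seg2 N) (\<lambda>p. ln \<bar>(\<psi> (fst p) - fst p) - (\<psi> (snd p) - snd p)\<bar>)" if "shape N \<psi>" for \<psi>
    by (rule pair_log_integrable[OF _ shape_steep[OF that] shape_abs_le[OF that] shape_abs_le[OF that]])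
      (use N shape_measurable[OF that] in auto)
  let ?l = "\<lambda>\<psi> u v. ln \<bar>(\<psi> u - u) - (\<psi> v - v)\<bar>"
  have "(1 - t) * ?P \<psi> + t * ?P \<phi> = (\<integral>p. (1 - t) * ?l \<psi> (fst p) (snd p) + t * ?l \<phi> (fst p) (snd p) \<partial>seg2 N)"
    unfolding log_pair_def using Pi[OF s1] Pi[OF s2] by (subst Bochner_Integration.integral_add) simp_all
  also have "\<dots> \<le> ?P \<theta>" unfolding log_pair_def
  proof (intro integral_mono_AE Bochner_Integration.integrable_add integrable_mult_right Pi s s1 s2)
    show "AE p in seg2 N. (1 - t) * ?l \<psi> (fst p) (snd p) + t * ?l \<phi> (fst p) (snd p) \<le> ?l \<theta> (fst p) (snd p)"
    proof (rule AE_pair_seg)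
      fix u assume "0 \<le> u" "u \<le> N"
      \<comment> \<open>Steepness fixes the sign of the difference for u < v, for all three shapes
        alike. Without absolute values the difference is affine in the shape, and concavity of the
        logarithm applies.\<close>
      have key: "(1 - t) * ?l \<psi> u v + t * ?l \<phi> u v \<le> ?l \<theta> u v" if "u < v" for u v
      proof -
        have p: "0 < (\<psi> u - u) - (\<psi> v - v)" "0 < (\<phi> u - u) - (\<phi> v - v)"
          using steepD[OF shape_steep[OF s1], of u v] steepD[OF shape_steep[OF s2], of u v] that by auto
        have e: "(\<theta> u - u) - (\<theta> v - v) = (1 - t) * ((\<psi> u - u) - (\<psi> v - v)) + t * ((\<phi> u - u) - (\<phi> v - v))"
          by (simp add: \<theta>_def algebra_simps)
        have "(1 - t) * ln ((\<psi> u - u) - (\<psi> v - v)) + t * ln ((\<phi> u - u) - (\<phi> v - v)) \<le> ln ((\<theta> u - u) - (\<theta> v - v))"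
          unfolding e using concave_onD[OF ln_concave, of t "(\<psi> u - u) - (\<psi> v - v)" "(\<phi> u - u) - (\<phi> v - v)"] t p by simp
        moreover have "0 < (\<theta> u - u) - (\<theta> v - v)" using steepD[OF shape_steep[OF s], of u v] that by simp
        ultimately show ?thesis using p by (simp only: abs_of_pos)
      qed
      show "AE v in seg N. (1 - t) * ?l \<psi> u v + t * ?l \<phi> u v \<le> ?l \<theta> u v"
        using steep_AE_neq[OF shape_steep[OF s], where N=N and t="\<theta> u - u"]
      proof eventually_elim
        case (elim v)
        then have "u < v \<or> v < u" by (cases u v rule: linorder_cases) auto
        then show ?case using key[of u v] key[of v u] by (auto simp: abs_minus_commute)
      qed
    qed measurable
  qed
  finally have "(1 - t) * ?P \<psi> + t * ?P \<phi> \<le> ?P \<theta>" .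
  then show ?thesis using G unfolding hook_energy_def \<theta>_def[symmetric] by (simp add: algebra_simps)
qed

section \<open>The area functional\<close>

definition area_above :: "(real \<Rightarrow> real) \<Rightarrow> real \<Rightarrow> real" where
  "area_above \<psi> x = (LBINT y:{0..}. max (\<psi> y - y - x) 0)"

text \<open>Beyond \<open>\<psi> 0 + \<bar>x\<bar>\<close> the positive part vanishes, so the half
  line may be replaced by any long enough segment, on which the integrand is bounded.\<close>

lemma area_above_seg:
  assumes a: "antimono \<psi>" and K: "\<psi> 0 + \<bar>x\<bar> \<le> K"
  shows "area_above \<psi> x = (\<integral>u. max (\<psi> u - u - x) 0 \<partial>seg K)"
    and "integrable (seg K) (\<lambda>u. max (\<psi> u - u - x) 0)"
    and "set_integrable lborel {0..} (\<lambda>u. max (\<psi> u - u - x) 0)"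
proof -
  note [measurable] = antimono_borel_measurable[OF a]
  have le: "\<psi> u \<le> \<psi> 0" if "0 \<le> u" for u using a that by (auto simp: antimono_def)
  have eq: "(\<lambda>u. indicator {0..} u *\<^sub>R max (\<psi> u - u - x) 0) = (\<lambda>u. indicator {0..K} u *\<^sub>R max (\<psi> u - u - x) 0)"
  proof
    fix u :: real show "indicator {0..} u *\<^sub>R max (\<psi> u - u - x) 0 = indicator {0..K} u *\<^sub>R max (\<psi> u - u - x) 0"
      using le[of u] K by (auto simp: indicator_def max_def)
  qed
  show "area_above \<psi> x = (\<integral>u. max (\<psi> u - u - x) 0 \<partial>seg K)"
    unfolding area_above_def set_lebesgue_integral_def eq
    by (simp add: integral_seg set_lebesgue_integral_def)
  show i: "integrable (seg K) (\<lambda>u. max (\<psi> u - u - x) 0)"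
  proof (rule integrable_seg_bounded[where C="max (\<psi> 0 + \<bar>x\<bar>) 0"])
    fix u :: real assume "0 \<le> u"
    then show "\<bar>max (\<psi> u - u - x) 0\<bar> \<le> max (\<psi> 0 + \<bar>x\<bar>) 0" using le[of u] by auto
  qed measurable
  then show "set_integrable lborel {0..} (\<lambda>u. max (\<psi> u - u - x) 0)"
    unfolding set_integrable_def eq by (subst (asm) integrable_seg) (auto simp: set_integrable_def)
qed

lemma area_above_nonneg: "0 \<le> area_above \<psi> x"
  unfolding area_above_def set_lebesgue_integral_def by (intro Bochner_Integration.integral_nonneg) auto

lemma area_above_mono:
  assumes "antimono \<psi>" "antimono \<phi>" "\<And>u. 0 \<le> u \<Longrightarrow> \<psi> u \<le> \<phi> u" "y \<le> x"
  shows "area_above \<psi> x \<le> area_above \<phi> y"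
  unfolding area_above_def
proof (rule set_integral_mono)
  show "set_integrable lborel {0..} (\<lambda>u. max (\<psi> u - u - x) 0)" "set_integrable lborel {0..} (\<lambda>u. max (\<phi> u - u - y) 0)"
    using area_above_seg(3) assms by blast+
qed (use assms in \<open>force simp: max_def\<close>)

lemma area_above_dilate:
  assumes a: "antimono \<psi>" and c: "0 < c"
  shows "area_above (dilate c \<psi>) (c * x) = c\<^sup>2 * area_above \<psi> x"
proof -
  note [measurable] = antimono_borel_measurable[OF a]
  have a': "antimono (dilate c \<psi>)" using a c by (auto simp: dilate_def antimono_def divide_right_mono)
  note [measurable] = antimono_borel_measurable[OF a']
  define K where "K = \<psi> 0 + \<bar>x\<bar>"
  have "area_above (dilate c \<psi>) (c * x) = (\<integral>u. max (dilate c \<psi> u - u - c * x) 0 \<partial>seg (c * K))"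
    by (rule area_above_seg[OF a']) (use c in \<open>simp add: K_def dilate_def abs_mult distrib_left\<close>)
  also have "\<dots> = c * (\<integral>u. max (dilate c \<psi> (c * u) - c * u - c * x) 0 \<partial>seg K)"
    by (rule integral_seg_scale) (use c in auto)
  also have "(\<lambda>u. max (dilate c \<psi> (c * u) - c * u - c * x) 0) = (\<lambda>u. c * max (\<psi> u - u - x) 0)"
  proof
    fix u
    have "dilate c \<psi> (c * u) - c * u - c * x = c * (\<psi> u - u - x)" using c by (simp add: dilate_def algebra_simps)
    then show "max (dilate c \<psi> (c * u) - c * u - c * x) 0 = c * max (\<psi> u - u - x) 0"
      using c by (auto simp: max_def zero_le_mult_iff mult_le_0_iff)
  qed
  finally show ?thesis using area_above_seg(1)[OF a, of x K] by (simp add: K_def power2_eq_square)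
qed

lemma area_above_convex:
  assumes a: "antimono \<psi>" "antimono \<phi>" and t: "0 < t" "t < 1"
  shows "area_above (\<lambda>u. (1 - t) * \<psi> u + t * \<phi> u) ((1 - t) * x + t * y) \<le> (1 - t) * area_above \<psi> x + t * area_above \<phi> y"
proof -
  define \<theta> where "\<theta> = (\<lambda>u. (1 - t) * \<psi> u + t * \<phi> u)"
  have a': "antimono \<theta>" using a t by (auto simp: \<theta>_def antimono_def intro!: add_mono mult_left_mono)
  define z where "z = (1 - t) * x + t * y"
  define K where "K = max (\<theta> 0 + \<bar>z\<bar>) (max (\<psi> 0 + \<bar>x\<bar>) (\<phi> 0 + \<bar>y\<bar>))"
  have "\<theta> 0 + \<bar>z\<bar> \<le> K" "\<psi> 0 + \<bar>x\<bar> \<le> K" "\<phi> 0 + \<bar>y\<bar> \<le> K" by (auto simp: K_def)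
  note th = area_above_seg[OF a' this(1)] and ps = area_above_seg[OF a(1) this(2)] and ph = area_above_seg[OF a(2) this(3)]
  have "(\<integral>u. max (\<theta> u - u - z) 0 \<partial>seg K) \<le> (\<integral>u. (1 - t) * max (\<psi> u - u - x) 0 + t * max (\<phi> u - u - y) 0 \<partial>seg K)"
  proof (rule integral_mono)
    fix u
    have "\<theta> u - u - z = (1 - t) * (\<psi> u - u - x) + t * (\<phi> u - u - y)" by (simp add: \<theta>_def z_def algebra_simps)
    also have "\<dots> \<le> (1 - t) * max (\<psi> u - u - x) 0 + t * max (\<phi> u - u - y) 0"
      using t by (intro add_mono mult_left_mono) auto
    finally show "max (\<theta> u - u - z) 0 \<le> (1 - t) * max (\<psi> u - u - x) 0 + t * max (\<phi> u - u - y) 0"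
      using t by (auto intro!: add_nonneg_nonneg mult_nonneg_nonneg)
  next
    show "integrable (seg K) (\<lambda>u. max (\<theta> u - u - z) 0)" by (rule th(2))
    show "integrable (seg K) (\<lambda>u. (1 - t) * max (\<psi> u - u - x) 0 + t * max (\<phi> u - u - y) 0)"
      by (intro Bochner_Integration.integrable_add integrable_mult_right ps(2) ph(2))
  qed
  also have "\<dots> = (1 - t) * (\<integral>u. max (\<psi> u - u - x) 0 \<partial>seg K) + t * (\<integral>u. max (\<phi> u - u - y) 0 \<partial>seg K)"
    using ps(2) ph(2) by (subst Bochner_Integration.integral_add) auto
  finally have "area_above \<theta> z \<le> (1 - t) * area_above \<psi> x + t * area_above \<phi> y"
    unfolding th(1) ps(1) ph(1) .
  then show ?thesis by (simp only: \<theta>_def z_def)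
qed

text \<open>On [0,x] the expression \<open>\<psi> u - u + x\<close> is nonnegative and needs no
  positive part; what is lost is the contribution from beyond x, which vanishes if the support lies
  in [0,x].\<close>

lemma area_above_lower:
  assumes a: "antimono \<psi>" and nn: "\<And>u. 0 \<le> \<psi> u" and x: "0 \<le> x"
  shows "(\<integral>u. \<psi> u \<partial>seg x) + x\<^sup>2 / 2 \<le> area_above \<psi> (- x)"
    and "(\<And>u. x \<le> u \<Longrightarrow> \<psi> u = 0) \<Longrightarrow> area_above \<psi> (- x) = (\<integral>u. \<psi> u \<partial>seg x) + x\<^sup>2 / 2"
proof -
  note [measurable] = antimono_borel_measurable[OF a]
  define K where "K = \<psi> 0 + \<bar>-x\<bar>"
  then have "\<psi> 0 + \<bar>-x\<bar> \<le> K" by simp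
  note K = area_above_seg[OF a this]
  have xK: "x \<le> K" using nn[of 0] x by (simp add: K_def)
  have le: "\<psi> u \<le> \<psi> 0" if "0 \<le> u" for u using a that by (auto simp: antimono_def)
  have \<psi>i: "integrable (seg x) \<psi>"
    by (rule integrable_seg_bounded[where C="\<psi> 0"]) (use nn le in auto)
  have "(\<integral>u. \<psi> u \<partial>seg x) + x\<^sup>2 / 2 = (\<integral>u. \<psi> u - u + x \<partial>seg x)"
    using \<psi>i id_integrable_seg x by (simp add: integral_seg_id measure_seg_UNIV power2_eq_square)
  also have "\<dots> = (\<integral>u. indicator {0..x} u * (\<psi> u - u + x) \<partial>seg K)"
    unfolding integral_seg[of "\<lambda>u. \<psi> u - u + x", OF _ ] using xK
    by (subst (1 2) integral_seg) (auto simp: set_lebesgue_integral_def indicator_def intro!: Bochner_Integration.integral_cong)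
  finally have e: "(\<integral>u. \<psi> u \<partial>seg x) + x\<^sup>2 / 2 = (\<integral>u. indicator {0..x} u * (\<psi> u - u + x) \<partial>seg K)" .
  have "(\<integral>u. indicator {0..x} u * (\<psi> u - u + x) \<partial>seg K) \<le> (\<integral>u. max (\<psi> u - u - -x) 0 \<partial>seg K)"
  proof (rule integral_mono)
    show "integrable (seg K) (\<lambda>u. indicator {0..x} u * (\<psi> u - u + x))"
    proof (rule integrable_seg_bounded[where C="\<psi> 0 + x"])
      fix u :: real assume "0 \<le> u"
      then show "\<bar>indicator {0..x} u * (\<psi> u - u + x)\<bar> \<le> \<psi> 0 + x" using le[of u] nn[of u] nn[of 0] x by (auto simp: indicator_def)
    qed measurable
    fix u :: real show "indicator {0..x} u * (\<psi> u - u + x) \<le> max (\<psi> u - u - -x) 0" by (auto simp: indicator_def)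
  qed (rule K(2))
  then show "(\<integral>u. \<psi> u \<partial>seg x) + x\<^sup>2 / 2 \<le> area_above \<psi> (- x)" using e K(1) by simp
  assume z: "\<And>u. x \<le> u \<Longrightarrow> \<psi> u = 0"
  have "(\<integral>u. indicator {0..x} u * (\<psi> u - u + x) \<partial>seg K) = (\<integral>u. max (\<psi> u - u - -x) 0 \<partial>seg K)"
  proof (rule integral_cong_AE)
    show "AE u in seg K. indicator {0..x} u * (\<psi> u - u + x) = max (\<psi> u - u - -x) 0"
    proof (rule AE_segI)
      fix u :: real assume "0 \<le> u"
      then show "indicator {0..x} u * (\<psi> u - u + x) = max (\<psi> u - u - -x) 0" using nn[of u] z[of u] by (auto simp: indicator_def)
    qed
  qed measurable
  then show "area_above \<psi> (- x) = (\<integral>u. \<psi> u \<partial>seg x) + x\<^sup>2 / 2" using e K(1) by simp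
qed

lemma triangle_integral:
  fixes d M :: real
  assumes "0 \<le> d"
  shows "integrable lborel (\<lambda>u. (u - (M - d)) * indicator {M - d..M} u)" "(\<integral>u. (u - (M - d)) * indicator {M - d..M} u \<partial>lborel) = d\<^sup>2 / 2"
    "integrable lborel (\<lambda>u. (M + d - u) * indicator {M..M + d} u)" "(\<integral>u. (M + d - u) * indicator {M..M + d} u \<partial>lborel) = d\<^sup>2 / 2"
proof -
  have 1: "((\<lambda>u. (u - (M - d))\<^sup>2 / 2) has_real_derivative (u - (M - d))) (at u)" for u
    by (auto intro!: derivative_eq_intros)
  have 2: "((\<lambda>u. - (M + d - u)\<^sup>2 / 2) has_real_derivative (M + d - u)) (at u)" for u
    by (auto intro!: derivative_eq_intros simp: field_simps)
  show "integrable lborel (\<lambda>u. (u - (M - d)) * indicator {M - d..M} u)"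
    by (rule integrable_FTC_Icc_nonneg[OF _ 1]) (use assms in auto)
  show "integrable lborel (\<lambda>u. (M + d - u) * indicator {M..M + d} u)"
    by (rule integrable_FTC_Icc_nonneg[OF _ 2]) (use assms in auto)
  have "(\<integral>u. (u - (M - d)) * indicator {M - d..M} u \<partial>lborel) = (M - (M - d))\<^sup>2 / 2 - (M - d - (M - d))\<^sup>2 / 2"
    by (rule integral_FTC_Icc_nonneg[OF _ 1]) (use assms in auto)
  then show "(\<integral>u. (u - (M - d)) * indicator {M - d..M} u \<partial>lborel) = d\<^sup>2 / 2" by simp
  have "(\<integral>u. (M + d - u) * indicator {M..M + d} u \<partial>lborel) = - (M + d - (M + d))\<^sup>2 / 2 - (- (M + d - M)\<^sup>2 / 2)"
    by (rule integral_FTC_Icc_nonneg[OF _ 2]) (use assms in auto)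
  then show "(\<integral>u. (M + d - u) * indicator {M..M + d} u \<partial>lborel) = d\<^sup>2 / 2" by simp
qed

text \<open>
  The derivative of the area in \<open>x\<close> is minus the length of \<open>{u. \<psi> u - u > x}\<close>, which is
  1-Lipschitz in \<open>x\<close> since \<open>\<psi> u - u\<close> has slope at most \<open>-1\<close>.
\<close>

lemma area_above_semiconcave:
  assumes a: "antimono \<psi>" and nn: "\<And>u. 0 \<le> \<psi> u"
  shows "\<exists>M. \<forall>y. area_above \<psi> y \<le> area_above \<psi> x - M * (y - x) + (y - x)\<^sup>2 / 2"
proof -
  note [measurable] = antimono_borel_measurable[OF a]
  let ?a = "\<lambda>u. \<psi> u - u"
  have st: "v - u \<le> ?a u - ?a v" if "u \<le> v" for u v using a that by (auto simp: antimono_def)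
  have le: "\<psi> u \<le> \<psi> 0" if "0 \<le> u" for u using a that by (auto simp: antimono_def)
  \<comment> \<open>Up to its endpoint the set where \<open>\<psi> u - u\<close> exceeds x is an
    initial segment, so M is its length; 0 is inserted to cover the empty case.\<close>
  define S where "S = insert 0 {u. 0 \<le> u \<and> x < ?a u}"
  define M where "M = Sup S"
  have Sb: "u \<le> \<psi> 0 + \<bar>x\<bar>" if "u \<in> S" for u using that le[of u] nn[of 0] by (auto simp: S_def)
  have bdd: "bdd_above S" by (rule bdd_aboveI) (rule Sb)
  have M0: "0 \<le> M" unfolding M_def by (rule cSup_upper[OF _ bdd]) (simp add: S_def)
  have MK: "M \<le> \<psi> 0 + \<bar>x\<bar>" unfolding M_def by (rule cSup_least) (use Sb in \<open>auto simp: S_def\<close>)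
  have below: "x + (M - u) \<le> ?a u" if u: "0 \<le> u" "u < M" for u
  proof -
    have "w \<le> ?a u - x + u" if "w < M" for w
    proof -
      obtain w' where w': "w' \<in> S" "max u w < w'"
        by (rule less_cSupE[of "max u w" S]) (use u \<open>w < M\<close> in \<open>auto simp: M_def S_def\<close>)
      then have "x < ?a w'" using u by (auto simp: S_def)
      then show ?thesis using st[of u w'] w' by auto
    qed
    then have "M \<le> ?a u - x + u" by (rule dense_le)
    then show ?thesis by simp
  qed
  have above: "?a u \<le> x - (u - M)" if u: "M < u" for u
  proof -
    have "?a u - x + u \<le> w" if "M < w" for w
    proof -
      have "min u w \<notin> S" using cSup_upper[OF _ bdd, of "min u w"] that u by (auto simp: M_def)
      then have "?a (min u w) \<le> x" using M0 u that by (auto simp: S_def)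
      then show ?thesis using st[of "min u w" u] by auto
    qed
    then have "?a u - x + u \<le> M" by (rule dense_ge)
    then show ?thesis by simp
  qed
  show ?thesis
  proof (intro exI allI)
    fix y
    define K where "K = max (\<psi> 0 + \<bar>x\<bar>) (\<psi> 0 + \<bar>y\<bar>)"
    \<comment> \<open>Moving the level from x to y is linear in y - x except for u within |y - x| of
      M. The slope bound dominates the error there by a triangle of area (y - x)^2 / 2, to the left
      or right of M according to the direction of the move.\<close>
    define tri where "tri = (if x \<le> y then (\<lambda>u. (u - (M - (y - x))) * indicator {M - (y - x)..M} u) else (\<lambda>u. (M + (x - y) - u) * indicator {M..M + (x - y)} u))"
    have tri: "integrable lborel tri" "(\<integral>u. tri u \<partial>lborel) = (y - x)\<^sup>2 / 2" and tn: "\<And>u. 0 \<le> tri u"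
      using triangle_integral[of "y - x" M] triangle_integral[of "x - y" M] by (auto simp: tri_def indicator_def power2_commute)
    have [measurable]: "tri \<in> borel_measurable borel" using borel_measurable_integrable[OF tri(1)] by simp
    have ti: "integrable (seg K) tri"
      using integrable_mult_indicator[OF _ tri(1), of "{0..K}"] by (simp add: integrable_seg set_integrable_def)
    have "(\<integral>u. tri u \<partial>seg K) = (\<integral>u. indicator {0..K} u *\<^sub>R tri u \<partial>lborel)" by (simp add: integral_seg set_lebesgue_integral_def)
    also have "\<dots> \<le> (\<integral>u. tri u \<partial>lborel)"
      by (rule integral_mono[OF integrable_mult_indicator[OF _ tri(1)] tri(1)]) (use tn in \<open>auto simp: indicator_def\<close>)
    finally have tle: "(\<integral>u. tri u \<partial>seg K) \<le> (y - x)\<^sup>2 / 2" using tri(2) by simp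
    have Ki: "\<psi> 0 + \<bar>x\<bar> \<le> K" "\<psi> 0 + \<bar>y\<bar> \<le> K" by (auto simp: K_def)
    note ax = area_above_seg[OF a Ki(1)] and ay = area_above_seg[OF a Ki(2)]
    have ind: "(\<integral>u. indicator {0..M} u \<partial>seg K) = M" 
      using M0 MK Ki by (simp add: measure_def emeasure_seg Int_absorb1)
    have indi: "integrable (seg K) (\<lambda>u. indicator {0..M} u :: real)" by (rule integrable_seg_bounded[where C=1]) auto
    have "area_above \<psi> y = (\<integral>u. max (?a u - y) 0 \<partial>seg K)" by (rule ay)
    also have "\<dots> \<le> (\<integral>u. max (?a u - x) 0 - (y - x) * indicator {0..M} u + tri u \<partial>seg K)"
    proof (rule integral_mono_AE)
      have "AE u in seg K. u \<noteq> M" using AE_lborel_singleton[of M] by (auto simp: AE_seg elim: eventually_mono)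
      moreover have "AE u in seg K. 0 \<le> u" by (rule AE_segI) simp
      ultimately show "AE u in seg K. max (?a u - y) 0 \<le> max (?a u - x) 0 - (y - x) * indicator {0..M} u + tri u"
      proof eventually_elim
        case (elim u)
        show ?case
        proof (cases "u < M")
          case True
          then have b: "x + (M - u) \<le> ?a u" using below elim by simp
          show ?thesis
          proof (cases "x \<le> y \<and> ?a u < y")
            case True
            then have "tri u = u - (M - (y - x))" using \<open>u < M\<close> b by (auto simp: tri_def)
            then show ?thesis using True b \<open>u < M\<close> elim by (auto simp: max_def)
          next
            case False
            then show ?thesis using b \<open>u < M\<close> elim tn[of u] by (auto simp: max_def)
          qed
        next
          case False
          then have uM: "M < u" using elim by auto
          have b: "?a u \<le> x - (u - M)" using above[OF uM] .
          show ?thesis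
          proof (cases "y < ?a u")
            case True
            then have "tri u = M + (x - y) - u" using uM b by (auto simp: tri_def)
            then show ?thesis using True b uM by (auto simp: max_def)
          next
            case False
            then show ?thesis using b uM tn[of u] by (auto simp: max_def)
          qed
        qed
      qed
    qed (use ax ay ti indi in auto)
    also have "\<dots> = area_above \<psi> x - M * (y - x) + (\<integral>u. tri u \<partial>seg K)"
      using ax ti indi ind by (subst Bochner_Integration.integral_add) auto
    finally show "area_above \<psi> y \<le> area_above \<psi> x - M * (y - x) + (y - x)\<^sup>2 / 2" using tle by simp
  qed
qed

section \<open>The logarithmic potential of the arcsine law\<close>

lemma integral_seg_reflect:
  fixes f :: "real \<Rightarrow> real"
  assumes [measurable]: "f \<in> borel_measurable borel"
  shows "(\<integral>u. f (N - u) \<partial>seg N) = (\<integral>u. f u \<partial>seg N)"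
proof -
  have "(\<integral>u. f u \<partial>seg N) = (\<integral>u. indicator {0..N} (N - u) * f (N - u) \<partial>lborel)"
    unfolding integral_seg[OF assms] set_lebesgue_integral_def
    using lborel_integral_real_affine[of "-1" "\<lambda>u. indicator {0..N} u * f u" N] by simp
  also have "(\<lambda>u. indicator {0..N} (N - u) * f (N - u)) = (\<lambda>u. indicator {0..N} u * f (N - u))"
    by (auto simp: indicator_def fun_eq_iff)
  finally show ?thesis by (simp add: integral_seg set_lebesgue_integral_def)
qed

lemma integral_seg_symmetric:
  fixes f :: "real \<Rightarrow> real"
  assumes [measurable]: "f \<in> borel_measurable borel" and i: "integrable (seg N) f"
    and sym: "\<And>u. f (N - u) = f u" and N: "0 \<le> N"
  shows "(\<integral>u. f u \<partial>seg N) = 2 * (\<integral>u. f u \<partial>seg (N / 2))"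
proof -
  have i': "integrable lborel (\<lambda>u. indicator {0..N} u *\<^sub>R f u)" using i by (simp add: integrable_seg set_integrable_def)
  have A: "integrable lborel (\<lambda>u. indicator {0..N/2} u * f u)"
    by (rule Bochner_Integration.integrable_bound[OF i']) (use N in \<open>auto simp: indicator_def\<close>)
  have B: "integrable lborel (\<lambda>u. indicator {N/2<..N} u * f u)"
    by (rule Bochner_Integration.integrable_bound[OF i']) (use N in \<open>auto simp: indicator_def\<close>)
  have "(\<integral>u. indicator {0..N} u * f u \<partial>lborel) = (\<integral>u. indicator {0..N/2} u * f u + indicator {N/2<..N} u * f u \<partial>lborel)"
    by (rule Bochner_Integration.integral_cong) (use N in \<open>auto simp: indicator_def\<close>)
  also have "\<dots> = (\<integral>u. indicator {0..N/2} u * f u \<partial>lborel) + (\<integral>u. indicator {N/2<..N} u * f u \<partial>lborel)"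
    using A B by simp
  also have "(\<integral>u. indicator {N/2<..N} u * f u \<partial>lborel) = (\<integral>u. indicator {N/2<..N} (N - u) * f u \<partial>lborel)"
    using lborel_integral_real_affine[of "-1" "\<lambda>u. indicator {N/2<..N} u * f u" N] by (simp add: sym)
  also have "\<dots> = (\<integral>u. indicator {0..N/2} u * f u \<partial>lborel)"
  proof (rule integral_cong_AE)
    show "AE u in lborel. indicator {N/2<..N} (N - u) * f u = indicator {0..N/2} u * f u"
      using AE_lborel_singleton[of "N/2"] by eventually_elim (auto simp: indicator_def field_simps)
  qed measurable
  finally show ?thesis by (simp add: integral_seg set_lebesgue_integral_def)
qed

text \<open>Up to pi/3 the derivative cos is at least 1/2; from there on sin is at least sqrt 3 / 2,
  which exceeds pi/4.\<close>

lemma sin_ge_half: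
  fixes t :: real
  assumes "0 \<le> t" "t \<le> pi / 2" shows "t / 2 \<le> sin t"
proof (cases "t \<le> pi / 3")
  case True
  have "(\<lambda>x. sin x - x / 2) 0 \<le> (\<lambda>x. sin x - x / 2) t"
  proof (rule DERIV_nonneg_imp_nondecreasing[OF assms(1)])
    fix x assume x: "0 \<le> x" "x \<le> t"
    have "cos (pi / 3) \<le> cos x" using x True by (intro cos_monotone_0_pi_le) auto
    then show "\<exists>y. ((\<lambda>x. sin x - x / 2) has_real_derivative y) (at x) \<and> 0 \<le> y"
      by (intro exI[of _ "cos x - 1 / 2"]) (auto intro!: derivative_eq_intros simp: cos_60)
  qed
  then show ?thesis by simp
next
  case False
  have "sin (pi / 3) \<le> sin t" using False assms by (intro sin_monotone_2pi_le) auto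
  moreover have "pi \<le> 32 / 10" using pi_approx by simp
  then have "t / 2 \<le> 4 / 5" using assms by linarith
  moreover have "8 / 5 \<le> sqrt 3" by (rule real_le_rsqrt) (simp add: power2_eq_square)
  ultimately show ?thesis using sin_60 by linarith
qed

text \<open>In the product formula the sine of the half sum is at least the sine of the half
  difference. A quadratic bound is the right one because cos is flat at 0 and pi, and it is uniform
  up to these ends.\<close>

lemma cos_diff_ge:
  assumes "0 \<le> \<phi>" "\<phi> \<le> \<theta>" "\<theta> \<le> pi"
  shows "(\<phi> - \<theta>)\<^sup>2 / 8 \<le> cos \<phi> - cos \<theta>"
proof -
  let ?d = "(\<theta> - \<phi>) / 2"
  have "cos \<phi> - cos \<theta> = 2 * sin ((\<phi> + \<theta>) / 2) * sin ?d" by (simp add: cos_diff_cos)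
  moreover have "sin ?d \<le> sin ((\<phi> + \<theta>) / 2)"
  proof -
    have "sin ((\<phi> + \<theta>) / 2) - sin ?d = 2 * sin (\<phi> / 2) * cos (\<theta> / 2)"
      by (simp add: sin_diff_sin add_divide_distrib diff_divide_distrib)
    moreover have "0 \<le> sin (\<phi> / 2)" using assms by (intro sin_ge_zero) auto
    moreover have "0 \<le> cos (\<theta> / 2)" using assms by (intro cos_ge_zero) auto
    ultimately show ?thesis by (metis diff_ge_0_iff_ge mult_nonneg_nonneg zero_le_numeral)
  qed
  moreover have d: "?d / 2 \<le> sin ?d" "0 \<le> ?d / 2" using assms sin_ge_half[of ?d] by auto
  ultimately have "?d / 2 * (?d / 2) \<le> sin ((\<phi> + \<theta>) / 2) * sin ?d" by (intro mult_mono) linarith+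
  then have "2 * (?d / 2 * (?d / 2)) \<le> cos \<phi> - cos \<theta>"
    using \<open>cos \<phi> - cos \<theta> = 2 * sin ((\<phi> + \<theta>) / 2) * sin ?d\<close> by simp
  then show ?thesis by (simp add: power2_eq_square field_simps)
qed

text \<open>The function L of the overview: pi times the mean of \<open>ln \<bar>x - t\<bar>\<close>
  for t distributed by the arcsine law on [-2,2].\<close>

definition cos_log :: "real \<Rightarrow> real" where
  "cos_log x = (\<integral>\<theta>. ln \<bar>x - 2 * cos \<theta>\<bar> \<partial>seg pi)"

text \<open>With x = 2 cos \<open>\<phi>\<close> the distance is at least a quarter of the square of
  \<open>\<phi> - \<theta>\<close>, so the singularity is at most that of twice a logarithm in the
  angle. The 32 is twice the value 4 * 4 of \<open>steep_log_bound\<close>.\<close>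

lemma cos_log_nn_bound:
  assumes x: "\<bar>x\<bar> \<le> 2"
  shows "(\<integral>\<^sup>+\<theta>. ennreal \<bar>ln \<bar>x - 2 * cos \<theta>\<bar>\<bar> \<partial>seg pi) \<le> ennreal (32 + ln 4 * pi)"
proof -
  define \<phi> where "\<phi> = arccos (x / 2)"
  have \<phi>: "0 \<le> \<phi>" "\<phi> \<le> pi" "2 * cos \<phi> = x" using x by (auto simp: \<phi>_def arccos_lbound arccos_ubound cos_arccos)
  have "(\<integral>\<^sup>+\<theta>. ennreal \<bar>ln \<bar>x - 2 * cos \<theta>\<bar>\<bar> \<partial>seg pi) \<le> (\<integral>\<^sup>+\<theta>. ennreal 2 * ennreal (ln (4 / \<bar>\<phi> - \<theta>\<bar>)) + ennreal (ln 4) \<partial>seg pi)"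
  proof (intro nn_integral_mono_AE AE_segI)
    fix \<theta> :: real assume \<theta>: "0 \<le> \<theta>" "\<theta> \<le> pi"
    let ?T = "\<bar>x - 2 * cos \<theta>\<bar>"
    have T4: "?T \<le> 4" using x cos_le_one[of \<theta>] cos_ge_minus_one[of \<theta>] by linarith
    have Td: "(\<phi> - \<theta>)\<^sup>2 / 4 \<le> ?T"
    proof (cases "\<phi> \<le> \<theta>")
      case True then show ?thesis using cos_diff_ge[of \<phi> \<theta>] \<phi> \<theta> by linarith
    next
      case False then show ?thesis using cos_diff_ge[of \<theta> \<phi>] \<phi> \<theta> power2_commute[of \<phi> \<theta>] by linarith
    qed
    have "ennreal (ln (4 / ?T)) \<le> ennreal 2 * ennreal (ln (4 / \<bar>\<phi> - \<theta>\<bar>))"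
    proof (cases "\<phi> = \<theta>")
      case True
      then have "?T = 0" using \<phi> by simp
      then show ?thesis by simp
    next
      case False
      then have d: "0 < \<bar>\<phi> - \<theta>\<bar>" by simp
      then have T: "0 < ?T" using Td by (smt (verit) divide_pos_pos zero_less_power2)
      have "4 / ?T \<le> (4 / \<bar>\<phi> - \<theta>\<bar>)\<^sup>2"
        using Td d T by (simp add: power_divide field_simps)
      then have "ln (4 / ?T) \<le> ln ((4 / \<bar>\<phi> - \<theta>\<bar>)\<^sup>2)" using T d by (subst ln_le_cancel_iff) auto
      also have "\<dots> = 2 * ln (4 / \<bar>\<phi> - \<theta>\<bar>)" using d by (simp add: ln_realpow)
      finally have "ennreal (ln (4 / ?T)) \<le> ennreal (2 * ln (4 / \<bar>\<phi> - \<theta>\<bar>))" by (rule ennreal_leI)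
      also have "\<dots> = ennreal 2 * ennreal (ln (4 / \<bar>\<phi> - \<theta>\<bar>))" by (rule ennreal_mult') simp
      finally show ?thesis .
    qed
    then show "ennreal \<bar>ln ?T\<bar> \<le> ennreal 2 * ennreal (ln (4 / \<bar>\<phi> - \<theta>\<bar>)) + ennreal (ln 4)"
      using abs_ln_le[of "x - 2 * cos \<theta>" 4] T4 by (meson add_right_mono order_trans one_le_numeral)
  qed
  also have "\<dots> = ennreal 2 * (\<integral>\<^sup>+\<theta>. ennreal (ln (4 / \<bar>\<phi> - \<theta>\<bar>)) \<partial>seg pi) + ennreal (ln 4) * ennreal pi"
    by (simp add: nn_integral_add nn_integral_cmult emeasure_seg)
  also have "\<dots> \<le> ennreal 2 * ennreal 16 + ennreal (ln 4) * ennreal pi"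
  proof (intro add_mono mult_left_mono order_refl)
    have st: "steep (\<lambda>\<theta>. - \<theta>)" by (simp add: steep_def)
    have "(\<integral>\<^sup>+\<theta>. ennreal (ln (4 / \<bar>\<phi> - \<theta>\<bar>)) \<partial>seg pi) \<le> (\<integral>\<^sup>+\<theta>. ennreal (ln (4 / \<bar>(-\<phi>) - (-\<theta>)\<bar>)) \<partial>lborel)"
      by (subst nn_integral_seg) (auto intro!: nn_integral_mono simp: indicator_def abs_minus_commute)
    also have "\<dots> \<le> ennreal (4 * 4)" by (rule steep_log_bound[OF st]) simp
    finally show "(\<integral>\<^sup>+\<theta>. ennreal (ln (4 / \<bar>\<phi> - \<theta>\<bar>)) \<partial>seg pi) \<le> ennreal 16" by simp
  qed simp_all
  also have "\<dots> = ennreal (32 + ln 4 * pi)" by (simp add: ennreal_plus flip: ennreal_mult)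
  finally show ?thesis .
qed

lemma cos_log_integrable: "integrable (seg pi) (\<lambda>\<theta>. ln \<bar>x - 2 * cos \<theta>\<bar>)"
proof (cases "\<bar>x\<bar> \<le> 2")
  case True
  show ?thesis
  proof (rule integrableI_bounded)
    show "(\<integral>\<^sup>+\<theta>. ennreal (norm (ln \<bar>x - 2 * cos \<theta>\<bar>)) \<partial>seg pi) < \<infinity>"
      using cos_log_nn_bound[OF True] le_less_trans by fastforce
  qed measurable
next
  case False
  show ?thesis
  proof (rule integrable_seg_bounded[where C="\<bar>ln (\<bar>x\<bar> - 2)\<bar> + \<bar>ln (\<bar>x\<bar> + 2)\<bar>"])
    fix \<theta> :: real
    have b: "\<bar>x\<bar> - 2 \<le> \<bar>x - 2 * cos \<theta>\<bar>" "\<bar>x - 2 * cos \<theta>\<bar> \<le> \<bar>x\<bar> + 2"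
      using cos_le_one[of \<theta>] cos_ge_minus_one[of \<theta>] by linarith+
    then have "ln (\<bar>x\<bar> - 2) \<le> ln \<bar>x - 2 * cos \<theta>\<bar>" "ln \<bar>x - 2 * cos \<theta>\<bar> \<le> ln (\<bar>x\<bar> + 2)"
      using False by (subst ln_le_cancel_iff; linarith)+
    then show "\<bar>ln \<bar>x - 2 * cos \<theta>\<bar>\<bar> \<le> \<bar>ln (\<bar>x\<bar> - 2)\<bar> + \<bar>ln (\<bar>x\<bar> + 2)\<bar>" by linarith
  qed measurable
qed

lemma cos_log_bounded: "\<bar>x\<bar> \<le> 2 \<Longrightarrow> \<bar>cos_log x\<bar> \<le> 32 + ln 4 * pi"
proof -
  assume x: "\<bar>x\<bar> \<le> 2"
  have "ennreal \<bar>cos_log x\<bar> \<le> (\<integral>\<^sup>+\<theta>. ennreal \<bar>ln \<bar>x - 2 * cos \<theta>\<bar>\<bar> \<partial>seg pi)"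
    unfolding cos_log_def using integral_norm_bound_ennreal[OF cos_log_integrable[of x]] by simp
  also have "\<dots> \<le> ennreal (32 + ln 4 * pi)" by (rule cos_log_nn_bound[OF x])
  finally show ?thesis by (subst (asm) ennreal_le_iff) auto
qed

lemma cos_log_minus: "cos_log (- x) = cos_log x"
proof -
  have "cos_log (- x) = (\<integral>\<theta>. ln \<bar>- x - 2 * cos (pi - \<theta>)\<bar> \<partial>seg pi)"
    unfolding cos_log_def by (rule integral_seg_reflect[symmetric]) measurable
  also have "\<dots> = (\<integral>\<theta>. ln \<bar>x - 2 * cos \<theta>\<bar> \<partial>seg pi)"
    by (rule Bochner_Integration.integral_cong) (auto simp: abs_if)
  finally show ?thesis by (simp add: cos_log_def)
qed

lemma cos_AE_neq: "AE \<theta> in seg pi. x \<noteq> 2 * cos \<theta>"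
proof -
  have "AE \<theta> in lborel. \<theta> \<noteq> arccos (x / 2)" by (rule AE_lborel_singleton)
  then show ?thesis unfolding AE_seg
  proof eventually_elim
    case (elim \<theta>)
    show ?case
    proof
      assume "\<theta> \<in> {0..pi}"
      then have "arccos (cos \<theta>) = \<theta>" by (intro arccos_cos) auto
      then show "x \<noteq> 2 * cos \<theta>" using elim by auto
    qed
  qed
qed

text \<open>The difference x^2 - 2 - 2 cos(2 \<open>\<theta>\<close>) factors as (x - 2 cos
  \<open>\<theta>\<close>)(x + 2 cos \<open>\<theta>\<close>), and both factors have the same
  logarithmic integral by reflection. The doubled angle sweeps two mirror copies of [0,pi].\<close>

lemma cos_log_double: "cos_log (x\<^sup>2 - 2) = 2 * cos_log x"
proof -
  define y where "y = x\<^sup>2 - 2"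
  let ?f = "\<lambda>t. ln \<bar>y - 2 * cos t\<bar>"
  have eq: "AE \<theta> in seg pi. ?f (2 * \<theta>) = ln \<bar>x - 2 * cos \<theta>\<bar> + ln \<bar>- x - 2 * cos \<theta>\<bar>"
    using cos_AE_neq[of x] cos_AE_neq[of "-x"]
  proof eventually_elim
    case (elim \<theta>)
    have "y - 2 * cos (2 * \<theta>) = - ((x - 2 * cos \<theta>) * (- x - 2 * cos \<theta>))"
      unfolding y_def cos_double_cos by (simp add: algebra_simps power2_eq_square)
    then have "\<bar>y - 2 * cos (2 * \<theta>)\<bar> = \<bar>x - 2 * cos \<theta>\<bar> * \<bar>- x - 2 * cos \<theta>\<bar>" by (simp add: abs_mult)
    moreover have "0 < \<bar>x - 2 * cos \<theta>\<bar>" "0 < \<bar>- x - 2 * cos \<theta>\<bar>" using elim by auto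
    ultimately show ?case using ln_mult_pos[of "\<bar>x - 2 * cos \<theta>\<bar>" "\<bar>- x - 2 * cos \<theta>\<bar>"] by simp
  qed
  have i: "integrable (seg pi) (\<lambda>\<theta>. ?f (2 * \<theta>))"
    by (rule Bochner_Integration.integrable_cong_AE_imp[OF Bochner_Integration.integrable_add[OF cos_log_integrable[of x] cos_log_integrable[of "-x"]]])
      (use eq in \<open>auto elim: eventually_mono\<close>)
  have "(\<integral>\<theta>. ?f (2 * \<theta>) \<partial>seg pi) = (\<integral>\<theta>. ln \<bar>x - 2 * cos \<theta>\<bar> + ln \<bar>- x - 2 * cos \<theta>\<bar> \<partial>seg pi)"
    by (rule integral_cong_AE) (use eq in auto)
  also have "\<dots> = cos_log x + cos_log (- x)"
    unfolding cos_log_def by (rule Bochner_Integration.integral_add[OF cos_log_integrable[of x] cos_log_integrable[of "-x"]])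
  also have "\<dots> = 2 * cos_log x" by (simp add: cos_log_minus)
  finally have 1: "(\<integral>\<theta>. ?f (2 * \<theta>) \<partial>seg pi) = 2 * cos_log x" .
  have "(\<integral>\<theta>. ?f (2 * \<theta>) \<partial>seg pi) = 2 * (\<integral>\<theta>. ?f (2 * \<theta>) \<partial>seg (pi / 2))"
  proof (rule integral_seg_symmetric[OF _ i])
    fix u show "?f (2 * (pi - u)) = ?f (2 * u)" by (simp add: cos_diff right_diff_distrib)
  qed simp_all
  also have "\<dots> = (\<integral>\<theta>. ?f \<theta> \<partial>seg (2 * (pi / 2)))"
    by (subst integral_seg_scale) auto
  finally show ?thesis using 1 by (simp add: cos_log_def y_def)
qed

text \<open>The map x -> x^2 - 2 preserves [-2,2], where a bound K is known; n doublings improve it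
  to K / 2^n. The integral is thus found without being computed.\<close>

lemma cos_log_eq_0:
  assumes "\<bar>x\<bar> \<le> 2" shows "cos_log x = 0"
proof -
  define K where "K = 32 + ln 4 * pi"
  have b: "\<bar>cos_log x\<bar> \<le> K / 2 ^ n" if "\<bar>x\<bar> \<le> 2" for n x
    using that
  proof (induction n arbitrary: x)
    case 0 then show ?case using cos_log_bounded[of x] by (simp add: K_def)
  next
    case (Suc n)
    have "\<bar>x\<bar>\<^sup>2 \<le> 2\<^sup>2" using Suc.prems by (intro power_mono) auto
    then have "x\<^sup>2 \<le> 4" by simp
    then have "\<bar>x\<^sup>2 - 2\<bar> \<le> 2" using zero_le_power2[of x] by linarith
    from Suc.IH[OF this] show ?case by (simp add: cos_log_double abs_mult field_simps)
  qed
  have "(\<lambda>n. K / 2 ^ n) \<longlonglongrightarrow> 0" by real_asymp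
  then have "\<bar>cos_log x\<bar> \<le> 0"
    by (rule LIMSEQ_le_const) (use b[OF assms] in auto)
  then show ?thesis by simp
qed

text \<open>To the right of 2 each logarithm is larger than at x = 2, where the integral vanishes;
  evenness does the rest.\<close>

lemma cos_log_nonneg: "0 \<le> cos_log x"
proof -
  have *: "0 \<le> cos_log x" if "2 < x" for x
  proof -
    have "cos_log 2 \<le> cos_log x" unfolding cos_log_def
    proof (rule integral_mono_AE[OF cos_log_integrable cos_log_integrable])
      show "AE \<theta> in seg pi. ln \<bar>2 - 2 * cos \<theta>\<bar> \<le> ln \<bar>x - 2 * cos \<theta>\<bar>"
        using cos_AE_neq[of 2]
      proof eventually_elim
        case (elim \<theta>)
        then show ?case using that cos_le_one[of \<theta>] by (subst ln_le_cancel_iff) linarith+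
      qed
    qed
    then show ?thesis by (simp add: cos_log_eq_0)
  qed
  show ?thesis
    using *[of x] *[of "-x"] cos_log_eq_0[of x] cos_log_minus[of x] by (cases "\<bar>x\<bar> \<le> 2"; cases "0 \<le> x") auto
qed

lemma cos_log_ge:
  assumes "2 < \<bar>x\<bar>" shows "pi * ln (\<bar>x\<bar> - 2) \<le> cos_log x"
proof -
  have "(\<integral>\<theta>. ln (\<bar>x\<bar> - 2) \<partial>seg pi) \<le> cos_log x" unfolding cos_log_def
  proof (rule integral_mono[OF _ cos_log_integrable])
    fix \<theta> show "ln (\<bar>x\<bar> - 2) \<le> ln \<bar>x - 2 * cos \<theta>\<bar>"
      using assms cos_le_one[of \<theta>] cos_ge_minus_one[of \<theta>] by (subst ln_le_cancel_iff) linarith+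
  qed simp
  then show ?thesis by (simp add: measure_seg_UNIV)
qed

definition log_prim :: "real \<Rightarrow> real" where
  "log_prim t = t * ln \<bar>t\<bar> - t"

lemma log_prim_minus: "log_prim (- t) = - log_prim t"
  by (simp add: log_prim_def)

text \<open>Continuity at 0, where the derivative blows up, lets the fundamental theorem in
  \<open>log_FTC\<close> cross the singularity.\<close>

lemma log_prim_isCont: "isCont log_prim t"
proof -
  have "isCont (\<lambda>x::real. x * ln \<bar>x\<bar>) t"
  proof (cases "t = 0")
    case True
    have "((\<lambda>x::real. x * ln x) \<longlongrightarrow> 0) (at_right 0)" by real_asymp
    then have r: "((\<lambda>x::real. x * ln \<bar>x\<bar>) \<longlongrightarrow> 0) (at_right 0)"
      by (rule Lim_transform_eventually) (auto simp: eventually_at_right_less intro!: eventually_at_rightI[of 0 1])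
    have "((\<lambda>x::real. x * ln (- x)) \<longlongrightarrow> 0) (at_left 0)" by real_asymp
    then have l: "((\<lambda>x::real. x * ln \<bar>x\<bar>) \<longlongrightarrow> 0) (at_left 0)"
      by (rule Lim_transform_eventually) (auto intro!: eventually_at_leftI[of "-1"])
    show ?thesis using filterlim_split_at[OF l r] True by (simp add: isCont_def)
  next
    case False
    then show ?thesis by (intro continuous_intros) auto
  qed
  from isCont_diff[OF this continuous_ident] show ?thesis by (simp add: log_prim_def[abs_def])
qed

lemma log_prim_deriv: "t \<noteq> 0 \<Longrightarrow> (log_prim has_real_derivative ln \<bar>t\<bar>) (at t)"
proof -
  assume t: "t \<noteq> 0"
  have d: "((\<lambda>t. t * ln (c * t) - t) has_real_derivative ln (c * t)) (at t)" if "0 < c * t" for c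
    using that t by (auto intro!: derivative_eq_intros)
  show ?thesis
  proof (cases "0 < t")
    case True
    show ?thesis
      using has_field_derivative_transform_within_open[OF d[of 1], of "{0<..}" log_prim] True by (auto simp: log_prim_def)
  next
    case False
    show ?thesis
      using has_field_derivative_transform_within_open[OF d[of "-1"], of "{..<0}" log_prim] False t by (auto simp: log_prim_def)
  qed
qed

lemma log_FTC:
  assumes h: "0 \<le> h"
  shows "(\<integral>w. ln \<bar>c + w\<bar> \<partial>seg h) = log_prim (c + h) - log_prim c"
proof -
  have i: "integrable (seg h) (\<lambda>w. ln \<bar>c - (- w)\<bar>)"
    by (rule log_integrable[where C="\<bar>c\<bar> + h"]) (use h in \<open>auto simp: steep_def\<close>)
  then have si: "set_integrable lborel {0..h} (\<lambda>w. ln \<bar>c + w\<bar>)" by (simp add: integrable_seg)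
  have "((\<lambda>w. ln \<bar>c + w\<bar>) has_integral log_prim (c + h) - log_prim (c + 0)) {0..h}"
  proof (rule fundamental_theorem_of_calculus_interior_strong[where S="{-c}"])
    show "continuous_on {0..h} (\<lambda>w. log_prim (c + w))"
      by (intro continuous_at_imp_continuous_on ballI isCont_o2[OF _ log_prim_isCont] continuous_intros)
    fix w assume "w \<in> {0<..<h} - {-c}"
    then have "c + w \<noteq> 0" by auto
    have "((\<lambda>w. log_prim (c + w)) has_real_derivative ln \<bar>c + w\<bar> * 1) (at w)"
      by (rule DERIV_chain2[where f=log_prim and g="\<lambda>w. c + w", OF log_prim_deriv[OF \<open>c + w \<noteq> 0\<close>]]) (auto intro!: derivative_eq_intros)
    then show "((\<lambda>w. log_prim (c + w)) has_vector_derivative ln \<bar>c + w\<bar>) (at w)"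
      by (simp add: has_real_derivative_iff_has_vector_derivative[symmetric])
  qed (use h in auto)
  then show ?thesis
    using set_borel_integral_eq_integral(2)[OF si] by (simp add: integral_seg integral_unique)
qed

section \<open>The limit shape\<close>

text \<open>
  The limit shape, in the coordinates \<open>(u, \<psi> u - u)\<close>: \<open>vk_tail s\<close> is the length of \<open>{u \<ge> 0. \<psi> u - u > s}\<close>
  for the Vershik-Kerov-Logan-Shepp shape, whose density of \<open>\<psi> u - u\<close> is \<open>arccos (s/2) / \<pi>\<close>.
\<close>

definition vk_tail :: "real \<Rightarrow> real" where
  "vk_tail s = (\<integral>\<theta>. max (2 * cos \<theta> - s) 0 \<partial>seg pi) / pi"

lemma integral_cos_seg: "(\<integral>\<theta>. cos \<theta> \<partial>seg pi) = 0"
proof -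
  have "(\<integral>\<theta>. cos \<theta> \<partial>seg pi) = (\<integral>\<theta>. cos (pi - \<theta>) \<partial>seg pi)"
    by (rule integral_seg_reflect[symmetric]) measurable
  also have "\<dots> = - (\<integral>\<theta>. cos \<theta> \<partial>seg pi)" by simp
  finally show ?thesis by simp
qed

lemma cos_integrable: "integrable (seg N) (\<lambda>\<theta>. cos \<theta> :: real)"
  by (rule integrable_seg_bounded[where C=1]) (auto simp: abs_cos_le_one)

lemma cos2_integrable: "integrable (seg N) (\<lambda>\<theta>. (cos \<theta>)\<^sup>2 :: real)"
proof (rule integrable_seg_bounded[where C=1])
  fix u :: real show "\<bar>(cos u)\<^sup>2\<bar> \<le> 1" using abs_square_le_1[of "cos u"] by simp
qed measurable

lemma integral_cos2_seg: "(\<integral>\<theta>. (cos \<theta>)\<^sup>2 \<partial>seg pi) = pi / 2"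
proof -
  have "(\<integral>\<theta>. (cos \<theta>)\<^sup>2 \<partial>seg pi) = (\<integral>\<theta>. (cos \<theta>)\<^sup>2 * indicator {0..pi} \<theta> \<partial>lborel)"
    by (simp add: integral_seg set_lebesgue_integral_def mult.commute)
  also have "\<dots> = (pi + sin pi * cos pi) / 2 - (0 + sin 0 * cos 0) / 2"
  proof (rule integral_FTC_Icc_nonneg)
    fix x :: real
    have "((\<lambda>x. (x + sin x * cos x) / 2) has_real_derivative (1 + (cos x * cos x - sin x * sin x)) / 2) (at x)"
      by (auto intro!: derivative_eq_intros)
    moreover have "(1 + (cos x * cos x - sin x * sin x)) / 2 = (cos x)\<^sup>2"
      using sin_cos_squared_add[of x] by (simp add: power2_eq_square)
    ultimately show "((\<lambda>x. (x + sin x * cos x) / 2) has_real_derivative (cos x)\<^sup>2) (at x)" by simp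
  qed auto
  finally show ?thesis by simp
qed

lemma vk_tail_integrable: "integrable (seg pi) (\<lambda>\<theta>. max (2 * cos \<theta> - s) 0)"
proof (rule integrable_seg_bounded[where C="2 + \<bar>s\<bar>"])
  fix \<theta> :: real
  have "2 * cos \<theta> - s \<le> 2 + \<bar>s\<bar>" using cos_le_one[of \<theta>] by linarith
  then show "\<bar>max (2 * cos \<theta> - s) 0\<bar> \<le> 2 + \<bar>s\<bar>" by simp
qed measurable

lemma vk_tail_mono: "s \<le> s' \<Longrightarrow> vk_tail s' \<le> vk_tail s"
  unfolding vk_tail_def
proof (rule divide_right_mono)
  assume "s \<le> s'"
  then show "(\<integral>\<theta>. max (2 * cos \<theta> - s') 0 \<partial>seg pi) \<le> (\<integral>\<theta>. max (2 * cos \<theta> - s) 0 \<partial>seg pi)"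
    by (intro integral_mono vk_tail_integrable) auto
qed simp

text \<open>Because the tail falls with slope at most 1 in absolute value, its inverse falls at
  least that fast; adding u therefore still leaves \<open>vk_shape\<close> decreasing.\<close>

lemma vk_tail_lipschitz: "s \<le> s' \<Longrightarrow> vk_tail s \<le> vk_tail s' + (s' - s)"
proof -
  assume ss: "s \<le> s'"
  have "(\<integral>\<theta>. max (2 * cos \<theta> - s) 0 \<partial>seg pi) \<le> (\<integral>\<theta>. max (2 * cos \<theta> - s') 0 + (s' - s) \<partial>seg pi)"
    using ss by (intro integral_mono vk_tail_integrable Bochner_Integration.integrable_add) auto
  also have "\<dots> = (\<integral>\<theta>. max (2 * cos \<theta> - s') 0 \<partial>seg pi) + (s' - s) * pi"
    using vk_tail_integrable by (subst Bochner_Integration.integral_add) (auto simp: measure_seg_UNIV)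
  finally show ?thesis unfolding vk_tail_def by (simp add: field_simps)
qed

lemma vk_tail_isCont: "isCont vk_tail s"
proof -
  have "1-lipschitz_on UNIV vk_tail"
  proof (rule lipschitz_onI)
    fix x y :: real
    show "dist (vk_tail x) (vk_tail y) \<le> 1 * dist x y"
      using vk_tail_mono[of x y] vk_tail_mono[of y x] vk_tail_lipschitz[of x y] vk_tail_lipschitz[of y x]
      by (auto simp: dist_real_def abs_if)
  qed simp
  then show ?thesis using lipschitz_on_continuous_on continuous_on_eq_continuous_at by blast
qed

lemma vk_tail_ge: "- s \<le> vk_tail s" and vk_tail_nonneg: "0 \<le> vk_tail s"
  and vk_tail_right: "2 \<le> s \<Longrightarrow> vk_tail s = 0" and vk_tail_left: "s \<le> -2 \<Longrightarrow> vk_tail s = - s"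
proof -
  have lin: "(\<integral>\<theta>. 2 * cos \<theta> - s \<partial>seg pi) = - s * pi"
    using cos_integrable by (simp add: integral_cos_seg measure_seg_UNIV)
  have "(\<integral>\<theta>. 2 * cos \<theta> - s \<partial>seg pi) \<le> (\<integral>\<theta>. max (2 * cos \<theta> - s) 0 \<partial>seg pi)"
    by (intro integral_mono vk_tail_integrable) (auto simp: cos_integrable)
  then show "- s \<le> vk_tail s" using lin by (simp add: vk_tail_def field_simps)
  show "0 \<le> vk_tail s" unfolding vk_tail_def by (intro divide_nonneg_nonneg Bochner_Integration.integral_nonneg) auto
  show "vk_tail s = 0" if "2 \<le> s"
  proof -
    have "2 * cos \<theta> - s \<le> 0" for \<theta> using cos_le_one[of \<theta>] that by linarith
    then have "max (2 * cos \<theta> - s) 0 = 0" for \<theta> by (simp add: max_def)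
    then show ?thesis by (simp add: vk_tail_def)
  qed
  show "vk_tail s = - s" if "s \<le> -2"
  proof -
    have "0 \<le> 2 * cos \<theta> - s" for \<theta> using cos_ge_minus_one[of \<theta>] that by linarith
    then have "max (2 * cos \<theta> - s) 0 = 2 * cos \<theta> - s" for \<theta> by (rule max_absorb1)
    with lin show ?thesis unfolding vk_tail_def by (simp only:) simp
  qed
qed

definition vk_quantile :: "real \<Rightarrow> real" where
  "vk_quantile u = Inf {s. vk_tail s \<le> u}"

text \<open>The clamp extends the function constantly to the left of 0, since \<open>shape\<close>
  demands monotonicity on the whole line.\<close>

definition vk_shape :: "real \<Rightarrow> real" where
  "vk_shape u = vk_quantile (max u 0) + max u 0"

lemma vk_quantile:
  assumes u: "0 \<le> u"
  shows "vk_tail (vk_quantile u) = u" "vk_quantile u \<le> s \<longleftrightarrow> vk_tail s \<le> u" "- u \<le> vk_quantile u" "vk_quantile u \<le> 2"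
proof -
  let ?S = "{s. vk_tail s \<le> u}"
  have ne: "2 \<in> ?S" using u by (simp add: vk_tail_right)
  have lb: "- u \<le> s" if "s \<in> ?S" for s using vk_tail_ge[of s] that by simp
  have bdd: "bdd_below ?S" by (rule bdd_belowI) (rule lb)
  show "vk_quantile u \<le> 2" unfolding vk_quantile_def by (rule cInf_lower[OF ne bdd])
  show "- u \<le> vk_quantile u" unfolding vk_quantile_def by (rule cInf_greatest) (use ne lb in auto)
  have "closed ?S" by (intro closed_Collect_le continuous_at_imp_continuous_on ballI vk_tail_isCont continuous_intros)
  then have "vk_quantile u \<in> ?S" unfolding vk_quantile_def using ne bdd by (intro closed_contains_Inf) auto
  then have le: "vk_tail (vk_quantile u) \<le> u" by simp
  show "vk_quantile u \<le> s \<longleftrightarrow> vk_tail s \<le> u"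
  proof
    assume "vk_quantile u \<le> s"
    then show "vk_tail s \<le> u" using vk_tail_mono le order_trans by blast
  next
    assume "vk_tail s \<le> u"
    then show "vk_quantile u \<le> s" unfolding vk_quantile_def by (intro cInf_lower bdd) simp
  qed
  have "u \<le> vk_tail (vk_quantile u)"
  proof (rule ccontr)
    assume "\<not> u \<le> vk_tail (vk_quantile u)"
    then have d: "0 < u - vk_tail (vk_quantile u)" by simp
    \<comment> \<open>By the slope bound a deficit of the tail leaves room to move left by just that
      amount, against the choice of the infimum.\<close>
    define s where "s = vk_quantile u - (u - vk_tail (vk_quantile u))"
    have "vk_tail s \<le> vk_tail (vk_quantile u) + (vk_quantile u - s)" using d by (intro vk_tail_lipschitz) (simp add: s_def)
    then have "vk_tail s \<le> u" by (simp add: s_def)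
    then have "vk_quantile u \<le> s" unfolding vk_quantile_def by (intro cInf_lower bdd) simp
    then show False using d by (simp add: s_def)
  qed
  with le show "vk_tail (vk_quantile u) = u" by simp
qed

lemma vk_shape_eq: "0 \<le> u \<Longrightarrow> vk_shape u - u = vk_quantile u"
  by (simp add: vk_shape_def)

lemma shape_vk: assumes N: "2 \<le> N" shows "shape N vk_shape"
  unfolding shape_def
proof (intro conjI allI impI antimonoI)
  show "0 < N" using N by simp
  show "0 \<le> vk_shape x" for x using vk_quantile(3)[of "max x 0"] by (simp add: vk_shape_def)
  show "vk_shape y \<le> vk_shape x" if "x \<le> y" for x y
  proof -
    let ?x = "max x 0" and ?y = "max y 0"
    have "vk_tail (vk_quantile ?x) \<le> ?y" using that by (subst vk_quantile(1)) auto
    then have "vk_quantile ?y \<le> vk_quantile ?x" using vk_quantile(2)[of ?y "vk_quantile ?x"] by simp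
    from vk_tail_lipschitz[OF this] have "?y \<le> ?x + (vk_quantile ?x - vk_quantile ?y)" by (simp only: vk_quantile(1) max.cobounded2)
    then show ?thesis unfolding vk_shape_def by linarith
  qed
  show "vk_shape x = 0" if "N \<le> x" for x
  proof -
    have x: "2 \<le> x" using that N by simp
    have "vk_tail (- x) \<le> x" using x by (simp add: vk_tail_left)
    then have "vk_quantile x \<le> - x" using vk_quantile(2)[of x "-x"] x by simp
    then show ?thesis using vk_quantile(3)[of x] x by (simp add: vk_shape_def)
  qed
qed

text \<open>
  The density of \<open>vk_shape u - u\<close> is the tail of the arcsine law, so its distribution is a mixture of Lebesgue
  measures on \<open>(-N, 2 cos \<theta>)\<close>.
\<close>

lemma vk_push_forward:
  assumes N: "2 \<le> N" and [measurable]: "f \<in> borel_measurable borel"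
    and i: "integrable (seg N) (\<lambda>u. f (vk_shape u - u))"
  shows "(\<integral>u. f (vk_shape u - u) \<partial>seg N) = (\<integral>\<theta>. (\<integral>w. f (w - N) \<partial>seg (2 * cos \<theta> + N)) \<partial>seg pi) / pi"
proof -
  note sh = shape_vk[OF N]
  note [measurable] = shape_measurable[OF sh]
  let ?a = "\<lambda>u. vk_shape u - u"
  \<comment> \<open>Density of a pair: the angle is uniform on [0,pi] (hence the 1/pi), and given it
    the second coordinate is Lebesgue on (-N, 2 cos \<open>\<theta>\<close>).\<close>
  define d where "d = (\<lambda>p::real\<times>real. indicator {p. - N < snd p \<and> snd p < 2 * cos (fst p)} p / pi)"
  have [measurable]: "d \<in> borel_measurable (borel \<Otimes>\<^sub>M borel)" unfolding d_def by measurable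
  have d0: "0 \<le> d p" for p by (simp add: d_def)
  interpret sl: pair_sigma_finite "seg pi" lborel ..
  let ?M = "seg pi \<Otimes>\<^sub>M lborel"
  let ?D = "density ?M (\<lambda>p. ennreal (d p))"
  have eq: "distr (seg N) borel ?a = distr ?D borel snd"
  proof (rule measure_eqI_lessThan)
    fix x
    \<comment> \<open>Neither measure charges values below -N, so a lower level x gives the same
      tail as -N.\<close>
    define z where "z = max x (- N)"
    have em: "emeasure (distr (seg N) borel ?a) {x<..} = ennreal (vk_tail z)"
    proof -
      have "emeasure (distr (seg N) borel ?a) {x<..} = emeasure (seg N) {u. x < ?a u}"
        by (subst emeasure_distr) (auto simp: vimage_def)
      also have "\<dots> = emeasure lborel ({0..N} \<inter> {u. x < ?a u})" by (rule emeasure_seg) measurable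
      also have "\<dots> = ennreal (vk_tail z - 0)"
      proof (rule emeasure_between)
        have zN: "vk_tail z \<le> N" using vk_tail_mono[of "-N" z] vk_tail_left[of "-N"] N by (simp add: z_def)
        have iff: "x < ?a u \<longleftrightarrow> u < vk_tail x" if "0 \<le> u" for u
          using vk_quantile(2)[OF that, of x] vk_shape_eq[OF that] by auto
        have x_le: "vk_tail z \<le> vk_tail x" by (rule vk_tail_mono) (simp add: z_def)
        show "{0<..<vk_tail z} \<subseteq> {0..N} \<inter> {u. x < ?a u}"
        proof
          fix u assume u: "u \<in> {0<..<vk_tail z}"
          then show "u \<in> {0..N} \<inter> {u. x < ?a u}" using zN x_le iff[of u] by auto
        qed
        show "{0..N} \<inter> {u. x < ?a u} \<subseteq> {0..vk_tail z}"
        proof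
          fix u assume u: "u \<in> {0..N} \<inter> {u. x < ?a u}"
          show "u \<in> {0..vk_tail z}"
          proof (cases "x \<le> - N")
            case True
            then have "vk_tail z = N" using vk_tail_left[of "-N"] N by (simp add: z_def max_def)
            then show ?thesis using u by auto
          next
            case False
            then show ?thesis using u iff[of u] by (auto simp: z_def max_def)
          qed
        qed
      qed (use vk_tail_nonneg in auto)
      finally show ?thesis by simp
    qed
    then show "emeasure (distr (seg N) borel ?a) {x<..} < \<infinity>" by simp
    have "{p \<in> space (borel \<Otimes>\<^sub>M borel). x < snd p} \<in> sets (borel \<Otimes>\<^sub>M (borel :: real measure))" for x :: real by measurable
    then have [measurable]: "{p. x < snd p} \<in> sets (borel \<Otimes>\<^sub>M borel)" by (simp add: space_pair_measure)
    have "emeasure (distr ?D borel snd) {x<..} = emeasure ?D {p. x < snd p}"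
      by (subst emeasure_distr) (auto simp: vimage_def space_pair_measure)
    also have "\<dots> = (\<integral>\<^sup>+p. ennreal (d p) * indicator {p. x < snd p} p \<partial>?M)"
      by (rule emeasure_density) auto
    also have "\<dots> = (\<integral>\<^sup>+\<theta>. (\<integral>\<^sup>+t. ennreal (d (\<theta>, t)) * indicator {p. x < snd p} (\<theta>, t) \<partial>lborel) \<partial>seg pi)"
      by (rule lborel.nn_integral_fst[symmetric]) measurable
    also have "\<dots> = (\<integral>\<^sup>+\<theta>. ennreal (max (2 * cos \<theta> - z) 0 / pi) \<partial>seg pi)"
    proof (rule nn_integral_cong)
      fix \<theta> :: real
      have "(\<integral>\<^sup>+t. ennreal (d (\<theta>, t)) * indicator {p. x < snd p} (\<theta>, t) \<partial>lborel) = (\<integral>\<^sup>+t. ennreal (1 / pi) * indicator {z<..<2 * cos \<theta>} t \<partial>lborel)"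
        by (rule nn_integral_cong) (auto simp: d_def z_def indicator_def max_def)
      also have "\<dots> = ennreal (1 / pi) * emeasure lborel {z<..<2 * cos \<theta>}" by (rule nn_integral_cmult_indicator) simp
      also have "emeasure lborel {z<..<2 * cos \<theta>} = ennreal (max (2 * cos \<theta> - z) 0)"
        by (cases "z \<le> 2 * cos \<theta>") (auto simp: max_def)
      also have "ennreal (1 / pi) * ennreal (max (2 * cos \<theta> - z) 0) = ennreal (max (2 * cos \<theta> - z) 0 / pi)"
        by (simp flip: ennreal_mult)
      finally show "(\<integral>\<^sup>+t. ennreal (d (\<theta>, t)) * indicator {p. x < snd p} (\<theta>, t) \<partial>lborel) = ennreal (max (2 * cos \<theta> - z) 0 / pi)" .
    qed
    also have "\<dots> = ennreal (vk_tail z)"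
      unfolding vk_tail_def using vk_tail_integrable[of z] by (subst nn_integral_eq_integral) auto
    finally show "emeasure (distr (seg N) borel ?a) {x<..} = emeasure (distr ?D borel snd) {x<..}" using em by simp
  qed simp_all
  have "integrable (distr (seg N) borel ?a) f" using i by (subst integrable_distr_eq) auto
  then have "integrable ?D (\<lambda>p. f (snd p))" unfolding eq by (subst (asm) integrable_distr_eq) auto
  then have di: "integrable ?M (\<lambda>p. d p * f (snd p))" using d0 by (subst (asm) integrable_density) auto
  have "(\<integral>u. f (?a u) \<partial>seg N) = (\<integral>t. f t \<partial>distr (seg N) borel ?a)" by (subst integral_distr) auto
  also have "\<dots> = (\<integral>p. f (snd p) \<partial>?D)" unfolding eq by (subst integral_distr) auto
  also have "\<dots> = (\<integral>p. d p * f (snd p) \<partial>?M)" using d0 by (subst integral_density) auto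
  also have "\<dots> = (\<integral>\<theta>. (\<integral>t. d (\<theta>, t) * f t \<partial>lborel) \<partial>seg pi)"
    using sl.integral_fst'[OF di] by simp
  also have "\<dots> = (\<integral>\<theta>. (\<integral>w. f (w - N) \<partial>seg (2 * cos \<theta> + N)) / pi \<partial>seg pi)"
  proof (rule Bochner_Integration.integral_cong[OF refl])
    fix \<theta> :: real
    have "(\<integral>t. d (\<theta>, t) * f t \<partial>lborel) = (\<integral>w. d (\<theta>, - N + w) * f (- N + w) \<partial>lborel)"
      using lborel_integral_real_affine[of 1 "\<lambda>t. d (\<theta>, t) * f t" "-N"] by simp
    also have "\<dots> = (\<integral>w. indicator {0..2 * cos \<theta> + N} w * f (w - N) / pi \<partial>lborel)"
    proof (rule integral_cong_AE)
      show "AE w in lborel. d (\<theta>, - N + w) * f (- N + w) = indicator {0..2 * cos \<theta> + N} w * f (w - N) / pi"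
        using AE_lborel_singleton[of 0] AE_lborel_singleton[of "2 * cos \<theta> + N"]
        by eventually_elim (auto simp: d_def indicator_def)
    qed measurable
    also have "\<dots> = (\<integral>w. f (w - N) \<partial>seg (2 * cos \<theta> + N)) / pi"
      by (simp add: integral_seg set_lebesgue_integral_def)
    finally show "(\<integral>t. d (\<theta>, t) * f t \<partial>lborel) = (\<integral>w. f (w - N) \<partial>seg (2 * cos \<theta> + N)) / pi" .
  qed
  finally show ?thesis by simp
qed

text \<open>Integrating t from -N to 2 cos \<open>\<theta>\<close> gives 2 cos^2
  \<open>\<theta>\<close> - N^2/2, and 2 cos^2 has mean 1 over [0,pi]. The N^2/2 is the integral of
  u.\<close>

lemma vk_mass: assumes N: "2 \<le> N" shows "(\<integral>u. vk_shape u \<partial>seg N) = 1"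
proof -
  note sh = shape_vk[OF N]
  note [measurable] = shape_measurable[OF sh]
  have i: "integrable (seg N) (\<lambda>u. vk_shape u - u)" using shape_integrable[OF sh] id_integrable_seg by auto
  have pos: "0 \<le> 2 * cos \<theta> + N" for \<theta> using cos_ge_minus_one[of \<theta>] N by linarith
  have "(\<integral>u. vk_shape u - u \<partial>seg N) = (\<integral>\<theta>. (\<integral>w. w - N \<partial>seg (2 * cos \<theta> + N)) \<partial>seg pi) / pi"
    by (rule vk_push_forward[OF N _ i]) measurable
  also have "(\<lambda>\<theta>. \<integral>w. w - N \<partial>seg (2 * cos \<theta> + N)) = (\<lambda>\<theta>. 2 * (cos \<theta>)\<^sup>2 - N\<^sup>2 / 2)"
  proof
    fix \<theta> :: real
    have "(\<integral>w. w - N \<partial>seg (2 * cos \<theta> + N)) = (2 * cos \<theta> + N)\<^sup>2 / 2 - N * (2 * cos \<theta> + N)"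
      using id_integrable_seg pos[of \<theta>] by (simp add: integral_seg_id measure_seg_UNIV)
    also have "\<dots> = 2 * (cos \<theta>)\<^sup>2 - N\<^sup>2 / 2" by (simp add: power2_eq_square field_simps)
    finally show "(\<integral>w. w - N \<partial>seg (2 * cos \<theta> + N)) = \<dots>" .
  qed
  also have "(\<integral>\<theta>. 2 * (cos \<theta>)\<^sup>2 - N\<^sup>2 / 2 \<partial>seg pi) / pi = 1 - N\<^sup>2 / 2"
    using cos2_integrable[of pi] by (simp add: integral_cos2_seg measure_seg_UNIV field_simps)
  finally have "(\<integral>u. vk_shape u - u \<partial>seg N) = 1 - N\<^sup>2 / 2" .
  moreover have "(\<integral>u. vk_shape u - u \<partial>seg N) = (\<integral>u. vk_shape u \<partial>seg N) - N\<^sup>2 / 2"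
    using shape_integrable[OF sh] id_integrable_seg N by (simp add: integral_seg_id)
  ultimately show ?thesis by simp
qed

text \<open>The potential P of the overview; by \<open>vk_potential_diff\<close> its increments are
  integrals of \<open>cos_log\<close> divided by pi.\<close>

definition vk_potential :: "real \<Rightarrow> real" where
  "vk_potential t = (\<integral>\<theta>. log_prim (t - 2 * cos \<theta>) \<partial>seg pi) / pi"

lemma log_prim_measurable [measurable]: "log_prim \<in> borel_measurable borel"
  unfolding log_prim_def[abs_def] by measurable

lemma log_prim_cos_integrable: "integrable (seg pi) (\<lambda>\<theta>. log_prim (t - 2 * cos \<theta>))"
proof -
  have "continuous_on {-\<bar>t\<bar>-2..\<bar>t\<bar>+2} log_prim" by (intro continuous_at_imp_continuous_on ballI log_prim_isCont)
  then have "bounded (log_prim ` {-\<bar>t\<bar>-2..\<bar>t\<bar>+2})" by (intro compact_imp_bounded compact_continuous_image) auto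
  then obtain C where C: "\<forall>s\<in>{-\<bar>t\<bar>-2..\<bar>t\<bar>+2}. \<bar>log_prim s\<bar> \<le> C" by (auto simp: bounded_iff)
  show ?thesis
  proof (rule integrable_seg_bounded[where C=C])
    fix \<theta> :: real
    have "- \<bar>t\<bar> - 2 \<le> t - 2 * cos \<theta>" "t - 2 * cos \<theta> \<le> \<bar>t\<bar> + 2"
      using cos_le_one[of \<theta>] cos_ge_minus_one[of \<theta>] by linarith+
    then have "t - 2 * cos \<theta> \<in> {-\<bar>t\<bar>-2..\<bar>t\<bar>+2}" by simp
    then show "\<bar>log_prim (t - 2 * cos \<theta>)\<bar> \<le> C" using C by blast
  qed measurable
qed

text \<open>On each slice (-N, 2 cos \<open>\<theta>\<close>) the logarithm integrates to
  \<open>log_prim (t + N) - log_prim (t - 2 * cos \<theta>)\<close>. The end at -N cancels the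
  single-integral term of the energy, which leaves a potential independent of N.\<close>

lemma vk_potential_eq:
  assumes N: "2 \<le> N" and t: "- N \<le> t"
  shows "log_prim (t + N) - (\<integral>u. ln \<bar>t - (vk_shape u - u)\<bar> \<partial>seg N) = vk_potential t"
proof -
  note sh = shape_vk[OF N]
  note [measurable] = shape_measurable[OF sh]
  have i: "integrable (seg N) (\<lambda>u. ln \<bar>t - (vk_shape u - u)\<bar>)"
    by (rule log_integrable[OF shape_steep[OF sh], where C="max \<bar>t\<bar> (vk_shape 0 + N)"])
      (use N shape_abs_le[OF sh] in \<open>auto simp: le_max_iff_disj\<close>)
  have pos: "0 \<le> 2 * cos \<theta> + N" for \<theta> using cos_ge_minus_one[of \<theta>] N by linarith
  have "(\<integral>u. ln \<bar>t - (vk_shape u - u)\<bar> \<partial>seg N) = (\<integral>\<theta>. (\<integral>w. ln \<bar>t - (w - N)\<bar> \<partial>seg (2 * cos \<theta> + N)) \<partial>seg pi) / pi"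
    by (rule vk_push_forward[OF N _ i]) measurable
  also have "(\<lambda>\<theta>. \<integral>w. ln \<bar>t - (w - N)\<bar> \<partial>seg (2 * cos \<theta> + N)) = (\<lambda>\<theta>. log_prim (t + N) - log_prim (t - 2 * cos \<theta>))"
  proof
    fix \<theta> :: real
    have "\<bar>t - (w - N)\<bar> = \<bar>- (t + N) + w\<bar>" for w by linarith
    then have "(\<integral>w. ln \<bar>t - (w - N)\<bar> \<partial>seg (2 * cos \<theta> + N)) = (\<integral>w. ln \<bar>- (t + N) + w\<bar> \<partial>seg (2 * cos \<theta> + N))"
      by simp
    also have "\<dots> = log_prim (- (t + N) + (2 * cos \<theta> + N)) - log_prim (- (t + N))" by (rule log_FTC[OF pos])
    also have "- (t + N) + (2 * cos \<theta> + N) = - (t - 2 * cos \<theta>)" by simp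
    finally show "(\<integral>w. ln \<bar>t - (w - N)\<bar> \<partial>seg (2 * cos \<theta> + N)) = log_prim (t + N) - log_prim (t - 2 * cos \<theta>)"
      unfolding log_prim_minus by simp
  qed
  also have "(\<integral>\<theta>. log_prim (t + N) - log_prim (t - 2 * cos \<theta>) \<partial>seg pi) / pi = log_prim (t + N) - vk_potential t"
    using log_prim_cos_integrable by (simp add: vk_potential_def measure_seg_UNIV diff_divide_distrib)
  finally show ?thesis by simp
qed

lemma vk_potential_diff:
  assumes h: "0 \<le> h"
  shows "vk_potential (t + h) - vk_potential t = (\<integral>w. cos_log (t + w) \<partial>seg h) / pi"
    and "integrable (seg h) (\<lambda>w. cos_log (t + w))"
proof -
  have i: "integrable (seg pi \<Otimes>\<^sub>M seg h) (\<lambda>(\<theta>, w). ln \<bar>t + w - 2 * cos \<theta>\<bar>)"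
  proof -
    have "integrable (seg pi \<Otimes>\<^sub>M seg h) (\<lambda>p. ln \<bar>(- 2 * cos (fst p)) - (- t - snd p)\<bar>)"
    proof (rule pair_log_integrable[where C="2 + \<bar>t\<bar> + h"])
      fix u :: real show "\<bar>- 2 * cos u\<bar> \<le> 2 + \<bar>t\<bar> + h" using cos_le_one[of u] cos_ge_minus_one[of u] h by linarith
    qed (use h in \<open>auto simp: steep_def\<close>)
    moreover have "\<bar>(- 2 * cos \<theta>) - (- t - w)\<bar> = \<bar>t + w - 2 * cos \<theta>\<bar>" for \<theta> w by linarith
    ultimately show ?thesis by (simp only: case_prod_beta')
  qed
  have "(\<integral>w. cos_log (t + w) \<partial>seg h) = (\<integral>\<theta>. (\<integral>w. ln \<bar>t + w - 2 * cos \<theta>\<bar> \<partial>seg h) \<partial>seg pi)"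
    unfolding cos_log_def by (rule segp.Fubini_integral[OF i])
  also have "\<dots> = (\<integral>\<theta>. log_prim (t + h - 2 * cos \<theta>) - log_prim (t - 2 * cos \<theta>) \<partial>seg pi)"
  proof (rule Bochner_Integration.integral_cong[OF refl])
    fix \<theta> :: real
    have "t + w - 2 * cos \<theta> = (t - 2 * cos \<theta>) + w" for w by simp
    then have "(\<integral>w. ln \<bar>t + w - 2 * cos \<theta>\<bar> \<partial>seg h) = (\<integral>w. ln \<bar>(t - 2 * cos \<theta>) + w\<bar> \<partial>seg h)" by (simp only:)
    also have "\<dots> = log_prim (t - 2 * cos \<theta> + h) - log_prim (t - 2 * cos \<theta>)" by (rule log_FTC[OF h])
    finally show "(\<integral>w. ln \<bar>t + w - 2 * cos \<theta>\<bar> \<partial>seg h) = log_prim (t + h - 2 * cos \<theta>) - log_prim (t - 2 * cos \<theta>)"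
      by (simp only: diff_add_eq)
  qed
  also have "\<dots> = pi * (vk_potential (t + h) - vk_potential t)"
    using log_prim_cos_integrable by (simp add: vk_potential_def right_diff_distrib)
  finally show "vk_potential (t + h) - vk_potential t = (\<integral>w. cos_log (t + w) \<partial>seg h) / pi" by simp
  show "integrable (seg h) (\<lambda>w. cos_log (t + w))"
    unfolding cos_log_def by (rule segp.integrable_snd[OF i])
qed

lemma vk_potential_mono: assumes "s \<le> t" shows "vk_potential s \<le> vk_potential t"
proof -
  have "0 \<le> (\<integral>w. cos_log (s + w) \<partial>seg (t - s)) / pi"
    by (intro divide_nonneg_nonneg Bochner_Integration.integral_nonneg cos_log_nonneg) auto
  then show ?thesis using vk_potential_diff(1)[of "t - s" s] assms by simp
qed

lemma vk_potential_bulk: assumes "\<bar>s\<bar> \<le> 2" "\<bar>t\<bar> \<le> 2" shows "vk_potential s = vk_potential t"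
proof -
  have *: "vk_potential s = vk_potential t" if "s \<le> t" "-2 \<le> s" "t \<le> 2" for s t
  proof -
    have "(\<integral>w. cos_log (s + w) \<partial>seg (t - s)) = (\<integral>w. 0 \<partial>seg (t - s))"
    proof (rule integral_cong_AE)
      show "AE w in seg (t - s). cos_log (s + w) = 0" by (rule AE_segI, rule cos_log_eq_0) (use that in auto)
    qed (use borel_measurable_integrable[OF vk_potential_diff(2)[of "t - s" s]] that in auto)
    then show ?thesis using vk_potential_diff(1)[of "t - s" s] that by simp
  qed
  show ?thesis
  proof (cases "s \<le> t")
    case True
    then show ?thesis by (rule *) (use assms in auto)
  next
    case False
    then show ?thesis by (intro *[symmetric]) (use assms in auto)
  qed
qed

text \<open>Left of -2 the bound of \<open>cos_log_ge\<close> is weakest at the right end t + h; its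
  value there is used on the whole interval.\<close>

lemma vk_potential_growth:
  assumes "0 \<le> h" "t + h < - 2" "1 \<le> \<bar>t + h\<bar> - 2"
  shows "h * ln (\<bar>t + h\<bar> - 2) \<le> vk_potential (t + h) - vk_potential t"
proof -
  have "(\<integral>w. pi * ln (\<bar>t + h\<bar> - 2) \<partial>seg h) \<le> (\<integral>w. cos_log (t + w) \<partial>seg h)"
  proof (rule integral_mono_AE)
    show "AE w in seg h. pi * ln (\<bar>t + h\<bar> - 2) \<le> cos_log (t + w)"
    proof (rule AE_segI)
      fix w assume w: "0 \<le> w" "w \<le> h"
      then have "ln (\<bar>t + h\<bar> - 2) \<le> ln (\<bar>t + w\<bar> - 2)" using assms by (subst ln_le_cancel_iff) auto
      then have "pi * ln (\<bar>t + h\<bar> - 2) \<le> pi * ln (\<bar>t + w\<bar> - 2)" by simp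
      also have "\<dots> \<le> cos_log (t + w)" using w assms by (intro cos_log_ge) auto
      finally show "pi * ln (\<bar>t + h\<bar> - 2) \<le> cos_log (t + w)" .
    qed
  qed (use vk_potential_diff(2)[OF assms(1)] in auto)
  then have "pi * (h * ln (\<bar>t + h\<bar> - 2)) \<le> pi * (vk_potential (t + h) - vk_potential t)"
    using vk_potential_diff(1)[OF assms(1), of t] assms(1) by (simp add: measure_seg_UNIV mult_ac)
  then show ?thesis by simp
qed

section \<open>Lower bounds for the energy\<close>

text \<open>By \<open>vk_potential_eq\<close> the mixed logarithmic energy with
  \<open>vk_shape\<close> is the \<open>log_prim\<close> integral minus the integral of the
  potential. Inserted into \<open>log_pair_positive\<close>, this removes the quadratic term of
  \<open>\<psi>\<close> and leaves the potential alone.\<close>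

lemma hook_energy_lower_vk:
  assumes s: "shape N \<psi>" and N: "2 \<le> N"
  shows "hook_energy N vk_shape + 2 * (\<integral>u. vk_potential (\<psi> u - u) - vk_potential (- u) \<partial>seg N) \<le> hook_energy N \<psi>"
    and "integrable (seg N) (\<lambda>u. vk_potential (\<psi> u - u) - vk_potential (- u))"
proof -
  note s0 = shape_vk[OF N]
  note [measurable] = shape_measurable[OF s] shape_measurable[OF s0]
  have N0: "0 \<le> N" using N by simp
  let ?a = "\<lambda>u. \<psi> u - u" and ?o = "\<lambda>u. vk_shape u - u"
  define C where "C = max (\<psi> 0 + N) (vk_shape 0 + N)"
  have bnd: "\<bar>\<phi> u - u\<bar> \<le> C" if "\<phi> = \<psi> \<or> \<phi> = vk_shape" "0 \<le> u" "u \<le> N" for \<phi> u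
    using that shape_abs_le[OF s that(2,3)] shape_abs_le[OF s0 that(2,3)] by (auto simp: C_def)
  have pm: "vk_potential \<in> borel_measurable borel"
    by (rule borel_measurable_mono) (simp add: mono_def vk_potential_mono)
  note [measurable] = pm
  have lge: "- N \<le> \<phi> u - u" if "\<phi> = \<psi> \<or> \<phi> = vk_shape" "u \<le> N" for \<phi> u
    using that shapeD(3)[OF s, of u] shapeD(3)[OF s0, of u] by auto
  have A: "hook_energy N \<phi> = 2 * (\<integral>u. log_prim (\<phi> u - u + N) \<partial>seg N) - log_pair N (\<lambda>u. \<phi> u - u) (\<lambda>u. \<phi> u - u)"
    and Ai: "integrable (seg N) (\<lambda>u. log_prim (\<phi> u - u + N))"
    if sh: "shape N \<phi>" and ph: "\<phi> = \<psi> \<or> \<phi> = vk_shape" for \<phi>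
  proof -
    note [measurable] = shape_measurable[OF sh]
    have ae: "AE u in seg N. (\<phi> u - u + N) * ln (\<phi> u - u + N) - (\<phi> u - u + N) = log_prim (\<phi> u - u + N)"
    proof (rule AE_segI)
      fix u assume "u \<le> N"
      then have "0 \<le> \<phi> u - u + N" using lge[OF ph] by force
      then show "(\<phi> u - u + N) * ln (\<phi> u - u + N) - (\<phi> u - u + N) = log_prim (\<phi> u - u + N)" by (simp add: log_prim_def)
    qed
    have i: "integrable (seg N) (\<lambda>u. (\<phi> u - u + N) * ln (\<phi> u - u + N) - (\<phi> u - u + N))"
      using shape_xlnx_integrable[OF sh] shape_integrable[OF sh] id_integrable_seg by auto
    show "integrable (seg N) (\<lambda>u. log_prim (\<phi> u - u + N))"
      by (rule Bochner_Integration.integrable_cong_AE_imp[OF i]) (use ae in \<open>auto elim: eventually_mono\<close>)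
    have "(\<integral>u. (\<phi> u - u + N) * ln (\<phi> u - u + N) - (\<phi> u - u + N) \<partial>seg N) = (\<integral>u. log_prim (\<phi> u - u + N) \<partial>seg N)"
      by (rule integral_cong_AE) (use ae in auto)
    then show "hook_energy N \<phi> = 2 * (\<integral>u. log_prim (\<phi> u - u + N) \<partial>seg N) - log_pair N (\<lambda>u. \<phi> u - u) (\<lambda>u. \<phi> u - u)"
      by (simp add: hook_energy_def)
  qed
  have P: "log_pair N (\<lambda>u. \<phi> u - u) ?o = (\<integral>u. log_prim (\<phi> u - u + N) \<partial>seg N) - (\<integral>u. vk_potential (\<phi> u - u) \<partial>seg N)"
    and Pi: "integrable (seg N) (\<lambda>u. vk_potential (\<phi> u - u))"
    if sh: "shape N \<phi>" and ph: "\<phi> = \<psi> \<or> \<phi> = vk_shape" for \<phi>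
  proof -
    note [measurable] = shape_measurable[OF sh]
    have L: "log_pair N (\<lambda>u. \<phi> u - u) ?o = (\<integral>u. (\<integral>v. ln \<bar>(\<phi> u - u) - ?o v\<bar> \<partial>seg N) \<partial>seg N)"
      by (rule log_pair_iter(1)[OF _ shape_steep[OF s0], where C=C]) (use bnd ph N0 in auto)
    have Li: "integrable (seg N) (\<lambda>u. \<integral>v. ln \<bar>(\<phi> u - u) - ?o v\<bar> \<partial>seg N)"
      by (rule log_pair_iter(2)[OF _ shape_steep[OF s0], where C=C]) (use bnd ph N0 in auto)
    have ae: "AE u in seg N. log_prim (\<phi> u - u + N) - (\<integral>v. ln \<bar>(\<phi> u - u) - ?o v\<bar> \<partial>seg N) = vk_potential (\<phi> u - u)"
      by (rule AE_segI, rule vk_potential_eq[OF N]) (use lge ph in auto)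
    show "integrable (seg N) (\<lambda>u. vk_potential (\<phi> u - u))"
      by (rule Bochner_Integration.integrable_cong_AE_imp[OF Bochner_Integration.integrable_diff[OF Ai[OF sh ph] Li]])
        (use ae in \<open>auto elim: eventually_mono\<close>)
    have "(\<integral>u. vk_potential (\<phi> u - u) \<partial>seg N) = (\<integral>u. log_prim (\<phi> u - u + N) - (\<integral>v. ln \<bar>(\<phi> u - u) - ?o v\<bar> \<partial>seg N) \<partial>seg N)"
      by (rule integral_cong_AE) (use ae in \<open>auto elim: eventually_mono\<close>)
    also have "\<dots> = (\<integral>u. log_prim (\<phi> u - u + N) \<partial>seg N) - log_pair N (\<lambda>u. \<phi> u - u) ?o"
      unfolding L by (rule Bochner_Integration.integral_diff[OF Ai[OF sh ph] Li])
    finally show "log_pair N (\<lambda>u. \<phi> u - u) ?o = (\<integral>u. log_prim (\<phi> u - u + N) \<partial>seg N) - (\<integral>u. vk_potential (\<phi> u - u) \<partial>seg N)" by simp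
  qed
  \<comment> \<open>For u <= 2 both arguments lie in [-2,2], where the potential is constant; for
    larger u the shape is 0 and the arguments agree.\<close>
  have o: "AE u in seg N. vk_potential (?o u) = vk_potential (- u)"
  proof (rule AE_segI)
    fix u assume u: "0 \<le> u" "u \<le> N"
    show "vk_potential (?o u) = vk_potential (- u)"
    proof (cases "u \<le> 2")
      case True
      have "- u \<le> ?o u" "?o u \<le> 2" using vk_quantile(3,4)[OF u(1)] vk_shape_eq[OF u(1)] by auto
      then show ?thesis using True u by (intro vk_potential_bulk) auto
    next
      case False
      then have "vk_shape u = 0" using shapeD(4)[OF shape_vk[of 2], of u] by simp
      then show ?thesis by simp
    qed
  qed
  have oi: "integrable (seg N) (\<lambda>u. vk_potential (- u))"
    by (rule Bochner_Integration.integrable_cong_AE_imp[OF Pi[OF s0]]) (use o in \<open>auto elim: eventually_mono\<close>)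
  have oe: "(\<integral>u. vk_potential (?o u) \<partial>seg N) = (\<integral>u. vk_potential (- u) \<partial>seg N)"
    by (rule integral_cong_AE) (use o in auto)
  show "integrable (seg N) (\<lambda>u. vk_potential (\<psi> u - u) - vk_potential (- u))"
    using Pi[OF s] oi by auto
  have pos: "log_pair N ?a ?a + log_pair N ?o ?o \<le> 2 * log_pair N ?a ?o"
    by (rule log_pair_positive[OF shape_steep[OF s] shape_steep[OF s0], where C=C]) (use bnd N0 in auto)
  have "(\<integral>u. vk_potential (\<psi> u - u) - vk_potential (- u) \<partial>seg N) = (\<integral>u. vk_potential (\<psi> u - u) \<partial>seg N) - (\<integral>u. vk_potential (- u) \<partial>seg N)"
    using Pi[OF s] oi by simp
  then show "hook_energy N vk_shape + 2 * (\<integral>u. vk_potential (\<psi> u - u) - vk_potential (- u) \<partial>seg N) \<le> hook_energy N \<psi>"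
    using pos A[OF s] A[OF s0] P[OF s] P[OF s0] oe by simp
qed

section \<open>Mass and energy as functionals of compactly supported shapes\<close>

definition is_shape :: "(real \<Rightarrow> real) \<Rightarrow> bool" where
  "is_shape \<psi> \<longleftrightarrow> (\<exists>N. shape N \<psi>)"

definition mass :: "(real \<Rightarrow> real) \<Rightarrow> real" where
  "mass \<psi> = (LBINT x:{0..}. \<psi> x)"

text \<open>Free of the support bound N, so different shapes can be compared. For shapes the hook
  integral is finite and \<open>real_of_ereal\<close> loses nothing.\<close>

definition energy :: "(real \<Rightarrow> real) \<Rightarrow> real" where
  "energy \<psi> = 2 * real_of_ereal (I_hook \<psi>)"

lemma is_shapeI: "shape N \<psi> \<Longrightarrow> is_shape \<psi>"
  by (auto simp: is_shape_def)

lemma energy_eq: "shape N \<psi> \<Longrightarrow> energy \<psi> = hook_energy N \<psi>"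
  by (simp add: energy_def I_hook_eq)

lemma I_hook_energy: "is_shape \<psi> \<Longrightarrow> I_hook \<psi> = ereal (energy \<psi> / 2)"
  by (auto simp: is_shape_def I_hook_eq energy_eq)

lemma mass_eq:
  assumes s: "shape N \<psi>"
  shows "mass \<psi> = (\<integral>u. \<psi> u \<partial>seg N)" "set_integrable lborel {0..} \<psi>"
proof -
  have eq: "(\<lambda>x. indicator {0..} x *\<^sub>R \<psi> x) = (\<lambda>x. indicator {0..N} x *\<^sub>R \<psi> x)"
    using shapeD(4)[OF s] by (auto simp: indicator_def fun_eq_iff)
  show "mass \<psi> = (\<integral>u. \<psi> u \<partial>seg N)"
    unfolding mass_def set_lebesgue_integral_def eq
    using shape_measurable[OF s] by (simp add: integral_seg set_lebesgue_integral_def)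
  show "set_integrable lborel {0..} \<psi>"
    using shape_integrable[OF s, of N] shape_measurable[OF s] unfolding set_integrable_def eq
    by (simp add: integrable_seg set_integrable_def)
qed

lemma shape_common:
  assumes "is_shape \<psi>" "is_shape \<phi>"
  obtains N where "K \<le> N" "shape N \<psi>" "shape N \<phi>"
proof -
  obtain N1 N2 where "shape N1 \<psi>" "shape N2 \<phi>" using assms by (auto simp: is_shape_def)
  then have "shape (max K (max N1 N2)) \<psi>" "shape (max K (max N1 N2)) \<phi>" by (auto intro: shape_mono)
  then show ?thesis by (intro that[of "max K (max N1 N2)"]) auto
qed

lemma is_shape_antimono: "is_shape \<psi> \<Longrightarrow> antimono \<psi>" and is_shape_nonneg: "is_shape \<psi> \<Longrightarrow> 0 \<le> \<psi> x"
  by (auto simp: is_shape_def shape_def)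

lemma is_shape_dilate: "is_shape \<psi> \<Longrightarrow> 0 < c \<Longrightarrow> is_shape (dilate c \<psi>)"
  by (auto simp: is_shape_def intro: shape_dilate)

lemma dilate_mass: "is_shape \<psi> \<Longrightarrow> 0 < c \<Longrightarrow> mass (dilate c \<psi>) = c\<^sup>2 * mass \<psi>"
  by (auto simp: is_shape_def mass_eq(1) mass_eq(1)[OF shape_dilate] mass_dilate)

lemma dilate_energy: "is_shape \<psi> \<Longrightarrow> 0 < c \<Longrightarrow> energy (dilate c \<psi>) = c\<^sup>2 * energy \<psi> + 2 * c\<^sup>2 * ln c * mass \<psi>"
  by (auto simp: is_shape_def mass_eq(1) energy_eq energy_eq[OF shape_dilate] hook_energy_dilate)

lemma is_shape_convex: "is_shape \<psi> \<Longrightarrow> is_shape \<phi> \<Longrightarrow> 0 < t \<Longrightarrow> t < 1 \<Longrightarrow> is_shape (\<lambda>x. (1 - t) * \<psi> x + t * \<phi> x)"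
  by (metis shape_common is_shapeI shape_convex)

lemma energy_convex:
  assumes "is_shape \<psi>" "is_shape \<phi>" and t: "0 < t" "t < 1"
  shows "energy (\<lambda>x. (1 - t) * \<psi> x + t * \<phi> x) \<le> (1 - t) * energy \<psi> + t * energy \<phi>"
proof -
  obtain N where N: "shape N \<psi>" "shape N \<phi>" using shape_common[OF assms(1,2)] by blast
  show ?thesis
    using hook_energy_convex[OF N t] unfolding energy_eq[OF N(1)] energy_eq[OF N(2)] energy_eq[OF shape_convex[OF N t]] .
qed

lemma mass_convex:
  assumes "is_shape \<psi>" "is_shape \<phi>" and t: "0 < t" "t < 1"
  shows "mass (\<lambda>x. (1 - t) * \<psi> x + t * \<phi> x) = (1 - t) * mass \<psi> + t * mass \<phi>"
proof -
  obtain N where N: "shape N \<psi>" "shape N \<phi>" using shape_common[OF assms(1,2)] by blast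
  show ?thesis
    unfolding mass_eq(1)[OF N(1)] mass_eq(1)[OF N(2)] mass_eq(1)[OF shape_convex[OF N t]]
    using shape_integrable[OF N(1)] shape_integrable[OF N(2)] by simp
qed

lemma is_shape_vk: "is_shape vk_shape"
  using shape_vk[of 2] by (auto intro: is_shapeI)

text \<open>The potential is increasing and \<open>\<psi> u - u\<close> lies above
  \<open>- u\<close>, so the correction term in the comparison is nonnegative.\<close>

lemma energy_ge_vk: assumes "is_shape \<psi>" shows "energy vk_shape \<le> energy \<psi>"
proof -
  obtain N where N: "2 \<le> N" "shape N \<psi>" using shape_common[OF assms assms] by blast
  have "0 \<le> (\<integral>u. vk_potential (\<psi> u - u) - vk_potential (- u) \<partial>seg N)"
    by (intro Bochner_Integration.integral_nonneg) (simp add: vk_potential_mono shapeD[OF N(2)])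
  then show ?thesis using hook_energy_lower_vk(1)[OF N(2,1)] by (simp add: energy_eq[OF N(2)] energy_eq[OF shape_vk[OF N(1)]])
qed

lemma mass_vk: "mass vk_shape = 1"
  using mass_eq(1)[OF shape_vk[of 2]] vk_mass[of 2] by simp

text \<open>
  Among its own dilations \<open>vk_shape\<close> minimises the energy, which pins down the energy through the scaling law.
\<close>

lemma energy_vk: "energy vk_shape = - 1"
proof -
  let ?e = "energy vk_shape"
  let ?h = "\<lambda>t. t * ?e + t * ln t - ?e"
  have ge: "0 \<le> ?h t" if t: "0 < t" for t
  proof -
    have "?e \<le> energy (dilate (sqrt t) vk_shape)" using t by (intro energy_ge_vk is_shape_dilate is_shape_vk) auto
    also have "\<dots> = t * ?e + 2 * t * ln (sqrt t)" using t by (subst dilate_energy) (auto simp: is_shape_vk mass_vk)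
    also have "2 * t * ln (sqrt t) = t * ln t" using t by (simp add: ln_sqrt)
    finally show ?thesis by simp
  qed
  \<comment> \<open>Here t is the mass of the dilated shape. The function is nonnegative and
    vanishes at t = 1, so its derivative there, which is the energy plus 1, is 0.\<close>
  have "(?h has_real_derivative ?e + (ln 1 + 1)) (at 1)" by (auto intro!: derivative_eq_intros)
  then have "?e + (ln 1 + 1) = 0"
  proof (rule DERIV_local_min[where d=1])
    show "\<forall>y. \<bar>1 - y\<bar> < 1 \<longrightarrow> ?h 1 \<le> ?h y" using ge by (auto simp: abs_less_iff)
  qed simp
  then show ?thesis by simp
qed

text \<open>Minimality of \<open>vk_shape\<close>, applied to \<open>\<psi>\<close> shrunk by s. The
  parameter stays free; the best choice would be s^2 = mass.\<close>

lemma energy_lower: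
  assumes \<psi>: "is_shape \<psi>" and s: "0 < s"
  shows "- s\<^sup>2 + 2 * ln s * mass \<psi> \<le> energy \<psi>"
proof -
  define \<phi> where "\<phi> = dilate (1 / s) \<psi>"
  have \<phi>: "is_shape \<phi>" using \<psi> s by (simp add: \<phi>_def is_shape_dilate)
  have d: "\<psi> = dilate s \<phi>" using s by (simp add: \<phi>_def dilate_dilate)
  have "energy \<psi> = s\<^sup>2 * energy \<phi> + 2 * ln s * mass \<psi>"
    unfolding d by (simp add: dilate_energy[OF \<phi> s] dilate_mass[OF \<phi> s])
  moreover have "s\<^sup>2 * (- 1) \<le> s\<^sup>2 * energy \<phi>" using energy_ge_vk[OF \<phi>] energy_vk by (intro mult_left_mono) auto
  ultimately show ?thesis by simp
qed

section \<open>The cost of mass far from the origin, and the parabola on the left\<close>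

lemma integral_seg_mono_set:
  fixes f :: "real \<Rightarrow> real"
  assumes [measurable]: "f \<in> borel_measurable borel" and "\<And>u. 0 \<le> f u" "X \<le> Y" "integrable (seg Y) f"
  shows "(\<integral>u. f u \<partial>seg X) = (\<integral>u. indicator {0..X} u * f u \<partial>seg Y)" "integrable (seg Y) (\<lambda>u. indicator {0..X} u * f u)"
    "(\<integral>u. f u \<partial>seg X) \<le> (\<integral>u. f u \<partial>seg Y)"
proof -
  show 1: "(\<integral>u. f u \<partial>seg X) = (\<integral>u. indicator {0..X} u * f u \<partial>seg Y)"
    using assms(3) by (subst (1 2) integral_seg) (auto simp: set_lebesgue_integral_def indicator_def intro!: Bochner_Integration.integral_cong)
  show 2: "integrable (seg Y) (\<lambda>u. indicator {0..X} u * f u)"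
    by (rule Bochner_Integration.integrable_bound[OF assms(4)]) (auto simp: indicator_def)
  show "(\<integral>u. f u \<partial>seg X) \<le> (\<integral>u. f u \<partial>seg Y)"
    unfolding 1 by (rule integral_mono[OF 2 assms(4)]) (use assms(2) in \<open>auto simp: indicator_def\<close>)
qed

text \<open>Beyond X heights are at most 1, because X times such a height is at most the mass, hence
  at most X. So \<open>\<psi> u - u\<close> stays left of -2 - b, which explains 3 + b, and there
  the potential rises by at least \<open>ln b\<close> per unit of height. On [0,X] its monotonicity
  is enough.\<close>

lemma energy_far:
  assumes \<psi>: "is_shape \<psi>" and b: "1 \<le> b" and X: "3 + b \<le> X" "mass \<psi> \<le> X"
  shows "- 1 + 2 * ln b * (mass \<psi> - (\<integral>u. \<psi> u \<partial>seg X)) \<le> energy \<psi>"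
proof -
  obtain N where N: "X \<le> N" "shape N \<psi>" using shape_common[OF \<psi> \<psi>] by blast
  note [measurable] = shape_measurable[OF N(2)]
  have N2: "2 \<le> N" using N(1) X b by simp
  have \<psi>i: "integrable (seg Y) \<psi>" for Y by (rule shape_integrable[OF N(2)])
  note sub = integral_seg_mono_set[OF _ shapeD(3)[OF N(2)] N(1) \<psi>i]
  have m: "mass \<psi> = (\<integral>u. \<psi> u \<partial>seg N)" by (rule mass_eq(1)[OF N(2)])
  have "ln b * (mass \<psi> - (\<integral>u. \<psi> u \<partial>seg X)) = (\<integral>u. ln b * (\<psi> u - indicator {0..X} u * \<psi> u) \<partial>seg N)"
    using \<psi>i sub(2) by (simp add: m sub(1))
  also have "\<dots> \<le> (\<integral>u. vk_potential (\<psi> u - u) - vk_potential (- u) \<partial>seg N)"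
  proof (rule integral_mono_AE)
    show "AE u in seg N. ln b * (\<psi> u - indicator {0..X} u * \<psi> u) \<le> vk_potential (\<psi> u - u) - vk_potential (- u)"
    proof (rule AE_segI)
      fix u assume u: "0 \<le> u" "u \<le> N"
      show "ln b * (\<psi> u - indicator {0..X} u * \<psi> u) \<le> vk_potential (\<psi> u - u) - vk_potential (- u)"
      proof (cases "u \<le> X")
        case True
        then show ?thesis using u by (simp add: vk_potential_mono shapeD[OF N(2)])
      next
        case False
        have "X * \<psi> u = (\<integral>v. \<psi> u \<partial>seg X)" using X b by (simp add: measure_seg_UNIV)
        also have "\<dots> \<le> (\<integral>v. \<psi> v \<partial>seg X)"
          by (intro integral_mono_AE AE_segI \<psi>i) (use False shapeD(5)[OF N(2)] in auto)
        also have "\<dots> \<le> X" using sub(3) m X(2) by simp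
        finally have "\<psi> u \<le> 1" using X b by simp
        then have g: "b \<le> \<bar>- u + \<psi> u\<bar> - 2" "- u + \<psi> u < - 2" using False X b by auto
        have "\<psi> u * ln b \<le> \<psi> u * ln (\<bar>- u + \<psi> u\<bar> - 2)"
          using g b shapeD(3)[OF N(2)] by (intro mult_left_mono) (auto simp: ln_le_cancel_iff)
        also have "\<dots> \<le> vk_potential (- u + \<psi> u) - vk_potential (- u)"
          by (rule vk_potential_growth) (use g b shapeD(3)[OF N(2)] in auto)
        finally show ?thesis using False by (simp add: mult.commute)
      qed
    qed
  qed (use \<psi>i sub(2) hook_energy_lower_vk(2)[OF N(2) N2] in auto)
  finally show ?thesis
    using hook_energy_lower_vk(1)[OF N(2) N2] energy_vk by (simp add: energy_eq[OF N(2)] energy_eq[OF shape_vk[OF N2]])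
qed

text \<open>\<open>W_func\<close> after merging \<open>\<kappa>\<close> and \<open>\<phi>\<close> into a shape of mass \<open>\<kappa>\<close>; the term \<open>\<kappa> log \<kappa>\<close> is absorbed by the scaling of the energy.\<close>

definition W_shape :: "real \<Rightarrow> (real \<Rightarrow> real) \<Rightarrow> real \<Rightarrow> real" where
  "W_shape q \<psi> x = 1 + energy \<psi> + ln (1 / q) * area_above \<psi> x"

text \<open>After division by sqrt q this is the requirement of \<open>energy_far\<close>: 3 + b
  with b = 1 / sqrt q, for which \<open>2 * ln b\<close> is log(1/q), plus e/q, which bounds the
  rescaled mass when the mass is below e.\<close>

definition x_crit :: "real \<Rightarrow> real" where
  "x_crit q = sqrt q * (3 + 1 / sqrt q + exp 1 / q)"

lemma W_shape_lower:
  assumes q: "0 < q" "q < 1" and \<psi>: "is_shape \<psi>" and x: "x_crit q \<le> x"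
  shows "1 - q + ln (1 / q) * (x\<^sup>2 / 2) \<le> W_shape q \<psi> (- x)"
proof -
  define \<eta> where "\<eta> = ln (1 / q)"
  define r where "r = sqrt q"
  have \<eta>: "0 < \<eta>" using q by (simp add: \<eta>_def)
  have r: "0 < r" "r\<^sup>2 = q" "r < 1" using q by (auto simp: r_def)
  have lr: "2 * ln r = - \<eta>" using q by (simp add: r_def \<eta>_def ln_sqrt ln_div)
  have x0: "0 \<le> x" using x q by (intro order_trans[OF _ x]) (auto simp: x_crit_def)
  have xr: "3 + 1 / r + exp 1 / q \<le> x / r" using x r by (simp add: x_crit_def r_def[symmetric] pos_le_divide_eq mult.commute)
  obtain N where N: "shape N \<psi>" using \<psi> by (auto simp: is_shape_def)
  note [measurable] = shape_measurable[OF N]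
  let ?I = "\<integral>u. \<psi> u \<partial>seg x"
  have I0: "0 \<le> ?I" using shapeD(3)[OF N] by (intro Bochner_Integration.integral_nonneg) auto
  have "- q \<le> energy \<psi> + \<eta> * ?I"
  proof (cases "exp 1 \<le> mass \<psi>")
    case True
    \<comment> \<open>With s^2 = e in \<open>energy_lower\<close> the energy is at least mass - e.
      Large masses are thus settled, and the argument for far mass has to deal with bounded mass
      only.\<close>
    have "(exp (1 / 2))\<^sup>2 = (exp 1 :: real)" by (simp add: exp_double[symmetric] power2_eq_square exp_add[symmetric])
    then have "0 \<le> energy \<psi>" using energy_lower[OF \<psi>, of "exp (1/2)"] True by simp
    moreover have "0 \<le> \<eta> * ?I" using \<eta> I0 by simp
    ultimately show ?thesis using q by linarith
  next
    case False
    \<comment> \<open>Rescaling by sqrt q turns the energy of \<open>\<psi>\<close> into q times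
      that of \<open>\<phi>\<close> minus \<open>\<eta>\<close> times the mass of
      \<open>\<psi>\<close>. The mass beyond x is paid for by \<open>energy_far\<close>, the mass
      inside [0,x] by the area term.\<close>
    define \<phi> where "\<phi> = dilate (1 / r) \<psi>"
    have \<phi>: "is_shape \<phi>" using \<psi> r by (simp add: \<phi>_def is_shape_dilate)
    have d: "\<psi> = dilate r \<phi>" using r by (simp add: \<phi>_def dilate_dilate)
    obtain N' where N': "shape N' \<phi>" using \<phi> by (auto simp: is_shape_def)
    note [measurable] = shape_measurable[OF N']
    have md: "mass \<psi> = q * mass \<phi>" using dilate_mass[OF \<phi> r(1)] by (simp add: d[symmetric] r)
    have e: "energy \<psi> = q * energy \<phi> - \<eta> * mass \<psi>"
    proof -
      have "energy \<psi> = r\<^sup>2 * energy \<phi> + 2 * r\<^sup>2 * ln r * mass \<phi>" by (subst d) (rule dilate_energy[OF \<phi> r(1)])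
      also have "2 * r\<^sup>2 * ln r * mass \<phi> = (2 * ln r) * (q * mass \<phi>)" by (simp add: r)
      finally show ?thesis by (simp add: lr md r)
    qed
    have mx: "mass \<phi> \<le> x / r"
    proof -
      have "mass \<phi> \<le> exp 1 / q" using False md q by (simp add: pos_le_divide_eq mult.commute)
      moreover have "0 \<le> 1 / r" using r by simp
      ultimately show ?thesis using xr by linarith
    qed
    have "0 \<le> exp 1 / q" using q by simp
    with xr have b: "3 + 1 / r \<le> x / r" by linarith
    have b1: "1 \<le> 1 / r" using r by simp
    have I: "?I = q * (\<integral>u. \<phi> u \<partial>seg (x / r))"
    proof -
      have "?I = (\<integral>u. dilate r \<phi> u \<partial>seg (r * (x / r)))" using r by (simp add: d[symmetric])
      also have "\<dots> = r * (\<integral>u. dilate r \<phi> (r * u) \<partial>seg (x / r))"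
        by (rule integral_seg_scale) (use r shape_measurable[OF shape_dilate[OF N' r(1)]] in auto)
      also have "\<dots> = r * (\<integral>u. r * \<phi> u \<partial>seg (x / r))" using r by (simp add: dilate_def)
      also have "\<dots> = q * (\<integral>u. \<phi> u \<partial>seg (x / r))" using r by (simp add: power2_eq_square)
      finally show ?thesis .
    qed
    have "- 1 + \<eta> * (mass \<phi> - (\<integral>u. \<phi> u \<partial>seg (x / r))) \<le> energy \<phi>"
    proof -
      have "2 * ln (1 / r) = \<eta>" using lr r by (simp add: ln_div)
      then show ?thesis using energy_far[OF \<phi> b1 b mx] by simp
    qed
    then have "q * (- 1 + \<eta> * (mass \<phi> - (\<integral>u. \<phi> u \<partial>seg (x / r)))) \<le> q * energy \<phi>" using q by (intro mult_left_mono) auto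
    then show ?thesis unfolding e I md by (simp add: algebra_simps)
  qed
  moreover have "\<eta> * (?I + x\<^sup>2 / 2) \<le> \<eta> * area_above \<psi> (- x)"
    using area_above_lower(1)[OF is_shape_antimono[OF \<psi>] is_shape_nonneg[OF \<psi>] x0] \<eta> by (intro mult_left_mono) auto
  ultimately show ?thesis unfolding W_shape_def \<eta>_def[symmetric] by (simp add: distrib_left)
qed

text \<open>The dilated shape has mass q, and the q log(1/q) in its area cancels the one in its
  energy. Its support [0, 2 sqrt q] lies inside [0,x], which is the equality case of
  \<open>area_above_lower\<close>.\<close>

lemma W_shape_attained:
  assumes q: "0 < q" "q < 1" and x: "x_crit q \<le> x"
  shows "W_shape q (dilate (sqrt q) vk_shape) (- x) = 1 - q + ln (1 / q) * (x\<^sup>2 / 2)"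
proof -
  define \<eta> where "\<eta> = ln (1 / q)"
  define r where "r = sqrt q"
  have r: "0 < r" "r\<^sup>2 = q" using q by (auto simp: r_def)
  have lr: "2 * ln r = - \<eta>" using q by (simp add: r_def \<eta>_def ln_sqrt ln_div)
  have x2: "2 * r \<le> x"
  proof -
    have "r * 2 \<le> r * (3 + 1 / sqrt q + exp 1 / q)" using r q by (intro mult_left_mono) (auto simp: add_increasing2)
    then show ?thesis using x by (simp add: x_crit_def r_def)
  qed
  let ?\<psi> = "dilate r vk_shape"
  have sh: "shape x ?\<psi>" using shape_mono[OF shape_dilate[OF shape_vk[of 2] r(1)], of x] x2 by (simp add: mult.commute)
  have "energy ?\<psi> = r\<^sup>2 * energy vk_shape + 2 * r\<^sup>2 * ln r * mass vk_shape" by (rule dilate_energy[OF is_shape_vk r(1)])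
  also have "\<dots> = - q + q * (2 * ln r)" by (simp add: r energy_vk mass_vk)
  finally have e: "energy ?\<psi> = - q - q * \<eta>" by (simp add: lr)
  have "area_above ?\<psi> (- x) = (\<integral>u. ?\<psi> u \<partial>seg x) + x\<^sup>2 / 2"
    using shapeD[OF sh] by (intro area_above_lower(2)) auto
  also have "(\<integral>u. ?\<psi> u \<partial>seg x) = q" using mass_eq(1)[OF sh] dilate_mass[OF is_shape_vk r(1)] r mass_vk by simp
  finally show ?thesis unfolding W_shape_def e r_def[symmetric] \<eta>_def[symmetric] by (simp add: algebra_simps)
qed

section \<open>Reduction to compactly supported shapes\<close>

text \<open>Members of \<open>Y1\<close> are constrained on [0,\<infinity>) only; overwriting the
  left half line makes them decreasing everywhere without changing the functionals.\<close>

definition clamp0 :: "(real \<Rightarrow> real) \<Rightarrow> real \<Rightarrow> real" where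
  "clamp0 \<phi> x = \<phi> (max x 0)"

lemma gen_inv_cong: "(\<And>x. 0 \<le> x \<Longrightarrow> \<phi> x = \<psi> x) \<Longrightarrow> gen_inv \<phi> y = gen_inv \<psi> y"
  unfolding gen_inv_def by (rule arg_cong[where f=Inf]) auto

lemma I_hook_cong:
  assumes "\<And>x. 0 \<le> x \<Longrightarrow> \<phi> x = \<psi> x" shows "I_hook \<phi> = I_hook \<psi>"
proof -
  have h: "hook \<phi> x y = hook \<psi> x y" if "0 \<le> x" for x y
    using that assms gen_inv_cong[of \<phi> \<psi> y] by (simp add: hook_def)
  have "hook_int F \<phi> = hook_int F \<psi>" for F
    unfolding hook_int_def
    by (rule nn_integral_cong) (use assms h in \<open>auto simp: indicator_def\<close>)
  then show ?thesis by (simp add: I_hook_alt)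
qed

lemma area_above_cong: "(\<And>x. 0 \<le> x \<Longrightarrow> \<phi> x = \<psi> x) \<Longrightarrow> area_above \<phi> x = area_above \<psi> x"
  unfolding area_above_def by (rule set_lebesgue_integral_cong) auto

lemma V_func_area: "V_func q x \<phi> = ln (1 / q) * area_above \<phi> x"
  by (simp add: V_func_def area_above_def)

text \<open>The merging of the two parameters read backwards: \<open>\<kappa>\<close> is the mass
  and \<open>\<phi>\<close> the shape shrunk to mass 1. The term
  \<open>\<kappa> * ln \<kappa>\<close> is exactly what the energy gains by scaling.\<close>

lemma F_func_le_W_shape:
  assumes \<psi>: "is_shape \<psi>" and m: "0 < mass \<psi>"
  shows "F_func q x \<le> ereal (W_shape q \<psi> x)"
proof -
  define \<kappa> where "\<kappa> = mass \<psi>"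
  define c where "c = sqrt \<kappa>"
  have \<kappa>: "0 < \<kappa>" using m by (simp add: \<kappa>_def)
  have c: "0 < c" "c\<^sup>2 = \<kappa>" using \<kappa> by (auto simp: c_def)
  define \<phi> where "\<phi> = dilate (1 / c) \<psi>"
  have \<phi>: "is_shape \<phi>" using \<psi> c by (simp add: \<phi>_def is_shape_dilate)
  have d: "dilate c \<phi> = \<psi>" using c by (simp add: \<phi>_def dilate_dilate)
  have m1: "mass \<phi> = 1" using dilate_mass[OF \<phi> c(1)] \<kappa> c by (simp add: d \<kappa>_def)
  have Y: "\<phi> \<in> Y1"
  proof -
    obtain N where N: "shape N \<phi>" using \<phi> by (auto simp: is_shape_def)
    have "antimono_on {0..} \<phi>" using shapeD(5)[OF N] by (auto simp: monotone_on_def)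
    then show ?thesis using shapeD(3)[OF N] mass_eq(2)[OF N] m1 by (simp add: Y1_def mass_def)
  qed
  have e: "energy \<psi> = \<kappa> * energy \<phi> + \<kappa> * ln \<kappa>"
  proof -
    have "energy \<psi> = c\<^sup>2 * energy \<phi> + c\<^sup>2 * (2 * ln c) * mass \<phi>"
      using dilate_energy[OF \<phi> c(1)] by (simp add: d mult_ac)
    moreover have "2 * ln c = ln \<kappa>" using \<kappa> by (simp add: c_def ln_sqrt)
    ultimately show ?thesis by (simp add: c(2) m1)
  qed
  have a: "area_above \<psi> x = \<kappa> * area_above \<phi> (x / sqrt \<kappa>)"
    using area_above_dilate[OF is_shape_antimono[OF \<phi>] c(1), of "x / c"] c by (simp add: d flip: c_def)
  have "W_func q \<kappa> \<phi> x = ereal (W_shape q \<psi> x)"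
    unfolding W_func_def I_hook_energy[OF \<phi>] W_shape_def V_func_area e a by (simp add: algebra_simps)
  moreover have "F_func q x \<le> W_func q \<kappa> \<phi> x"
    unfolding F_func_def using \<kappa> Y by (intro INF_lower2[of \<kappa>] INF_lower2[of \<phi>]) auto
  ultimately show ?thesis by simp
qed

definition cutoff :: "real \<Rightarrow> (real \<Rightarrow> real) \<Rightarrow> real \<Rightarrow> real" where
  "cutoff N \<phi> x = (if x < N then \<phi> x else 0)"

lemma shape_cutoff:
  assumes "antimono \<phi>" "\<And>x. 0 \<le> \<phi> x" "0 < N" shows "shape N (cutoff N \<phi>)"
  using assms by (auto simp: shape_def cutoff_def antimono_def)

lemma cutoff_le: "(\<And>x. 0 \<le> \<phi> x) \<Longrightarrow> cutoff N \<phi> x \<le> \<phi> x"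
  by (simp add: cutoff_def)

text \<open>Cutting off lowers the generalised inverse and leaves \<open>\<phi> x\<close> unchanged
  for x < N, so the surviving hooks can only shrink.\<close>

lemma hook_cutoff_le:
  assumes a: "antimono \<phi>" and nn: "\<And>x. 0 \<le> \<phi> x" and N: "0 < N"
    and ne: "\<exists>z\<ge>0. \<phi> z \<le> y" and x: "0 \<le> x" "x < N" and y: "0 < y" "y < \<phi> x"
  shows "0 < hook (cutoff N \<phi>) x y" "hook (cutoff N \<phi>) x y \<le> hook \<phi> x y"
proof -
  note s = shape_cutoff[OF a nn N]
  have "x \<le> gen_inv (cutoff N \<phi>) y" using x y by (intro shape_inv(4)[OF s]) (auto simp: cutoff_def)
  then show "0 < hook (cutoff N \<phi>) x y" using x y by (simp add: hook_def cutoff_def)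
  have "gen_inv (cutoff N \<phi>) y \<le> gen_inv \<phi> y" unfolding gen_inv_def
  proof (rule cInf_superset_mono)
    show "{x. 0 \<le> x \<and> \<phi> x \<le> y} \<noteq> {}" using ne by auto
    show "bdd_below {x. 0 \<le> x \<and> cutoff N \<phi> x \<le> y}" by (auto intro: bdd_belowI[of _ 0])
    show "{x. 0 \<le> x \<and> \<phi> x \<le> y} \<subseteq> {x. 0 \<le> x \<and> cutoff N \<phi> x \<le> y}"
      using order_trans[OF cutoff_le[of \<phi> N, OF nn]] by auto
  qed
  then show "hook (cutoff N \<phi>) x y \<le> hook \<phi> x y" using x by (simp add: hook_def cutoff_def)
qed

definition hook_row :: "(real \<Rightarrow> real) \<Rightarrow> (real \<Rightarrow> real) \<Rightarrow> real \<Rightarrow> ennreal" where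
  "hook_row F \<phi> x = (\<integral>\<^sup>+y\<in>{0..\<phi> x}. ennreal (F (hook \<phi> x y)) \<partial>lborel)"

lemma hook_row_mono:
  assumes h: "\<phi> x = h" "\<phi>' x' = h"
    and le: "\<And>y. 0 < y \<Longrightarrow> y < h \<Longrightarrow> F (hook \<phi> x y) \<le> G (hook \<phi>' x' y)"
  shows "hook_row F \<phi> x \<le> hook_row G \<phi>' x'"
  unfolding hook_row_def h
proof (rule nn_integral_mono_AE)
  show "AE y in lborel. ennreal (F (hook \<phi> x y)) * indicator {0..h} y \<le> ennreal (G (hook \<phi>' x' y)) * indicator {0..h} y"
    using AE_lborel_singleton[of 0] AE_lborel_singleton[of h]
  proof eventually_elim
    case (elim y)
    show ?case
    proof (cases "0 < y \<and> y < h")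
      case True
      then show ?thesis using le[of y] by (auto intro!: mult_right_mono ennreal_leI)
    next
      case False
      then have "y \<notin> {0..h}" using elim by auto
      then show ?thesis by simp
    qed
  qed
qed

text \<open>The inverse is known to be monotone for y > 0 only. Setting it to 0 elsewhere alters the
  integrand on the row at y = 0 at most.\<close>

lemma hook_row_measurable:
  assumes a: "antimono \<phi>" and ne: "\<And>y. 0 < y \<Longrightarrow> \<exists>z\<ge>0. \<phi> z \<le> y"
  shows "hook_row (\<lambda>t. - ln t) \<phi> \<in> borel_measurable borel"
proof -
  note [measurable] = antimono_borel_measurable[OF a]
  define g where "g = (\<lambda>y. - gen_inv \<phi> y)"
  have "mono_on {0<..} g"
  proof (rule mono_onI)
    fix r s :: real assume rs: "r \<in> {0<..}" "s \<in> {0<..}" "r \<le> s"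
    have "gen_inv \<phi> s \<le> gen_inv \<phi> r" unfolding gen_inv_def
    proof (rule cInf_superset_mono)
      show "{x. 0 \<le> x \<and> \<phi> x \<le> r} \<noteq> {}" using ne[of r] rs by auto
      show "bdd_below {x. 0 \<le> x \<and> \<phi> x \<le> s}" by (auto intro: bdd_belowI[of _ 0])
    qed (use rs in auto)
    then show "g r \<le> g s" by (simp add: g_def)
  qed
  from borel_measurable_mono_on_fnc[OF this]
  have "(\<lambda>y. g y * indicator {0<..} y) \<in> borel_measurable borel"
    by (subst (asm) borel_measurable_restrict_space_iff) (auto simp: mult.commute)
  then have [measurable]: "(\<lambda>y. g y * indicator {0<..} y) \<in> borel_measurable borel" .
  let ?f = "\<lambda>x y. ennreal (- ln (\<phi> x - g y * indicator {0<..} y - x - y)) * indicator {p. 0 \<le> snd p \<and> snd p \<le> \<phi> (fst p)} (x, y)"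
  have "(\<lambda>x. \<integral>\<^sup>+y. ?f x y \<partial>lborel) \<in> borel_measurable borel" by measurable
  also have "(\<lambda>x. \<integral>\<^sup>+y. ?f x y \<partial>lborel) = hook_row (\<lambda>t. - ln t) \<phi>"
  proof
    fix x
    show "(\<integral>\<^sup>+y. ?f x y \<partial>lborel) = hook_row (\<lambda>t. - ln t) \<phi> x" unfolding hook_row_def
    proof (rule nn_integral_cong_AE)
      show "AE y in lborel. ?f x y = ennreal (- ln (hook \<phi> x y)) * indicator {0..\<phi> x} y"
        using AE_lborel_singleton[of 0] by eventually_elim (auto simp: indicator_def g_def hook_def)
    qed
  qed
  finally show ?thesis .
qed

text \<open>Cutoffs are not renormalised, since \<open>W_shape\<close> admits any mass. One-sided
  control suffices: hooks shrink, so the positive part of the cutoff's hook integral is at most that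
  of \<open>\<phi>\<close>, its negative part dominates that of \<open>\<phi>\<close> over the
  surviving rows, and its area term is smaller. Monotone convergence then recovers the negative part
  of \<open>\<phi>\<close>.\<close>

lemma W_func_ge:
  assumes q: "0 < q" "q < 1" and \<kappa>: "0 < \<kappa>" and \<phi>0: "\<phi>0 \<in> Y1"
    and B: "\<And>\<psi>. is_shape \<psi> \<Longrightarrow> 0 < mass \<psi> \<Longrightarrow> B \<le> W_shape q \<psi> x"
  shows "ereal B \<le> W_func q \<kappa> \<phi>0 x"
proof -
  define \<phi> where "\<phi> = clamp0 \<phi>0"
  have eq: "\<phi>0 z = \<phi> z" if "0 \<le> z" for z using that by (simp add: \<phi>_def clamp0_def)
  have a: "antimono \<phi>" using \<phi>0 by (auto simp: Y1_def \<phi>_def clamp0_def antimono_def monotone_on_def)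
  note [measurable] = antimono_borel_measurable[OF a]
  have nn: "0 \<le> \<phi> z" for z using \<phi>0 by (auto simp: Y1_def \<phi>_def clamp0_def)
  have i0: "set_integrable lborel {0..} \<phi>0" "(LBINT z:{0..}. \<phi>0 z) = 1" using \<phi>0 by (auto simp: Y1_def)
  have inte: "(\<lambda>z. indicator {0..} z *\<^sub>R \<phi>0 z) = (\<lambda>z. indicator {0..} z *\<^sub>R \<phi> z)"
    using eq by (auto simp: indicator_def fun_eq_iff)
  have i: "integrable lborel (\<lambda>z. indicator {0..} z * \<phi> z)" "(\<integral>z. indicator {0..} z * \<phi> z \<partial>lborel) = 1"
    using i0 inte by (auto simp: set_integrable_def set_lebesgue_integral_def)
  define N where "N = (\<lambda>n. real n + 1)"
  define m where "m = (\<lambda>n. mass (cutoff (N n) \<phi>))"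
  have N0: "0 < N n" for n by (simp add: N_def)
  have sh: "shape (N n) (cutoff (N n) \<phi>)" for n by (rule shape_cutoff[OF a nn N0])
  have m_eq: "m n = (\<integral>z. indicator {0..<N n} z * \<phi> z \<partial>lborel)" for n
  proof -
    have "(\<lambda>z. indicator {0..} z *\<^sub>R cutoff (N n) \<phi> z) = (\<lambda>z. indicator {0..<N n} z * \<phi> z)"
      by (auto simp: cutoff_def indicator_def fun_eq_iff)
    then show ?thesis by (simp add: m_def mass_def set_lebesgue_integral_def)
  qed
  have m_lim: "m \<longlonglongrightarrow> 1"
    unfolding m_eq i(2)[symmetric]
  proof (rule integral_dominated_convergence[where w="\<lambda>z. indicator {0..} z * \<phi> z"])
    show "AE z in lborel. (\<lambda>n. indicator {0..<N n} z * \<phi> z) \<longlonglongrightarrow> indicator {0..} z * \<phi> z"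
    proof (rule AE_I2)
      fix z :: real
      obtain k where k: "z < real k" using reals_Archimedean2 by blast
      have "\<forall>\<^sub>F n in sequentially. indicator {0..<N n} z * \<phi> z = indicator {0..} z * \<phi> z"
        using eventually_ge_at_top[of k]
      proof eventually_elim
        case (elim n)
        then have "z < N n" using k by (simp add: N_def)
        then show ?case by (simp add: indicator_def)
      qed
      then show "(\<lambda>n. indicator {0..<N n} z * \<phi> z) \<longlonglongrightarrow> indicator {0..} z * \<phi> z" by (rule tendsto_eventually)
    qed
    show "AE z in lborel. norm (indicator {0..<N n} z * \<phi> z) \<le> indicator {0..} z * \<phi> z" for n
      using nn by (intro AE_I2) (auto simp: indicator_def)
  qed (use i in auto)
  \<comment> \<open>Markov's inequality: a decreasing function of mass 1 satisfies
    \<open>1 / y * \<phi> (1 / y) \<le> 1\<close>, so the witness is 1/y.\<close>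
  have ne: "\<exists>z\<ge>0. \<phi> z \<le> y" if y: "0 < y" for y
  proof -
    have "(\<integral>z. indicator {0..1/y} z * \<phi> (1 / y) \<partial>lborel) \<le> (\<integral>z. indicator {0..} z * \<phi> z \<partial>lborel)"
    proof (rule integral_mono)
      fix z show "indicator {0..1/y} z * \<phi> (1 / y) \<le> indicator {0..} z * \<phi> z"
        using nn a by (auto simp: indicator_def antimono_def)
      show "integrable lborel (\<lambda>z. indicator {0..1/y} z * \<phi> (1 / y))"
        by (intro integrable_mult_left integrable_real_indicator) (auto simp: emeasure_lborel_Icc_eq)
    qed (rule i(1))
    then have "1 / y * \<phi> (1 / y) \<le> 1" using y i(2) by simp
    then have "\<phi> (1 / y) \<le> y" using y by (simp add: field_simps)
    then show ?thesis using y by (intro exI[of _ "1 / y"]) auto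
  qed
  define row where "row = hook_row (\<lambda>t. - ln t) \<phi>"
  have [measurable]: "row \<in> borel_measurable borel" unfolding row_def by (rule hook_row_measurable[OF a ne])
  define neg where "neg = (\<lambda>n. \<integral>\<^sup>+x\<in>{0..<N n}. row x \<partial>lborel)"
  have int_row: "hook_int F \<psi> = (\<integral>\<^sup>+x\<in>{0..}. hook_row F \<psi> x \<partial>lborel)" for F \<psi>
    by (simp add: hook_int_def hook_row_def)
  have pos_le: "hook_int ln (cutoff (N n) \<phi>) \<le> hook_int ln \<phi>" for n
    unfolding int_row
  proof (rule nn_integral_mono)
    fix x :: real
    have "hook_row ln (cutoff (N n) \<phi>) x \<le> hook_row ln \<phi> x" if x: "0 \<le> x"
    proof (cases "x < N n")
      case xN: True
      show ?thesis
      proof (rule hook_row_mono)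
        show "cutoff (N n) \<phi> x = \<phi> x" using xN by (simp add: cutoff_def)
        fix y assume y: "0 < y" "y < \<phi> x"
        from hook_cutoff_le[OF a nn N0 ne[OF y(1)] x xN y]
        show "ln (hook (cutoff (N n) \<phi>) x y) \<le> ln (hook \<phi> x y)" by simp
      qed simp
    next
      case False
      then have "hook_row ln (cutoff (N n) \<phi>) x \<le> hook_row (\<lambda>_. 0) (cutoff (N n) \<phi>) x"
        by (intro hook_row_mono[where h=0]) (auto simp: cutoff_def)
      then show ?thesis by (simp add: hook_row_def)
    qed
    then show "hook_row ln (cutoff (N n) \<phi>) x * indicator {0..} x \<le> hook_row ln \<phi> x * indicator {0..} x"
      by (simp add: indicator_def)
  qed
  have neg_le: "neg n \<le> hook_int (\<lambda>t. - ln t) (cutoff (N n) \<phi>)" for n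
    unfolding neg_def row_def int_row
  proof (rule nn_integral_mono)
    fix x :: real
    have "hook_row (\<lambda>t. - ln t) \<phi> x \<le> hook_row (\<lambda>t. - ln t) (cutoff (N n) \<phi>) x" if x: "0 \<le> x" "x < N n"
    proof (rule hook_row_mono)
      show "cutoff (N n) \<phi> x = \<phi> x" using x by (simp add: cutoff_def)
      fix y assume y: "0 < y" "y < \<phi> x"
      from hook_cutoff_le[OF a nn N0 ne[OF y(1)] x y]
      show "- ln (hook \<phi> x y) \<le> - ln (hook (cutoff (N n) \<phi>) x y)" by simp
    qed simp
    then show "hook_row (\<lambda>t. - ln t) \<phi> x * indicator {0..<N n} x \<le> hook_row (\<lambda>t. - ln t) (cutoff (N n) \<phi>) x * indicator {0..} x"
      by (simp add: indicator_def)
  qed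
  have neg_sup: "neg \<longlonglongrightarrow> hook_int (\<lambda>t. - ln t) \<phi>"
  proof -
    have inc: "incseq (\<lambda>n x. row x * indicator {0..<N n} x)"
      by (auto simp: incseq_def le_fun_def N_def indicator_def)
    have "(SUP n. row x * indicator {0..<N n} x) = row x * indicator {0..} x" for x
    proof (rule antisym)
      show "(SUP n. row x * indicator {0..<N n} x) \<le> row x * indicator {0..} x"
        by (rule SUP_least) (auto simp: indicator_def)
      obtain k where "x < real k" using reals_Archimedean2 by blast
      then have "row x * indicator {0..} x \<le> row x * indicator {0..<N k} x" by (simp add: N_def indicator_def)
      then show "row x * indicator {0..} x \<le> (SUP n. row x * indicator {0..<N n} x)" by (rule SUP_upper2[OF UNIV_I])
    qed
    then have "(SUP n. neg n) = (\<integral>\<^sup>+x\<in>{0..}. row x \<partial>lborel)"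
      using nn_integral_monotone_convergence_SUP[OF inc, of lborel] by (simp add: neg_def)
    then have "(SUP n. neg n) = hook_int (\<lambda>t. - ln t) \<phi>" by (simp only: row_def int_row)
    moreover have "incseq neg"
      unfolding neg_def incseq_def by (auto intro!: nn_integral_mono simp: N_def indicator_def)
    ultimately show ?thesis using LIMSEQ_SUP by metis
  qed
  define V where "V = area_above \<phi> (x / sqrt \<kappa>)"
  have W_eq: "W_func q \<kappa> \<phi>0 x = ereal (1 + \<kappa> * ln \<kappa>) + ereal (2 * \<kappa>) * I_hook \<phi> + ereal (\<kappa> * ln (1 / q) * V)"
  proof -
    have "I_hook \<phi>0 = I_hook \<phi>" by (rule I_hook_cong) (rule eq)
    moreover have "area_above \<phi>0 (x / sqrt \<kappa>) = V" unfolding V_def by (rule area_above_cong) (rule eq)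
    ultimately show ?thesis by (simp add: W_func_def V_func_area mult.assoc)
  qed
  show ?thesis
  proof (cases "hook_int ln \<phi> = \<infinity>")
    \<comment> \<open>In \<open>ereal\<close>, \<open>\<infinity>\<close> minus any value is
      \<open>\<infinity>\<close>, so the functional is infinite and the bound trivial.\<close>
    case True
    then have "I_hook \<phi> = \<infinity>" unfolding I_hook_alt by (simp add: infinity_ennreal_def top_ennreal.rep_eq top_ereal_def)
    then show ?thesis unfolding W_eq using \<kappa> by simp
  next
    case False
    then obtain \<alpha> where \<alpha>: "hook_int ln \<phi> = ennreal \<alpha>" "0 \<le> \<alpha>" by (cases "hook_int ln \<phi>") auto
    \<comment> \<open>What the bound for the cutoff of mass m leaves for the negative part of its
      hook integral. It is affine in m, so it passes to the limit m = 1.\<close>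
    define c where "c = (\<lambda>m. (1 + \<kappa> * ln \<kappa> * m + 2 * \<kappa> * \<alpha> + \<kappa> * ln (1 / q) * V - B) / (2 * \<kappa>))"
    have bound: "0 \<le> c (m n) \<and> neg n \<le> ennreal (c (m n))" if mn: "0 < m n" for n
    proof -
      let ?f = "cutoff (N n) \<phi>"
      have f: "is_shape ?f" using sh by (rule is_shapeI)
      have sk: "0 < sqrt \<kappa>" using \<kappa> by simp
      let ?\<psi> = "dilate (sqrt \<kappa>) ?f"
      have "0 < mass ?\<psi>" using dilate_mass[OF f sk] mn \<kappa> by (simp add: m_def)
      then have "B \<le> W_shape q ?\<psi> x" using B is_shape_dilate[OF f sk] by blast
      moreover have "energy ?\<psi> = \<kappa> * energy ?f + \<kappa> * ln \<kappa> * m n"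
        using dilate_energy[OF f sk] \<kappa> by (simp add: ln_sqrt m_def)
      moreover have "area_above ?\<psi> x = \<kappa> * area_above ?f (x / sqrt \<kappa>)"
        using area_above_dilate[OF is_shape_antimono[OF f] sk, of "x / sqrt \<kappa>"] \<kappa> by simp
      ultimately have 1: "B \<le> 1 + (\<kappa> * energy ?f + \<kappa> * ln \<kappa> * m n) + ln (1 / q) * (\<kappa> * area_above ?f (x / sqrt \<kappa>))"
        by (simp add: W_shape_def)
      have "area_above ?f (x / sqrt \<kappa>) \<le> V" unfolding V_def
        by (rule area_above_mono[OF is_shape_antimono[OF f] a]) (use cutoff_le[OF nn] in auto)
      then have "ln (1 / q) * (\<kappa> * area_above ?f (x / sqrt \<kappa>)) \<le> ln (1 / q) * (\<kappa> * V)"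
        using q \<kappa> by (intro mult_left_mono) auto
      with 1 have 2: "B \<le> 1 + (\<kappa> * energy ?f + \<kappa> * ln \<kappa> * m n) + ln (1 / q) * (\<kappa> * V)" by linarith
      have "ereal (energy ?f / 2) = enn2ereal (hook_int ln ?f) - enn2ereal (hook_int (\<lambda>t. - ln t) ?f)"
        using I_hook_energy[OF f] by (simp add: I_hook_alt)
      also have "\<dots> \<le> enn2ereal (hook_int ln \<phi>) - enn2ereal (neg n)"
        by (intro ereal_minus_mono) (use pos_le neg_le in \<open>auto simp: less_eq_ennreal.rep_eq[symmetric]\<close>)
      finally have 3: "ereal (energy ?f / 2) \<le> ereal \<alpha> - enn2ereal (neg n)" using \<alpha> by simp
      then obtain \<beta> where \<beta>: "neg n = ennreal \<beta>" "0 \<le> \<beta>" by (cases "neg n") (auto simp: top_ennreal.rep_eq top_ereal_def)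
      have "energy ?f / 2 \<le> \<alpha> - \<beta>" using 3 \<beta> by simp
      then have "\<kappa> * energy ?f \<le> \<kappa> * (2 * (\<alpha> - \<beta>))" using \<kappa> by (intro mult_left_mono) auto
      with 2 have "\<beta> * (2 * \<kappa>) \<le> 1 + \<kappa> * ln \<kappa> * m n + 2 * \<kappa> * \<alpha> + \<kappa> * ln (1 / q) * V - B"
        by (simp add: algebra_simps)
      then have "\<beta> \<le> c (m n)" using \<kappa> unfolding c_def by (simp add: pos_le_divide_eq)
      then show ?thesis using \<beta> by (auto intro: ennreal_leI)
    qed
    have ev: "\<forall>\<^sub>F n in sequentially. 0 < m n" using order_tendstoD(1)[OF m_lim, of 0] by simp
    have c_lim: "(\<lambda>n. c (m n)) \<longlonglongrightarrow> c 1" unfolding c_def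
      using \<kappa> by (intro tendsto_intros m_lim) auto
    \<comment> \<open>Since \<open>ennreal\<close> truncates at 0, the sign of the limit is needed
      to read the bound on the negative part back as one between real numbers.\<close>
    have c1: "0 \<le> c 1"
      by (rule tendsto_lowerbound[OF c_lim]) (use ev bound in \<open>auto elim: eventually_mono\<close>)
    have "hook_int (\<lambda>t. - ln t) \<phi> \<le> ennreal (c 1)"
      by (rule tendsto_le[OF _ tendsto_ennrealI[OF c_lim] neg_sup]) (use ev bound in \<open>auto elim: eventually_mono\<close>)
    then obtain \<beta> where \<beta>: "hook_int (\<lambda>t. - ln t) \<phi> = ennreal \<beta>" "0 \<le> \<beta>" "\<beta> \<le> c 1"
      using c1 by (cases "hook_int (\<lambda>t. - ln t) \<phi>") (auto simp: top_unique)
    have "I_hook \<phi> = ereal (\<alpha> - \<beta>)" unfolding I_hook_alt using \<alpha> \<beta> by simp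
    moreover have "B \<le> 1 + \<kappa> * ln \<kappa> + 2 * \<kappa> * (\<alpha> - \<beta>) + \<kappa> * ln (1 / q) * V"
      using \<beta>(3) \<kappa> unfolding c_def by (simp add: pos_le_divide_eq algebra_simps)
    ultimately show ?thesis unfolding W_eq by simp
  qed
qed

section \<open>Convexity and duality\<close>

lemma W_shape_nonneg: "0 < q \<Longrightarrow> q < 1 \<Longrightarrow> is_shape \<psi> \<Longrightarrow> 0 \<le> W_shape q \<psi> x"
  using energy_ge_vk[of \<psi>] energy_vk area_above_nonneg[of \<psi> x] by (simp add: W_shape_def)

lemma F_func_ge:
  assumes "0 < q" "q < 1" "\<And>\<psi>. is_shape \<psi> \<Longrightarrow> 0 < mass \<psi> \<Longrightarrow> B \<le> W_shape q \<psi> x"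
  shows "ereal B \<le> F_func q x"
  unfolding F_func_def by (intro INF_greatest W_func_ge assms) auto

definition F_real :: "real \<Rightarrow> real \<Rightarrow> real" where
  "F_real q x = real_of_ereal (F_func q x)"

context
  fixes q :: real
  assumes q: "0 < q" "q < 1"
begin

lemma F_func_real: "F_func q x = ereal (F_real q x)"
proof -
  have "ereal 0 \<le> F_func q x" by (rule F_func_ge[OF q]) (rule W_shape_nonneg[OF q])
  moreover have "F_func q x \<le> ereal (W_shape q vk_shape x)"
    by (rule F_func_le_W_shape) (auto simp: is_shape_vk mass_vk)
  ultimately show ?thesis unfolding F_real_def by (cases "F_func q x") auto
qed

lemma F_real_le: "is_shape \<psi> \<Longrightarrow> 0 < mass \<psi> \<Longrightarrow> F_real q x \<le> W_shape q \<psi> x"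
  using F_func_le_W_shape[of \<psi> q x] by (simp add: F_func_real)

lemma F_real_ge: "(\<And>\<psi>. is_shape \<psi> \<Longrightarrow> 0 < mass \<psi> \<Longrightarrow> B \<le> W_shape q \<psi> x) \<Longrightarrow> B \<le> F_real q x"
  using F_func_ge[OF q, of B x] by (simp add: F_func_real)

lemma F_real_nonneg: "0 \<le> F_real q x"
  by (intro F_real_ge W_shape_nonneg q)

lemma F_real_antimono: "antimono (F_real q)"
proof (rule antimonoI)
  fix x y :: real assume xy: "x \<le> y"
  show "F_real q y \<le> F_real q x"
  proof (rule F_real_ge)
    fix \<psi> assume \<psi>: "is_shape \<psi>" "0 < mass \<psi>"
    have "area_above \<psi> y \<le> area_above \<psi> x" by (intro area_above_mono is_shape_antimono \<psi>(1) xy) simp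
    then have "W_shape q \<psi> y \<le> W_shape q \<psi> x" unfolding W_shape_def using q by (intro add_left_mono mult_left_mono) auto
    then show "F_real q y \<le> W_shape q \<psi> x" using F_real_le[OF \<psi>, of y] by linarith
  qed
qed

lemma W_shape_convex:
  assumes "is_shape \<psi>" "is_shape \<phi>" and t: "0 < t" "t < 1"
  shows "W_shape q (\<lambda>u. (1 - t) * \<psi> u + t * \<phi> u) ((1 - t) * x + t * y) \<le> (1 - t) * W_shape q \<psi> x + t * W_shape q \<phi> y"
proof -
  have "ln (1 / q) * area_above (\<lambda>u. (1 - t) * \<psi> u + t * \<phi> u) ((1 - t) * x + t * y) \<le> ln (1 / q) * ((1 - t) * area_above \<psi> x + t * area_above \<phi> y)"
    using q assms by (intro mult_left_mono area_above_convex is_shape_antimono) auto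
  then show ?thesis using energy_convex[OF assms] unfolding W_shape_def by (simp add: algebra_simps)
qed

lemma F_real_convex: "convex_on UNIV (F_real q)"
proof (rule convex_onI)
  fix t x y :: real assume t: "0 < t" "t < 1"
  let ?z = "(1 - t) * x + t * y"
  have "F_real q ?z \<le> (1 - t) * W_shape q \<psi> x + t * W_shape q \<phi> y"
    if "is_shape \<psi>" "0 < mass \<psi>" "is_shape \<phi>" "0 < mass \<phi>" for \<psi> \<phi>
  proof -
    have "0 < mass (\<lambda>u. (1 - t) * \<psi> u + t * \<phi> u)"
      using that t by (subst mass_convex) (auto intro: add_pos_pos)
    then have "F_real q ?z \<le> W_shape q (\<lambda>u. (1 - t) * \<psi> u + t * \<phi> u) ?z"
      using is_shape_convex[OF that(1,3) t] by (rule F_real_le[rotated])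
    also have "\<dots> \<le> (1 - t) * W_shape q \<psi> x + t * W_shape q \<phi> y" by (rule W_shape_convex[OF that(1,3) t])
    finally show ?thesis .
  qed
  \<comment> \<open>The infimum is taken over one shape at a time: solving for the value at y makes
    \<open>F_real_ge\<close> applicable, and solving for the value at x does it again.\<close>
  then have "(F_real q ?z - (1 - t) * W_shape q \<psi> x) / t \<le> F_real q y"
    if "is_shape \<psi>" "0 < mass \<psi>" for \<psi>
    using that t by (intro F_real_ge) (simp add: pos_divide_le_eq algebra_simps)
  then have "(F_real q ?z - t * F_real q y) / (1 - t) \<le> F_real q x"
    using t by (intro F_real_ge) (simp add: pos_divide_le_eq algebra_simps)
  then show "F_real q ((1 - t) *\<^sub>R x + t *\<^sub>R y) \<le> (1 - t) * F_real q x + t * F_real q y"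
    using t by (simp add: pos_divide_le_eq algebra_simps)
qed simp

lemma F_real_semiconcave: "convex_on UNIV (\<lambda>x. ln (1 / q) / 2 * x\<^sup>2 - F_real q x)"
proof (rule convex_onI)
  fix t x y :: real assume t: "0 < t" "t < 1"
  define \<eta> where "\<eta> = ln (1 / q)"
  have \<eta>: "0 < \<eta>" using q by (simp add: \<eta>_def)
  define z where "z = (1 - t) * x + t * y"
  \<comment> \<open>Half the variance of a point equal to x with weight 1 - t and to y with weight
    t. Its mean is z, so the linear term with M averages out below.\<close>
  define D where "D = (1 - t) * ((x - z)\<^sup>2 / 2) + t * ((y - z)\<^sup>2 / 2)"
  have D: "D = (1 - t) * (x\<^sup>2 / 2) + t * (y\<^sup>2 / 2) - z\<^sup>2 / 2"
    unfolding D_def z_def by (simp add: power2_eq_square field_simps)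
  have "(1 - t) * F_real q x + t * F_real q y - \<eta> * D \<le> F_real q z"
  proof (rule F_real_ge)
    fix \<psi> assume \<psi>: "is_shape \<psi>" "0 < mass \<psi>"
    obtain M where M: "\<And>w. area_above \<psi> w \<le> area_above \<psi> z - M * (w - z) + (w - z)\<^sup>2 / 2"
      using area_above_semiconcave[OF is_shape_antimono[OF \<psi>(1)] is_shape_nonneg[OF \<psi>(1)]] by blast
    have "(1 - t) * area_above \<psi> x + t * area_above \<psi> y \<le>
      (1 - t) * (area_above \<psi> z - M * (x - z) + (x - z)\<^sup>2 / 2) + t * (area_above \<psi> z - M * (y - z) + (y - z)\<^sup>2 / 2)"
      using t M by (intro add_mono mult_left_mono) auto
    also have "\<dots> = area_above \<psi> z - M * ((1 - t) * x + t * y - z) + D"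
      unfolding D_def by (simp add: algebra_simps)
    also have "\<dots> = area_above \<psi> z + D" by (simp add: z_def)
    finally have "\<eta> * ((1 - t) * area_above \<psi> x + t * area_above \<psi> y) \<le> \<eta> * (area_above \<psi> z + D)"
      using \<eta> by (intro mult_left_mono) auto
    then have "(1 - t) * W_shape q \<psi> x + t * W_shape q \<psi> y \<le> W_shape q \<psi> z + \<eta> * D"
      unfolding W_shape_def \<eta>_def[symmetric] by (simp add: algebra_simps)
    moreover have "(1 - t) * F_real q x + t * F_real q y \<le> (1 - t) * W_shape q \<psi> x + t * W_shape q \<psi> y"
      using t F_real_le[OF \<psi>] by (intro add_mono mult_left_mono) auto
    ultimately show "(1 - t) * F_real q x + t * F_real q y - \<eta> * D \<le> W_shape q \<psi> z" by linarith
  qed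
  moreover have "\<eta> * D = (1 - t) * (\<eta> / 2 * x\<^sup>2) + t * (\<eta> / 2 * y\<^sup>2) - \<eta> / 2 * z\<^sup>2"
    unfolding D by (simp add: field_simps)
  ultimately show "ln (1 / q) / 2 * ((1 - t) *\<^sub>R x + t *\<^sub>R y)\<^sup>2 - F_real q ((1 - t) *\<^sub>R x + t *\<^sub>R y)
    \<le> (1 - t) * (ln (1 / q) / 2 * x\<^sup>2 - F_real q x) + t * (ln (1 / q) / 2 * y\<^sup>2 - F_real q y)"
    unfolding \<eta>_def[symmetric] real_scaleR_def z_def[symmetric] by (simp add: algebra_simps)
qed simp

lemma F_real_left: "x \<le> - x_crit q \<Longrightarrow> F_real q x = (1 - q) + ln (1 / q) * (x\<^sup>2 / 2)"
proof (rule antisym)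
  assume x: "x \<le> - x_crit q"
  have "is_shape (dilate (sqrt q) vk_shape)" "0 < mass (dilate (sqrt q) vk_shape)"
    using q by (auto simp: is_shape_dilate is_shape_vk dilate_mass mass_vk)
  from F_real_le[OF this, of x] W_shape_attained[OF q, of "- x"] x
  show "F_real q x \<le> (1 - q) + ln (1 / q) * (x\<^sup>2 / 2)" by simp
  show "(1 - q) + ln (1 / q) * (x\<^sup>2 / 2) \<le> F_real q x"
    using W_shape_lower[OF q, of _ "- x"] x by (intro F_real_ge) simp
qed

end

text \<open>Convexity gives a line below f, convexity of the second function a parabola above it,
  both touching f at x. Their gap has to be nonnegative on both sides of x, which forces equal
  slopes.\<close>

lemma convex_semiconcave_tangent:
  fixes f :: "real \<Rightarrow> real"
  assumes f: "convex_on UNIV f" and g: "convex_on UNIV (\<lambda>x. c / 2 * x\<^sup>2 - f x)" and c: "0 < c"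
  shows "\<exists>p. \<forall>y. f x + p * (y - x) \<le> f y \<and> f y \<le> f x + p * (y - x) + c / 2 * (y - x)\<^sup>2"
proof -
  have "f x + Inf ((\<lambda>t. (f x - f t) / (x - t)) ` ({x<..} \<inter> UNIV)) * (y - x) \<le> f y" for y
    by (rule convex_le_Inf_differential[OF f]) auto
  then obtain p where p: "\<And>y. f x + p * (y - x) \<le> f y" by blast
  let ?g = "\<lambda>x. c / 2 * x\<^sup>2 - f x"
  have "?g x + Inf ((\<lambda>t. (?g x - ?g t) / (x - t)) ` ({x<..} \<inter> UNIV)) * (y - x) \<le> ?g y" for y
    by (rule convex_le_Inf_differential[OF g]) auto
  then obtain s where s: "\<And>y. ?g x + s * (y - x) \<le> ?g y" by blast
  define r where "r = c * x - s"
  have r: "f y \<le> f x + r * (y - x) + c / 2 * (y - x)\<^sup>2" for y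
    using s[of y] by (simp add: r_def power2_eq_square field_simps)
  have "\<bar>p - r\<bar> \<le> 0 + e" if e: "0 < e" for e
  proof -
    \<comment> \<open>Chosen so that the quadratic term \<open>c / 2 * h\<^sup>2\<close> equals e *
      h; evaluation at x + h and x - h then bounds the difference of slopes by e.\<close>
    define h where "h = 2 * e / c"
    have h: "0 < h" "c / 2 * h = e" using e c by (auto simp: h_def)
    have e2: "c / 2 * h\<^sup>2 = e * h" using h(2) by (simp add: power2_eq_square)
    have "(p - r) * h \<le> e * h" using p[of "x + h"] r[of "x + h"] e2 by (simp add: algebra_simps)
    moreover have "(r - p) * h \<le> e * h" using p[of "x - h"] r[of "x - h"] e2 by (simp add: algebra_simps)
    ultimately show ?thesis using h(1) by auto
  qed
  then have "p = r" using field_le_epsilon[of "\<bar>p - r\<bar>" 0] by simp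
  then show ?thesis using p r by blast
qed

lemma tangent_imp_DERIV:
  fixes f :: "real \<Rightarrow> real"
  assumes p: "\<And>y. f x + p * (y - x) \<le> f y \<and> f y \<le> f x + p * (y - x) + c / 2 * (y - x)\<^sup>2" and c: "0 < c"
  shows "(f has_real_derivative p) (at x)"
  unfolding has_field_derivative_iff
proof (subst LIM_zero_iff[symmetric], rule Lim_null_comparison)
  show "\<forall>\<^sub>F y in at x. norm ((f y - f x) / (y - x) - p) \<le> c / 2 * \<bar>y - x\<bar>"
  proof (rule eventually_at_filter[THEN iffD2], rule always_eventually, intro allI impI)
    fix y assume "y \<noteq> x"
    then have d: "0 < \<bar>y - x\<bar>" by simp
    have "(f y - f x) / (y - x) - p = (f y - f x - p * (y - x)) / (y - x)" using d by (simp add: field_simps)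
    then have "norm ((f y - f x) / (y - x) - p) = \<bar>f y - f x - p * (y - x)\<bar> / \<bar>y - x\<bar>" by (simp only: real_norm_def abs_divide)
    also have "\<dots> \<le> (c / 2 * (y - x)\<^sup>2) / \<bar>y - x\<bar>" using p[of y] by (intro divide_right_mono) auto
    also have "(y - x)\<^sup>2 = \<bar>y - x\<bar> * \<bar>y - x\<bar>" by (simp flip: power2_eq_square)
    also have "c / 2 * (\<bar>y - x\<bar> * \<bar>y - x\<bar>) / \<bar>y - x\<bar> = c / 2 * \<bar>y - x\<bar>"
      using nonzero_mult_div_cancel_right[of "\<bar>y - x\<bar>" "c / 2 * \<bar>y - x\<bar>"] d by (simp only: mult.assoc)
    finally show "norm ((f y - f x) / (y - x) - p) \<le> c / 2 * \<bar>y - x\<bar>" .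
  qed
  have "((\<lambda>y. c / 2 * \<bar>y - x\<bar>) \<longlongrightarrow> c / 2 * \<bar>x - x\<bar>) (at x)" by (intro tendsto_intros)
  then show "((\<lambda>y. c / 2 * \<bar>y - x\<bar>) \<longlongrightarrow> 0) (at x)" by simp
qed

theorem theorem1p5:
  fixes q :: real
  assumes "0 < q" and "q < 1"
  shows "(\<exists>f :: real \<Rightarrow> real.
            (\<forall>x. F_func q x = ereal (f x)) \<and>
            antimono f \<and>
            (\<forall>x. 0 \<le> f x) \<and>
            convex_on UNIV f \<and>
            (\<forall>x. f differentiable (at x)) \<and>
            continuous_on UNIV (deriv f) \<and>
            (ln (1 / q))-lipschitz_on UNIV (deriv f) \<and>
            (\<exists>x\<^sub>q. \<forall>x\<le>x\<^sub>q. f x = (1 - q) + ln (1 / q) * (x\<^sup>2 / 2))) \<and>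
         (\<forall>\<mu>. Phi_minus q \<mu> \<noteq> - \<infinity>) \<and>
         (\<forall>x. F_func q x = (INF y. Phi_minus q y + ereal (ln (1 / q) / 2 * (x - y)\<^sup>2)))"
proof -
  let ?f = "F_real q"
  define c where "c = ln (1 / q)"
  have c: "0 < c" using assms by (simp add: c_def)
  have "\<forall>x. \<exists>p. \<forall>y. ?f x + p * (y - x) \<le> ?f y \<and> ?f y \<le> ?f x + p * (y - x) + c / 2 * (y - x)\<^sup>2"
    unfolding c_def
    using convex_semiconcave_tangent[OF F_real_convex[OF assms] F_real_semiconcave[OF assms]] c by (simp add: c_def)
  then obtain p where p: "\<And>x y. ?f x + p x * (y - x) \<le> ?f y \<and> ?f y \<le> ?f x + p x * (y - x) + c / 2 * (y - x)\<^sup>2"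
    by metis
  have D: "(?f has_real_derivative p x) (at x)" for x by (rule tangent_imp_DERIV[OF p c])
  have dp: "deriv ?f = p" using D by (auto simp: fun_eq_iff intro: DERIV_imp_deriv)
  have lip: "c-lipschitz_on UNIV p"
  proof (rule lipschitz_onI)
    fix x y :: real
    \<comment> \<open>Add the inequalities based at x and at y: the lower pair shows that p
      increases, the upper pair gives the constant c.\<close>
    have "0 \<le> (p y - p x) * (y - x)" "(p y - p x) * (y - x) \<le> c * (y - x)\<^sup>2"
      using p[of x y] p[of y x] by (auto simp: power2_commute[of x y] algebra_simps)
    then have "\<bar>(p y - p x) * (y - x)\<bar> \<le> c * (y - x)\<^sup>2" by simp
    then have "\<bar>p y - p x\<bar> * \<bar>y - x\<bar> \<le> (c * \<bar>y - x\<bar>) * \<bar>y - x\<bar>"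
      by (simp add: abs_mult power2_eq_square mult.assoc)
    then have "\<bar>p y - p x\<bar> \<le> c * \<bar>y - x\<bar>"
      by (cases "y = x") (auto simp: mult_le_cancel_right)
    then show "dist (p x) (p y) \<le> c * dist x y" by (simp add: dist_real_def abs_minus_commute)
  qed (use c in simp)
  have Phi: "Phi_minus q \<mu> = (SUP y. ereal (?f y - c / 2 * (\<mu> - y)\<^sup>2))" for \<mu>
    by (simp add: Phi_minus_def F_func_real[OF assms] c_def)
  have Phi_ge: "ereal (?f y - c / 2 * (\<mu> - y)\<^sup>2) \<le> Phi_minus q \<mu>" for \<mu> y
    unfolding Phi by (rule SUP_upper) simp
  have "F_func q x = (INF y. Phi_minus q y + ereal (c / 2 * (x - y)\<^sup>2))" for x
  proof (rule antisym)
    show "F_func q x \<le> (INF y. Phi_minus q y + ereal (c / 2 * (x - y)\<^sup>2))"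
    proof (rule INF_greatest)
      fix y
      have "F_func q x = ereal (?f x - c / 2 * (y - x)\<^sup>2) + ereal (c / 2 * (x - y)\<^sup>2)"
        by (simp add: F_func_real[OF assms] power2_commute)
      also have "\<dots> \<le> Phi_minus q y + ereal (c / 2 * (x - y)\<^sup>2)" by (intro add_right_mono Phi_ge)
      finally show "F_func q x \<le> Phi_minus q y + ereal (c / 2 * (x - y)\<^sup>2)" .
    qed
    \<comment> \<open>The upper tangent parabola at x has its vertex at x - d, with value
      \<open>?f x - c / 2 * d\<^sup>2\<close>; this is the point at which the infimum is
      attained.\<close>
    define d where "d = p x / c"
    have d: "p x = c * d" using c by (simp add: d_def)
    have "Phi_minus q (x - d) \<le> ereal (?f x - c / 2 * d\<^sup>2)" unfolding Phi
    proof (rule SUP_least)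
      fix y
      have "?f y \<le> ?f x + p x * (y - x) + c / 2 * (y - x)\<^sup>2" using p by blast
      also have "\<dots> = ?f x - c / 2 * d\<^sup>2 + c / 2 * ((x - d) - y)\<^sup>2"
        unfolding d by (simp add: power2_eq_square algebra_simps)
      finally show "ereal (?f y - c / 2 * ((x - d) - y)\<^sup>2) \<le> ereal (?f x - c / 2 * d\<^sup>2)" by simp
    qed
    then have "Phi_minus q (x - d) + ereal (c / 2 * (x - (x - d))\<^sup>2) \<le> ereal (?f x - c / 2 * d\<^sup>2) + ereal (c / 2 * d\<^sup>2)"
      by (intro add_mono) auto
    also have "\<dots> = F_func q x" by (simp add: F_func_real[OF assms])
    finally show "(INF y. Phi_minus q y + ereal (c / 2 * (x - y)\<^sup>2)) \<le> F_func q x"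
      by (rule INF_lower2[OF UNIV_I])
  qed
  moreover have "Phi_minus q \<mu> \<noteq> - \<infinity>" for \<mu>
    using Phi_ge[of \<mu> \<mu>] by auto
  moreover have "\<exists>f :: real \<Rightarrow> real.
            (\<forall>x. F_func q x = ereal (f x)) \<and> antimono f \<and> (\<forall>x. 0 \<le> f x) \<and> convex_on UNIV f \<and>
            (\<forall>x. f differentiable (at x)) \<and> continuous_on UNIV (deriv f) \<and> c-lipschitz_on UNIV (deriv f) \<and>
            (\<exists>x\<^sub>q. \<forall>x\<le>x\<^sub>q. f x = (1 - q) + c * (x\<^sup>2 / 2))"
  proof (intro exI[of _ ?f] conjI allI)
    show "continuous_on UNIV (deriv ?f)" unfolding dp by (rule lipschitz_on_continuous_on[OF lip])
    show "?f differentiable (at x)" for x using D[of x] real_differentiable_def by blast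
    show "\<exists>x\<^sub>q. \<forall>x\<le>x\<^sub>q. ?f x = (1 - q) + c * (x\<^sup>2 / 2)"
      using F_real_left[OF assms] unfolding c_def by blast
  qed (use lip in \<open>simp_all add: dp F_func_real[OF assms] F_real_antimono[OF assms] F_real_nonneg[OF assms] F_real_convex[OF assms]\<close>)
  ultimately show ?thesis unfolding c_def by blast
qed

end
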